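(* Let $w\in L^1(\mathbb{R}^d)\cap L^\infty(\mathbb{R}^d)$, $w\neq0$, be a non-negative function, and let $k(x,y)=\widehat{w}(x-y)$. Assume that $w$ satisfies $({\rm DC})^d_{n,a}$ for some integer $n>0$ and some $a>0$. Then for any open set $U\subset\mathbb{R}^d$ and any map $f:U\to\mathbb{R}^d$ such that $\mathcal{D}(C_f)=H_k$ and $C_f:H_k\to H_{k|_{U^2}}$ is bounded, there exists a holomorphic map $F:\mathfrak{X}_a^d\to\mathbb{C}^d$ such that $F|_U=f$.
   Context: Fourier transform: $\widehat{h}(\xi)=\int_{\mathbb{R}^d}h(x)e^{-2\pi i x\cdot\xi}\,dx$. For a positive integer $n$ and real $a\ge0$, the condition $({\rm DC})^d_{n,a}$ on $w$ is: for any $\varepsilon>0$ there exists $L_\varepsilon>0$ such that $w(\xi)\le L_\varepsilon(1+|\xi|^{2n+d+\varepsilon})^{-1}e^{-4\pi a|\xi|}$ for almost every $\xi\in\mathbb{R}^d$. For $a>0$, $\mathfrak{X}_a^d:=\{z\in\mathbb{C}^d:|{\rm Im}(z)|<a\}$. For a positive definite kernel $k$ on a set $E$, $H_k\subset\mathbb{C}^E$ is the reproducing kernel Hilbert space (RKHS) of $k$: $k_x:=k(x,\cdot)\in H_k$ and $\langle h,k_x\rangle_{H_k}=h(x)$. For $U\subset\mathbb{R}^d$, $H_{k|_{U^2}}\subset\mathbb{C}^U$ is the RKHS of the restriction of $k$ to $U\times U$. The composition operator $C_f:H_k\to H_{k|_{U^2}}$ is $C_fh=h\circ f$ with domain $\mathcal{D}(C_f)=\{h\in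 H_k:h\circ f\in H_{k|_{U^2}}\}$. *)

theory Defs
  imports "HOL-Analysis.Analysis"
begin

definition fourier :: "(real^'d \<Rightarrow> complex) \<Rightarrow> real^'d \<Rightarrow> complex" where
  "fourier h \<xi> =
     (LINT x|lebesgue. h x * exp (- (2 * of_real pi * \<i> * of_real (x \<bullet> \<xi>))))"

definition ess_bounded :: "(real^'d \<Rightarrow> real) \<Rightarrow> bool" where
  "ess_bounded w \<longleftrightarrow>
     w \<in> borel_measurable lebesgue \<and> (\<exists>C. AE \<xi> in lebesgue. \<bar>w \<xi>\<bar> \<le> C)"

definition decay_condition :: "nat \<Rightarrow> real \<Rightarrow> (real^'d \<Rightarrow> real) \<Rightarrow> bool" where
  "decay_condition n a w \<longleftrightarrow>
     (\<forall>\<epsilon>>0. \<exists>L>0. AE \<xi> in lebesgue.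
        w \<xi> \<le> L * inverse (1 + norm \<xi> powr (2 * real n + real CARD('d) + \<epsilon>))
                 * exp (- (4 * pi * a * norm \<xi>)))"

definition translation_kernel :: "(real^'d \<Rightarrow> real) \<Rightarrow> real^'d \<Rightarrow> real^'d \<Rightarrow> complex" where
  "translation_kernel w x y = fourier (\<lambda>\<xi>. of_real (w \<xi>)) (x - y)"

text \<open>The space of complex functions on a set \<open>E\<close> is encoded by the functions on the whole type
  that vanish outside \<open>E\<close>; this keeps it closed under pointwise addition and scaling.\<close>

definition zero_outside :: "'a set \<Rightarrow> ('a \<Rightarrow> complex) \<Rightarrow> 'a \<Rightarrow> complex" where
  "zero_outside E g = (\<lambda>x. if x \<in> E then g x else 0)"

definition ip_norm :: "(('a \<Rightarrow> complex) \<Rightarrow> ('a \<Rightarrow> complex) \<Rightarrow> complex) \<Rightarrow> ('a \<Rightarrow> complex) \<Rightarrow> real" where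
  "ip_norm ip g = sqrt (Re (ip g g))"

text \<open>A complex Hilbert space \<open>H\<close> of functions on \<open>E\<close>, whose inner product \<open>ip\<close> is linear in the
  first argument. Only the values of \<open>ip\<close> on \<open>H\<close> are meaningful.\<close>

locale function_hilbert_space =
  fixes E :: "'a set"
    and H :: "('a \<Rightarrow> complex) set"
    and ip :: "('a \<Rightarrow> complex) \<Rightarrow> ('a \<Rightarrow> complex) \<Rightarrow> complex"
  assumes vanish: "\<And>g x. g \<in> H \<Longrightarrow> x \<notin> E \<Longrightarrow> g x = 0"
    and zero_mem: "(\<lambda>x. 0) \<in> H"
    and add_mem: "\<And>g h. g \<in> H \<Longrightarrow> h \<in> H \<Longrightarrow> (\<lambda>x. g x + h x) \<in> H"
    and scale_mem: "\<And>c g. g \<in> H \<Longrightarrow> (\<lambda>x. c * g x) \<in> H"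
    and ip_add: "\<And>g h l. g \<in> H \<Longrightarrow> h \<in> H \<Longrightarrow> l \<in> H \<Longrightarrow>
                   ip (\<lambda>x. g x + h x) l = ip g l + ip h l"
    and ip_scale: "\<And>c g h. g \<in> H \<Longrightarrow> h \<in> H \<Longrightarrow> ip (\<lambda>x. c * g x) h = c * ip g h"
    and ip_cnj: "\<And>g h. g \<in> H \<Longrightarrow> h \<in> H \<Longrightarrow> ip h g = cnj (ip g h)"
    and ip_nonneg: "\<And>g. g \<in> H \<Longrightarrow> 0 \<le> Re (ip g g)"
    and ip_definite: "\<And>g. g \<in> H \<Longrightarrow> ip g g = 0 \<Longrightarrow> g = (\<lambda>x. 0)"
    and complete: "\<And>X. (\<And>m. X m \<in> H) \<Longrightarrow>
        (\<And>e. e > 0 \<Longrightarrow> \<exists>N. \<forall>m\<ge>N. \<forall>n\<ge>N. ip_norm ip (\<lambda>x. X m x - X n x) < e) \<Longrightarrow>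
        \<exists>g\<in>H. (\<lambda>m. ip_norm ip (\<lambda>x. X m x - g x)) \<longlonglongrightarrow> 0"

text \<open>\<open>H\<close> with inner product \<open>ip\<close> is the RKHS of the restriction of \<open>k\<close> to \<open>E \<times> E\<close>: only the
  values of \<open>k\<close> on \<open>E \<times> E\<close> enter. By the Moore-Aronszajn theorem, \<open>H\<close> and the values of \<open>ip\<close>
  on \<open>H\<close> are determined by \<open>E\<close> and \<open>k\<close>, and exist whenever \<open>k\<close> is positive definite on \<open>E\<close>.\<close>

locale rkhs = function_hilbert_space E H ip
  for E :: "'a set" and k :: "'a \<Rightarrow> 'a \<Rightarrow> complex"
    and H :: "('a \<Rightarrow> complex) set"
    and ip :: "('a \<Rightarrow> complex) \<Rightarrow> ('a \<Rightarrow> complex) \<Rightarrow> complex" +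
  assumes kernel_mem: "\<And>x. x \<in> E \<Longrightarrow> zero_outside E (k x) \<in> H"
    and reproducing: "\<And>x h. x \<in> E \<Longrightarrow> h \<in> H \<Longrightarrow> ip h (zero_outside E (k x)) = h x"

definition comp_op :: "'a set \<Rightarrow> ('a \<Rightarrow> 'b) \<Rightarrow> ('b \<Rightarrow> complex) \<Rightarrow> 'a \<Rightarrow> complex" where
  "comp_op U f h = zero_outside U (h \<circ> f)"

definition comp_dom ::
  "'a set \<Rightarrow> ('a \<Rightarrow> 'b) \<Rightarrow> ('b \<Rightarrow> complex) set \<Rightarrow> ('a \<Rightarrow> complex) set \<Rightarrow> ('b \<Rightarrow> complex) set" where
  "comp_dom U f H H' = {h \<in> H. comp_op U f h \<in> H'}"

definition bounded_on ::
  "('b \<Rightarrow> complex) set \<Rightarrow> (('b \<Rightarrow> complex) \<Rightarrow> ('b \<Rightarrow> complex) \<Rightarrow> complex) \<Rightarrow>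
   (('a \<Rightarrow> complex) \<Rightarrow> ('a \<Rightarrow> complex) \<Rightarrow> complex) \<Rightarrow>
   (('b \<Rightarrow> complex) \<Rightarrow> ('a \<Rightarrow> complex)) \<Rightarrow> bool" where
  "bounded_on D ip ip' T \<longleftrightarrow> (\<exists>C. \<forall>h\<in>D. ip_norm ip' (T h) \<le> C * ip_norm ip h)"

definition cvec :: "real^'d \<Rightarrow> complex^'d" where
  "cvec x = (\<chi> i. of_real (x $ i))"

definition tube :: "real \<Rightarrow> (complex^'d) set" where
  "tube a = {z. norm (\<chi> i. Im (z $ i)) < a}"

text \<open>Holomorphy in several variables on an open set \<open>S\<close>: the real Frechet derivative exists
  and is complex linear at every point.\<close>

definition holomorphic_map_on :: "(complex^'m \<Rightarrow> complex^'n) \<Rightarrow> (complex^'m) set \<Rightarrow> bool" where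
  "holomorphic_map_on F S \<longleftrightarrow>
     (\<forall>z\<in>S. \<exists>F'. (F has_derivative F') (at z) \<and> (\<forall>c v. F' (c *s v) = c *s F' v))"

end

theory Submission
  imports Defs "HOL-Complex_Analysis.Conformal_Mappings"
begin

text \<open>
  Let \<open>\<mu>\<close> be the measure with density \<open>w\<close>, transported by \<open>\<xi> \<mapsto> - 2 \<pi> \<xi>\<close>, and let \<open>e\<^sub>z(\<xi>) = exp (\<i> z \<cdot> \<xi>)\<close>. Then
  \<open>k(x, y) = \<integral> e\<^sub>x cnj e\<^sub>y d\<mu>\<close>, so the kernel functions may be replaced by the waves \<open>e\<^sub>x\<close> in \<open>L\<^sup>2(\<mu>)\<close>, and
  boundedness of \<open>C\<^sub>f\<close> says that \<open>T: e\<^sub>x \<mapsto> e\<^bsub>f x\<^esub>\<close>, the adjoint of \<open>C\<^sub>f\<close>, is bounded on the span of the waves with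
  \<open>x \<in> U\<close> (\<open>bounded_comp_op_kernel_bound\<close>). The decay of \<open>w\<close> gives \<open>\<mu>\<close> exponential moments, hence \<open>e\<^sub>z\<close> is
  square-integrable and depends holomorphically on \<open>z\<close> in the tube of radius \<open>a\<close>. Analytic continuation by
  power series, in steps whose length depends on \<open>a\<close> only, shows that \<open>e\<^sub>z\<close> lies in the closed span of the waves
  over \<open>U\<close> for every \<open>z\<close> in the tube (\<open>clos_tube\<close>). So \<open>G(z) = T e\<^sub>z\<close> makes sense and is holomorphic, and it is
  \<open>e\<^bsub>f x\<^esub>\<close> at \<open>x \<in> U\<close>.

  The map \<open>f\<close> is the logarithm of \<open>G\<close>, and a logarithm of \<open>G\<close> might branch. The way around this is that \<open>f\<close> is
  real: on \<open>U\<close> the inverse of \<open>G\<close> is its conjugate, so the logarithmic derivative is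
  \<open>(\<partial>\<^sub>l G) cnj G = \<i> (\<partial>\<^sub>l f \<cdot> \<xi>)\<close>. Integrating it against bounded weights \<open>\<kappa>\<^sub>j\<close> that are dual to the coordinates
  gives \<open>\<i> \<partial>\<^sub>l f\<^sub>j(x) = \<langle>\<kappa>\<^sub>j \<partial>\<^sub>l G(x), G(x)\<rangle>\<close>, and \<open>\<langle>\<kappa>\<^sub>j \<partial>\<^sub>l G(z), G(cnj z)\<rangle>\<close> is holomorphic on the whole tube
  (\<open>pairing_has_derivative\<close>). Thus the Jacobian of \<open>f\<close> extends holomorphically, and \<open>F\<close> is its radial primitive
  with a base point \<open>x0\<close> in \<open>U\<close> (\<open>radial_primitive\<close>).

  Two points need the absolute continuity of \<open>\<mu>\<close>, in the form of the Riemann-Lebesgue lemma. The first is that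
  \<open>f\<close>, an arbitrary map, is continuous: \<open>k(f x, f y)\<close> tends to \<open>k(0, 0)\<close> as \<open>x\<close> tends to \<open>y\<close>, and this forces
  \<open>f x - f y\<close> to tend to zero (\<open>tendsto_zero_of_char_fun\<close>); differentiability then follows by inverting the
  expansion of \<open>\<integral> \<kappa>\<^sub>j e\<^sub>t d\<mu>\<close> at \<open>t = 0\<close> (\<open>f_quadratic\<close>). The second is the existence of the dual weights
  (\<open>dual_weights\<close>).

  The extension agrees with \<open>f\<close> near \<open>x0\<close>. On the other components of \<open>U\<close>, agreement comes from the identity
  theorem on complex lines, applied to \<open>z \<mapsto> \<langle>G(z), G(x1)\<rangle>\<close> and to the characteristic function at \<open>F(z) - f x1\<close>
  (\<open>holomorphic_extension\<close>).
\<close>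

section \<open>Boundedness of a composition operator in terms of kernels\<close>

context function_hilbert_space
begin

lemma ip_scale_right: "g \<in> H \<Longrightarrow> h \<in> H \<Longrightarrow> ip g (\<lambda>x. c * h x) = cnj c * ip g h"
  using ip_cnj[of "\<lambda>x. c * h x" g] ip_cnj[of h g] by (simp add: scale_mem ip_scale)

lemma ip_add_right:
  "g \<in> H \<Longrightarrow> h \<in> H \<Longrightarrow> l \<in> H \<Longrightarrow> ip g (\<lambda>x. h x + l x) = ip g h + ip g l"
  using ip_cnj[of "\<lambda>x. h x + l x" g] ip_cnj[of h g] ip_cnj[of l g] by (simp add: add_mem ip_add)

lemma ip_self_real: "g \<in> H \<Longrightarrow> ip g g = of_real (Re (ip g g))"
  using ip_cnj[of g g] by (simp add: complex_eq_iff)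

lemma ip_zero_right: "g \<in> H \<Longrightarrow> ip g (\<lambda>x. 0) = 0"
  using ip_scale_right[of g g 0] by simp

lemma Cauchy_Schwarz:
  assumes g: "g \<in> H" and h: "h \<in> H"
  shows "cmod (ip g h) \<le> ip_norm ip g * ip_norm ip h"
proof (cases "ip h h = 0")
  case True
  then have "h = (\<lambda>x. 0)" using ip_definite h by blast
  then show ?thesis using ip_zero_right[OF g] ip_nonneg[OF g] ip_nonneg[OF h]
    by (simp add: ip_norm_def)
next
  case False
  define s where "s = Re (ip h h)"
  define c where "c = ip g h"
  have hh: "ip h h = of_real s" using ip_self_real[OF h] by (simp add: s_def)
  have s: "s > 0" 
  proof -
    have "s \<noteq> 0" using False hh by auto
    then show ?thesis using ip_nonneg[OF h] unfolding s_def[symmetric] by simp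
  qed
  define t where "t = - c / of_real s"
  have th: "(\<lambda>x. t * h x) \<in> H" using h by (rule scale_mem)
  have gt: "(\<lambda>x. g x + t * h x) \<in> H" using g th by (rule add_mem)
  have hg: "ip h g = cnj c" using ip_cnj[OF g h] by (simp add: c_def)
  have "ip (\<lambda>x. g x + t * h x) (\<lambda>x. g x + t * h x)
      = ip g (\<lambda>x. g x + t * h x) + t * ip h (\<lambda>x. g x + t * h x)"
    by (simp only: ip_add[OF g th gt] ip_scale[OF h gt])
  also have "ip g (\<lambda>x. g x + t * h x) = ip g g + cnj t * c"
    by (simp only: ip_add_right[OF g g th] ip_scale_right[OF g h] c_def)
  also have "ip h (\<lambda>x. g x + t * h x) = cnj c + cnj t * of_real s"
    by (simp only: ip_add_right[OF h g th] ip_scale_right[OF h h] hh hg)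
  also have "ip g g + cnj t * c + t * (cnj c + cnj t * of_real s)
      = ip g g + (cnj t * c + t * cnj c + t * cnj t * of_real s)"
    by (simp add: algebra_simps)
  also have "cnj t * c + t * cnj c + t * cnj t * of_real s = - (c * cnj c) / of_real s"
    using s by (simp add: t_def)
  finally have "ip (\<lambda>x. g x + t * h x) (\<lambda>x. g x + t * h x) = ip g g - of_real ((cmod c)^2 / s)"
    using complex_norm_square[of c] by simp
  then have "0 \<le> Re (ip g g) - (cmod c)^2 / s"
    using ip_nonneg[OF gt] by simp
  then have "(cmod c)^2 \<le> Re (ip g g) * s"
    using s by (simp add: field_simps)
  then show ?thesis
    using s ip_nonneg[OF g]
    by (simp add: ip_norm_def c_def[symmetric] s_def[symmetric] real_sqrt_mult[symmetric] real_le_rsqrt)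
qed

end

context rkhs
begin

lemma kernel_sum_mem:
  assumes "finite S" "p ` S \<subseteq> E"
  shows "(\<lambda>t. \<Sum>x\<in>S. c x * zero_outside E (k (p x)) t) \<in> H"
  using assms by (induction S rule: finite_induct) (auto intro!: zero_mem add_mem scale_mem kernel_mem)

lemma reproducing_sum:
  assumes "finite S" "p ` S \<subseteq> E" "h \<in> H"
  shows "ip h (\<lambda>t. \<Sum>x\<in>S. c x * zero_outside E (k (p x)) t) = (\<Sum>x\<in>S. cnj (c x) * h (p x))"
  using assms
proof (induction S rule: finite_induct)
  case empty
  then show ?case by (simp add: ip_zero_right)
next
  case (insert x S)
  have K: "(\<lambda>t. c x * zero_outside E (k (p x)) t) \<in> H"
    using insert by (auto intro!: scale_mem kernel_mem)
  have L: "(\<lambda>t. \<Sum>x\<in>S. c x * zero_outside E (k (p x)) t) \<in> H"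
    by (rule kernel_sum_mem) (use insert in auto)
  show ?case using insert
    by (simp add: ip_add_right[OF _ K L] ip_scale_right kernel_mem reproducing)
qed

end

text \<open>The adjoint of \<open>C\<^sub>f\<close> sends the kernel function at \<open>x\<close> to the kernel function at \<open>f x\<close>, so it maps
  \<open>p = \<Sum> c\<^sub>x k'\<^sub>x\<close> to \<open>q = \<Sum> c\<^sub>x k\<^bsub>f x\<^esub>\<close>, and the estimate is the boundedness of the adjoint on such sums,
  written in terms of the kernels. Testing \<open>C\<^sub>f\<close> on \<open>q\<close> itself gives it: the reproducing property
  turns \<open>\<langle>C\<^sub>f q, p\<rangle>\<close> into \<open>\<parallel>q\<parallel>\<^sup>2\<close>.\<close>

lemma bounded_comp_op_kernel_bound:
  assumes R: "rkhs E k H ip" and R': "rkhs U k' H' ip'"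
    and dom: "comp_dom U f H H' = H"
    and bdd: "bounded_on (comp_dom U f H H') ip ip' (comp_op U f)"
  shows "\<exists>C\<ge>0. \<forall>S c. finite S \<longrightarrow> S \<subseteq> U \<longrightarrow> f ` S \<subseteq> E \<longrightarrow>
     Re (\<Sum>x\<in>S. \<Sum>y\<in>S. c x * cnj (c y) * k (f x) (f y))
       \<le> C^2 * Re (\<Sum>x\<in>S. \<Sum>y\<in>S. c x * cnj (c y) * k' x y)"
proof -
  interpret R: rkhs E k H ip by (rule R)
  interpret R': rkhs U k' H' ip' by (rule R')
  obtain C0 where C0: "\<And>h. h \<in> H \<Longrightarrow> ip_norm ip' (comp_op U f h) \<le> C0 * ip_norm ip h"
    using bdd dom by (auto simp: bounded_on_def)
  define C where "C = max C0 0"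
  have C: "ip_norm ip' (comp_op U f h) \<le> C * ip_norm ip h" if "h \<in> H" for h
    by (rule order_trans[OF C0[OF that]])
       (auto simp: C_def ip_norm_def R.ip_nonneg that intro!: mult_right_mono)
  have mem: "comp_op U f h \<in> H'" if "h \<in> H" for h
    using dom that by (auto simp: comp_dom_def)
  show ?thesis
  proof (intro exI[of _ C] conjI allI impI)
    show "C \<ge> 0" by (simp add: C_def)
    fix S c assume S: "finite S" "S \<subseteq> U" "f ` S \<subseteq> E"
    define q where "q = (\<lambda>t. \<Sum>x\<in>S. c x * zero_outside E (k (f x)) t)"
    define p where "p = (\<lambda>t. \<Sum>x\<in>S. c x * zero_outside U (k' x) t)"
    have q: "q \<in> H" unfolding q_def using S by (intro R.kernel_sum_mem) auto
    have p: "p \<in> H'" unfolding p_def using S R'.kernel_sum_mem[of S "\<lambda>x. x" c] by auto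
    have "ip q q = (\<Sum>y\<in>S. cnj (c y) * q (f y))"
      using R.reproducing_sum[of S f q c] S q by (simp add: q_def)
    also have "\<dots> = (\<Sum>y\<in>S. \<Sum>x\<in>S. c x * cnj (c y) * k (f x) (f y))"
      using S by (auto simp: q_def zero_outside_def sum_distrib_left intro!: sum.cong)
    finally have qq: "ip q q = (\<Sum>x\<in>S. \<Sum>y\<in>S. c x * cnj (c y) * k (f x) (f y))"
      by (subst sum.swap)
    have "ip' p p = (\<Sum>y\<in>S. cnj (c y) * p y)"
      using R'.reproducing_sum[of S "\<lambda>x. x" p c] S p by (simp add: p_def)
    also have "\<dots> = (\<Sum>y\<in>S. \<Sum>x\<in>S. c x * cnj (c y) * k' x y)"
      using S by (auto simp: p_def zero_outside_def sum_distrib_left intro!: sum.cong)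
    finally have pp: "ip' p p = (\<Sum>x\<in>S. \<Sum>y\<in>S. c x * cnj (c y) * k' x y)"
      by (subst sum.swap)
    have "ip' (comp_op U f q) p = (\<Sum>y\<in>S. cnj (c y) * comp_op U f q y)"
      using R'.reproducing_sum[of S "\<lambda>x. x" "comp_op U f q" c] S mem[OF q] by (simp add: p_def)
    also have "\<dots> = (\<Sum>y\<in>S. cnj (c y) * q (f y))"
      using S by (auto simp: comp_op_def zero_outside_def intro!: sum.cong)
    also have "\<dots> = ip q q"
      using R.reproducing_sum[of S f q c] S q by (simp add: q_def)
    finally have "cmod (ip q q) \<le> ip_norm ip' (comp_op U f q) * ip_norm ip' p"
      using R'.Cauchy_Schwarz[OF mem[OF q] p] by simp
    also have "\<dots> \<le> (C * ip_norm ip q) * ip_norm ip' p"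
      using C[OF q] R'.ip_nonneg[OF p] by (intro mult_right_mono) (auto simp: ip_norm_def)
    finally have le: "cmod (ip q q) \<le> C * ip_norm ip q * ip_norm ip' p" .
    have "(ip_norm ip q)^2 = Re (ip q q)" using R.ip_nonneg[OF q] by (simp add: ip_norm_def)
    also have "\<dots> \<le> cmod (ip q q)" by (rule complex_Re_le_cmod)
    finally have "ip_norm ip q * ip_norm ip q \<le> ip_norm ip q * (C * ip_norm ip' p)"
      using le by (simp add: power2_eq_square mult_ac)
    then have "ip_norm ip q \<le> C * ip_norm ip' p"
    proof (cases "ip_norm ip q > 0")
      case True
      then show ?thesis using \<open>ip_norm ip q * ip_norm ip q \<le> _\<close> by simp
    next
      case False
      moreover have "C * ip_norm ip' p \<ge> 0"
        using R'.ip_nonneg[OF p] by (simp add: C_def ip_norm_def)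
      ultimately show ?thesis by linarith
    qed
    then have "(ip_norm ip q)^2 \<le> (C * ip_norm ip' p)^2"
      using R.ip_nonneg[OF q] by (intro power_mono) (auto simp: ip_norm_def)
    then show "Re (\<Sum>x\<in>S. \<Sum>y\<in>S. c x * cnj (c y) * k (f x) (f y))
       \<le> C^2 * Re (\<Sum>x\<in>S. \<Sum>y\<in>S. c x * cnj (c y) * k' x y)"
      using R.ip_nonneg[OF q] R'.ip_nonneg[OF p]
      by (simp add: ip_norm_def power_mult_distrib qq pp)
  qed
qed

section \<open>Square-integrable functions\<close>

definition L2 :: "'a measure \<Rightarrow> ('a \<Rightarrow> complex) set" where
  "L2 M = {g \<in> borel_measurable M. integrable M (\<lambda>x. (cmod (g x))\<^sup>2)}"

definition l2norm :: "'a measure \<Rightarrow> ('a \<Rightarrow> complex) \<Rightarrow> real" where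
  "l2norm M g = sqrt (LINT x|M. (cmod (g x))\<^sup>2)"

lemma L2_measurable: "g \<in> L2 M \<Longrightarrow> g \<in> borel_measurable M"
  by (simp add: L2_def)

lemma L2_integrable: "g \<in> L2 M \<Longrightarrow> integrable M (\<lambda>x. (cmod (g x))\<^sup>2)"
  by (simp add: L2_def)

lemma l2norm_nonneg [simp]: "l2norm M g \<ge> 0"
  by (simp add: l2norm_def)

lemma l2norm_square: "(l2norm M g)\<^sup>2 = (LINT x|M. (cmod (g x))\<^sup>2)"
  by (simp add: l2norm_def)

lemma L2_dominated:
  assumes "g \<in> borel_measurable M" "integrable M (\<lambda>x. (G x)\<^sup>2)" "\<And>x. cmod (g x) \<le> G x"
  shows "g \<in> L2 M"
    and "l2norm M g \<le> sqrt (LINT x|M. (G x)\<^sup>2)"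
proof -
  have le: "(cmod (g x))\<^sup>2 \<le> (G x)\<^sup>2" for x
    using assms(3)[of x] by (intro power_mono) auto
  have "integrable M (\<lambda>x. (cmod (g x))\<^sup>2)"
    by (rule Bochner_Integration.integrable_bound[OF assms(2)]) (use assms(1) le in auto)
  then show "g \<in> L2 M" using assms(1) by (simp add: L2_def)
  show "l2norm M g \<le> sqrt (LINT x|M. (G x)\<^sup>2)"
    unfolding l2norm_def real_sqrt_le_iff
    by (rule integral_mono) (use \<open>integrable M (\<lambda>x. (cmod (g x))\<^sup>2)\<close> assms(2) le in auto)
qed

lemma L2_integrable_mult:
  assumes g: "g \<in> L2 M" and h: "h \<in> L2 M"
  shows "integrable M (\<lambda>x. cmod (g x) * cmod (h x))"
proof (rule Bochner_Integration.integrable_bound)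
  show "integrable M (\<lambda>x. (cmod (g x))\<^sup>2 + (cmod (h x))\<^sup>2)"
    using g h by (auto simp: L2_def)
  show "(\<lambda>x. cmod (g x) * cmod (h x)) \<in> borel_measurable M"
    using g h by (auto simp: L2_def)
  have "cmod (g x) * cmod (h x) \<le> (cmod (g x))\<^sup>2 + (cmod (h x))\<^sup>2" for x

  proof -
    have "0 \<le> cmod (g x) * cmod (h x)" by simp
    then show ?thesis using sum_squares_bound[of "cmod (g x)" "cmod (h x)"] by linarith
  qed
  then show "AE x in M. norm (cmod (g x) * cmod (h x)) \<le> norm ((cmod (g x))\<^sup>2 + (cmod (h x))\<^sup>2)"
    by (auto simp: norm_mult)
qed

text \<open>The quadratic polynomial \<open>t \<mapsto> \<integral> (|g| - t |h|)\<^sup>2\<close> is non-negative; the minimising \<open>t\<close> gives the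
  inequality.\<close>

lemma L2_Cauchy_Schwarz:
  assumes g: "g \<in> L2 M" and h: "h \<in> L2 M"
  shows "(LINT x|M. cmod (g x) * cmod (h x)) \<le> l2norm M g * l2norm M h"
proof -
  define A where "A = (LINT x|M. (cmod (g x))\<^sup>2)"
  define B where "B = (LINT x|M. (cmod (h x))\<^sup>2)"
  define X where "X = (LINT x|M. cmod (g x) * cmod (h x))"
  note [simp] = L2_integrable[OF g] L2_integrable[OF h] L2_integrable_mult[OF g h]
  have pos: "A \<ge> 0" "B \<ge> 0" "X \<ge> 0" by (auto simp: A_def B_def X_def)
  have quad: "0 \<le> A - 2 * t * X + t\<^sup>2 * B" for t
  proof -
    have "0 \<le> (LINT x|M. (cmod (g x) - t * cmod (h x))\<^sup>2)" by simp
    also have "\<dots> = (LINT x|M. (cmod (g x))\<^sup>2 - 2 * t * (cmod (g x) * cmod (h x)) + t\<^sup>2 * (cmod (h x))\<^sup>2)"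
      by (intro Bochner_Integration.integral_cong) (auto simp: power2_eq_square algebra_simps)
    also have "\<dots> = A - 2 * t * X + t\<^sup>2 * B" by (simp add: A_def B_def X_def)
    finally show ?thesis .
  qed
  have "X\<^sup>2 \<le> A * B"
  proof (cases "B = 0")
    case True
    \<comment> \<open>With vanishing leading coefficient, a large \<open>t\<close> would make the polynomial negative.\<close>
    have "A - 2 * ((A + 1) / X) * X < 0" if "X \<noteq> 0" using that pos by simp
    then have "X = 0" using quad[of "(A + 1) / X"] True by fastforce
    then show ?thesis using True by simp
  next
    case False
    have "0 \<le> A - 2 * (X / B) * X + (X / B)\<^sup>2 * B" by (rule quad)
    also have "\<dots> = A - X\<^sup>2 / B" using False by (simp add: power2_eq_square)
    finally show ?thesis using False pos by (simp add: field_simps)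
  qed
  then have "X \<le> sqrt (A * B)" by (rule real_le_rsqrt)
  then show ?thesis by (simp add: l2norm_def A_def B_def X_def real_sqrt_mult)
qed

lemma L2_add: assumes g: "g \<in> L2 M" and h: "h \<in> L2 M" shows "(\<lambda>x. g x + h x) \<in> L2 M"
proof -
  note [simp] = L2_integrable[OF g] L2_integrable[OF h] L2_integrable_mult[OF g h]
  have "integrable M (\<lambda>x. (cmod (g x + h x))\<^sup>2)"
  proof (rule Bochner_Integration.integrable_bound)
    show "integrable M (\<lambda>x. (cmod (g x))\<^sup>2 + 2 * (cmod (g x) * cmod (h x)) + (cmod (h x))\<^sup>2)" by simp
    show "(\<lambda>x. (cmod (g x + h x))\<^sup>2) \<in> borel_measurable M"
      using L2_measurable[OF g] L2_measurable[OF h] by measurable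
    have "(cmod (g x + h x))\<^sup>2 \<le> (cmod (g x) + cmod (h x))\<^sup>2" for x
      by (intro power_mono norm_triangle_ineq) auto
    then show "AE x in M. norm ((cmod (g x + h x))\<^sup>2)
        \<le> norm ((cmod (g x))\<^sup>2 + 2 * (cmod (g x) * cmod (h x)) + (cmod (h x))\<^sup>2)"
      by (auto simp: power2_sum algebra_simps)
  qed
  then show ?thesis using g h by (auto simp: L2_def)
qed

lemma L2_scale: "g \<in> L2 M \<Longrightarrow> (\<lambda>x. c * g x) \<in> L2 M"
  by (auto simp: L2_def norm_mult power_mult_distrib)

lemma L2_diff: "g \<in> L2 M \<Longrightarrow> h \<in> L2 M \<Longrightarrow> (\<lambda>x. g x - h x) \<in> L2 M"
  using L2_add[of g M "\<lambda>x. (- 1) * h x"] L2_scale[of h M "- 1"] by simp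

lemma L2_zero: "(\<lambda>x. 0) \<in> L2 M"
  by (simp add: L2_def)

lemma L2_sum: "(\<And>i. i \<in> I \<Longrightarrow> g i \<in> L2 M) \<Longrightarrow> (\<lambda>x. \<Sum>i\<in>I. g i x) \<in> L2 M"
  by (induction I rule: infinite_finite_induct) (auto intro: L2_add L2_zero)

lemma l2norm_scale: "l2norm M (\<lambda>x. c * g x) = cmod c * l2norm M g"
  by (simp add: l2norm_def norm_mult power_mult_distrib real_sqrt_mult)

lemma l2norm_diff_commute: "l2norm M (\<lambda>x. g x - h x) = l2norm M (\<lambda>x. h x - g x)"
  by (simp add: l2norm_def norm_minus_commute)

lemma l2norm_add:
  assumes g: "g \<in> L2 M" and h: "h \<in> L2 M"
  shows "l2norm M (\<lambda>x. g x + h x) \<le> l2norm M g + l2norm M h"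
proof -
  note [simp] = L2_integrable[OF g] L2_integrable[OF h] L2_integrable_mult[OF g h]
  have "(LINT x|M. (cmod (g x + h x))\<^sup>2)
      \<le> (LINT x|M. (cmod (g x))\<^sup>2 + 2 * (cmod (g x) * cmod (h x)) + (cmod (h x))\<^sup>2)"
  proof (rule integral_mono)
    fix x
    have "(cmod (g x + h x))\<^sup>2 \<le> (cmod (g x) + cmod (h x))\<^sup>2"
      by (intro power_mono norm_triangle_ineq) auto
    then show "(cmod (g x + h x))\<^sup>2 \<le> (cmod (g x))\<^sup>2 + 2 * (cmod (g x) * cmod (h x)) + (cmod (h x))\<^sup>2"
      by (auto simp: power2_sum algebra_simps)
  qed (use L2_add[OF g h] in \<open>auto simp: L2_def\<close>)
  also have "\<dots> = (l2norm M g)\<^sup>2 + 2 * (LINT x|M. cmod (g x) * cmod (h x)) + (l2norm M h)\<^sup>2"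
    by (simp add: l2norm_square)
  also have "\<dots> \<le> (l2norm M g)\<^sup>2 + 2 * (l2norm M g * l2norm M h) + (l2norm M h)\<^sup>2"
    using L2_Cauchy_Schwarz[OF g h] by simp
  also have "\<dots> = (l2norm M g + l2norm M h)\<^sup>2" by (simp add: power2_sum)
  finally show ?thesis unfolding l2norm_def[of M "\<lambda>x. g x + h x"]
    by (intro real_le_lsqrt) auto
qed

lemma l2norm_diff_triangle:
  assumes "g \<in> L2 M" "h \<in> L2 M" "l \<in> L2 M"
  shows "l2norm M (\<lambda>x. g x - l x) \<le> l2norm M (\<lambda>x. g x - h x) + l2norm M (\<lambda>x. h x - l x)"
  using l2norm_add[OF L2_diff[OF assms(1,2)] L2_diff[OF assms(2,3)]] by simp

lemma borel_measurable_cnj: "g \<in> borel_measurable M \<Longrightarrow> (\<lambda>x. cnj (g x)) \<in> borel_measurable M"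
  using borel_measurable_continuous_onI[of cnj] measurable_compose[of g M borel cnj borel]
  by (simp add: continuous_on_cnj continuous_on_id)

lemma L2_form_integrable:
  assumes g: "g \<in> L2 M" and h: "h \<in> L2 M"
    and \<kappa>: "\<kappa> \<in> borel_measurable M" "\<And>x. cmod (\<kappa> x) \<le> K"
  shows "integrable M (\<lambda>x. \<kappa> x * g x * cnj (h x))"
proof (rule Bochner_Integration.integrable_bound)
  show "integrable M (\<lambda>x. K * (cmod (g x) * cmod (h x)))"
    using L2_integrable_mult[OF g h] by simp
  show "(\<lambda>x. \<kappa> x * g x * cnj (h x)) \<in> borel_measurable M"
    using \<kappa>(1) L2_measurable[OF g] borel_measurable_cnj[OF L2_measurable[OF h]] by measurable
  have "K \<ge> 0" using \<kappa>(2) norm_ge_zero order_trans by blast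
  then show "AE x in M. norm (\<kappa> x * g x * cnj (h x)) \<le> norm (K * (cmod (g x) * cmod (h x)))"
    using \<kappa>(2) by (auto simp: norm_mult mult.assoc intro!: mult_right_mono)
qed

lemma L2_form_bound:
  assumes g: "g \<in> L2 M" and h: "h \<in> L2 M"
    and \<kappa>: "\<kappa> \<in> borel_measurable M" "\<And>x. cmod (\<kappa> x) \<le> K"
  shows "cmod (LINT x|M. \<kappa> x * g x * cnj (h x)) \<le> K * (l2norm M g * l2norm M h)"
proof -
  have "K \<ge> 0" using \<kappa>(2) norm_ge_zero order_trans by blast
  have "cmod (LINT x|M. \<kappa> x * g x * cnj (h x)) \<le> (LINT x|M. cmod (\<kappa> x * g x * cnj (h x)))"
    by (rule integral_norm_bound)
  also have "\<dots> \<le> (LINT x|M. K * (cmod (g x) * cmod (h x)))"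
  proof (rule integral_mono)
    show "integrable M (\<lambda>x. cmod (\<kappa> x * g x * cnj (h x)))"
      using L2_form_integrable[OF assms] by (rule integrable_norm)
    show "integrable M (\<lambda>x. K * (cmod (g x) * cmod (h x)))"
      using L2_integrable_mult[OF g h] by simp
    show "cmod (\<kappa> x * g x * cnj (h x)) \<le> K * (cmod (g x) * cmod (h x))" for x
      using \<kappa>(2) by (auto simp: norm_mult mult.assoc intro!: mult_right_mono)
  qed
  also have "\<dots> \<le> K * (l2norm M g * l2norm M h)"
    using L2_Cauchy_Schwarz[OF g h] \<open>K \<ge> 0\<close> by (simp add: mult_left_mono)
  finally show ?thesis .
qed

section \<open>Extension of bounded forms to a closed span\<close>

definition bounded_weight :: "'a measure \<Rightarrow> ('a \<Rightarrow> complex) \<Rightarrow> bool" where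
  "bounded_weight M \<kappa> \<longleftrightarrow> \<kappa> \<in> borel_measurable M \<and> (\<exists>K. \<forall>\<xi>. cmod (\<kappa> \<xi>) \<le> K)"

definition weighted_form :: "'a measure \<Rightarrow> ('a \<Rightarrow> complex) \<Rightarrow> ('a \<Rightarrow> complex) \<Rightarrow> ('a \<Rightarrow> complex) \<Rightarrow> complex"
  where "weighted_form M \<kappa> g h = (LINT \<xi>|M. \<kappa> \<xi> * g \<xi> * cnj (h \<xi>))"

lemma weighted_form_simps:
  assumes "bounded_weight M \<kappa>" "g \<in> L2 M" "g' \<in> L2 M" "h \<in> L2 M"
  shows "weighted_form M \<kappa> (\<lambda>x. g x + g' x) h = weighted_form M \<kappa> g h + weighted_form M \<kappa> g' h"
    and "weighted_form M \<kappa> (\<lambda>x. g x - g' x) h = weighted_form M \<kappa> g h - weighted_form M \<kappa> g' h"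
    and "weighted_form M \<kappa> h (\<lambda>x. g x + g' x) = weighted_form M \<kappa> h g + weighted_form M \<kappa> h g'"
    and "weighted_form M \<kappa> h (\<lambda>x. g x - g' x) = weighted_form M \<kappa> h g - weighted_form M \<kappa> h g'"
proof -
  obtain K where K: "\<kappa> \<in> borel_measurable M" "\<And>\<xi>. cmod (\<kappa> \<xi>) \<le> K"
    using assms by (auto simp: bounded_weight_def)
  note I = L2_form_integrable[OF _ _ K]
  note [simp] = I[OF assms(2,4)] I[OF assms(3,4)] I[OF assms(4,2)] I[OF assms(4,3)]
  show "weighted_form M \<kappa> (\<lambda>x. g x + g' x) h = weighted_form M \<kappa> g h + weighted_form M \<kappa> g' h"
    and "weighted_form M \<kappa> (\<lambda>x. g x - g' x) h = weighted_form M \<kappa> g h - weighted_form M \<kappa> g' h"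
    and "weighted_form M \<kappa> h (\<lambda>x. g x + g' x) = weighted_form M \<kappa> h g + weighted_form M \<kappa> h g'"
    and "weighted_form M \<kappa> h (\<lambda>x. g x - g' x) = weighted_form M \<kappa> h g - weighted_form M \<kappa> h g'"
    by (simp_all add: weighted_form_def distrib_left distrib_right left_diff_distrib right_diff_distrib)
qed

lemma weighted_form_scale:
  "weighted_form M \<kappa> (\<lambda>x. c * g x) h = c * weighted_form M \<kappa> g h"
  "weighted_form M \<kappa> g (\<lambda>x. c * h x) = cnj c * weighted_form M \<kappa> g h"
proof -
  have "weighted_form M \<kappa> (\<lambda>x. c * g x) h = (LINT x|M. c * (\<kappa> x * g x * cnj (h x)))"
    unfolding weighted_form_def by (rule Bochner_Integration.integral_cong) auto
  then show "weighted_form M \<kappa> (\<lambda>x. c * g x) h = c * weighted_form M \<kappa> g h"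
    by (simp add: weighted_form_def)
  have "weighted_form M \<kappa> g (\<lambda>x. c * h x) = (LINT x|M. cnj c * (\<kappa> x * g x * cnj (h x)))"
    unfolding weighted_form_def by (rule Bochner_Integration.integral_cong) auto
  then show "weighted_form M \<kappa> g (\<lambda>x. c * h x) = cnj c * weighted_form M \<kappa> g h"
    by (simp add: weighted_form_def)
qed

text \<open>The map \<open>e\<^sub>x \<mapsto> u\<^sub>x\<close> between two families of square-integrable functions is bounded on linear
  combinations. It therefore induces a bounded operator from the closed span of the family \<open>e\<close>, and
  the sesquilinear forms \<open>\<langle>\<kappa> T m, T m'\<rangle>\<close> with bounded weights \<open>\<kappa>\<close> are all that will be evaluated.
  Extending these forms by continuity, instead of the operator \<open>T\<close>, only involves limits of complex
  numbers.\<close>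

locale l2_transfer =
  fixes M :: "'a measure" and U :: "'i set" and e u :: "'i \<Rightarrow> 'a \<Rightarrow> complex" and C :: real
  assumes e_L2: "\<And>x. x \<in> U \<Longrightarrow> e x \<in> L2 M"
    and u_L2: "\<And>x. x \<in> U \<Longrightarrow> u x \<in> L2 M"
    and C_nonneg: "0 \<le> C"
    and transfer_bound: "\<And>S c. finite S \<Longrightarrow> S \<subseteq> U \<Longrightarrow>
       l2norm M (\<lambda>\<xi>. \<Sum>x\<in>S. c x * u x \<xi>) \<le> C * l2norm M (\<lambda>\<xi>. \<Sum>x\<in>S. c x * e x \<xi>)"
begin

text \<open>A relation, because a combination may have several
  representations; the bound makes the image unique only up to a null set.\<close>

definition graph :: "(('a \<Rightarrow> complex) \<times> ('a \<Rightarrow> complex)) set" where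
  "graph = {(p, q). \<exists>S c. finite S \<and> S \<subseteq> U \<and>
     p = (\<lambda>\<xi>. \<Sum>x\<in>S. c x * e x \<xi>) \<and> q = (\<lambda>\<xi>. \<Sum>x\<in>S. c x * u x \<xi>)}"

lemma graph_L2: "(p, q) \<in> graph \<Longrightarrow> p \<in> L2 M" "(p, q) \<in> graph \<Longrightarrow> q \<in> L2 M"
  by (auto simp: graph_def intro!: L2_sum L2_scale e_L2 u_L2)

lemma graph_bound: "(p, q) \<in> graph \<Longrightarrow> l2norm M q \<le> C * l2norm M p"
  using transfer_bound by (auto simp: graph_def)

lemma graph_single: "x \<in> U \<Longrightarrow> (e x, u x) \<in> graph"
  unfolding graph_def by (auto intro!: exI[of _ "{x}"] exI[of _ "\<lambda>_. 1"])

lemma graph_scale: assumes "(p, q) \<in> graph" shows "(\<lambda>\<xi>. a * p \<xi>, \<lambda>\<xi>. a * q \<xi>) \<in> graph"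
proof -
  obtain S c where "finite S" "S \<subseteq> U" "p = (\<lambda>\<xi>. \<Sum>x\<in>S. c x * e x \<xi>)" "q = (\<lambda>\<xi>. \<Sum>x\<in>S. c x * u x \<xi>)"
    using assms by (auto simp: graph_def)
  then show ?thesis
    unfolding graph_def by (auto simp: sum_distrib_left mult.assoc intro!: exI[of _ S] exI[of _ "\<lambda>x. a * c x"])
qed

lemma graph_add:
  assumes "(p, q) \<in> graph" "(p', q') \<in> graph"
  shows "(\<lambda>\<xi>. p \<xi> + p' \<xi>, \<lambda>\<xi>. q \<xi> + q' \<xi>) \<in> graph"
proof -
  obtain S c where S: "finite S" "S \<subseteq> U" "p = (\<lambda>\<xi>. \<Sum>x\<in>S. c x * e x \<xi>)" "q = (\<lambda>\<xi>. \<Sum>x\<in>S. c x * u x \<xi>)"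
    using assms(1) by (auto simp: graph_def)
  obtain T d where T: "finite T" "T \<subseteq> U" "p' = (\<lambda>\<xi>. \<Sum>x\<in>T. d x * e x \<xi>)" "q' = (\<lambda>\<xi>. \<Sum>x\<in>T. d x * u x \<xi>)"
    using assms(2) by (auto simp: graph_def)
  define b where "b = (\<lambda>x. (if x \<in> S then c x else 0) + (if x \<in> T then d x else 0))"
  have "(\<Sum>x\<in>S \<union> T. b x * v x \<xi>) = (\<Sum>x\<in>S. c x * v x \<xi>) + (\<Sum>x\<in>T. d x * v x \<xi>)"
    for v :: "'i \<Rightarrow> 'a \<Rightarrow> complex" and \<xi>
  proof -
    have "(\<Sum>x\<in>S \<union> T. (if x \<in> S then c x else 0) * v x \<xi>) = (\<Sum>x\<in>S. c x * v x \<xi>)"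
      using S T by (intro sum.mono_neutral_cong_right) auto
    moreover have "(\<Sum>x\<in>S \<union> T. (if x \<in> T then d x else 0) * v x \<xi>) = (\<Sum>x\<in>T. d x * v x \<xi>)"
      using S T by (intro sum.mono_neutral_cong_right) auto
    ultimately show ?thesis by (simp add: b_def distrib_right sum.distrib)
  qed
  then show ?thesis using S T
    unfolding graph_def by (auto intro!: exI[of _ "S \<union> T"] exI[of _ b])
qed

lemma graph_diff:
  assumes "(p, q) \<in> graph" "(p', q') \<in> graph"
  shows "(\<lambda>\<xi>. p \<xi> - p' \<xi>, \<lambda>\<xi>. q \<xi> - q' \<xi>) \<in> graph"
  using graph_add[OF assms(1) graph_scale[OF assms(2), of "- 1"]] by simp

definition clos :: "('a \<Rightarrow> complex) set" where
  "clos = {m \<in> L2 M. \<forall>\<epsilon>>0. \<exists>p q. (p, q) \<in> graph \<and> l2norm M (\<lambda>\<xi>. m \<xi> - p \<xi>) < \<epsilon>}"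

definition approx :: "('a \<Rightarrow> complex) \<Rightarrow> (nat \<Rightarrow> 'a \<Rightarrow> complex) \<Rightarrow> (nat \<Rightarrow> 'a \<Rightarrow> complex) \<Rightarrow> bool" where
  "approx m P Q \<longleftrightarrow> (\<forall>n. (P n, Q n) \<in> graph) \<and> (\<lambda>n. l2norm M (\<lambda>\<xi>. m \<xi> - P n \<xi>)) \<longlonglongrightarrow> 0"

lemma approx_L2: assumes "approx m P Q" shows "P n \<in> L2 M" "Q n \<in> L2 M"
proof -
  have "(P n, Q n) \<in> graph" using assms by (simp add: approx_def)
  then show "P n \<in> L2 M" "Q n \<in> L2 M" by (rule graph_L2)+
qed

lemma clos_L2: "m \<in> clos \<Longrightarrow> m \<in> L2 M"
  by (simp add: clos_def)

lemma approx_exists: assumes "m \<in> clos" shows "\<exists>P Q. approx m P Q"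
proof -
  have "\<exists>p q. (p, q) \<in> graph \<and> l2norm M (\<lambda>\<xi>. m \<xi> - p \<xi>) < inverse (real (Suc n))" for n
    using assms by (simp add: clos_def)
  then obtain P Q where PQ: "\<And>n. (P n, Q n) \<in> graph"
    "\<And>n. l2norm M (\<lambda>\<xi>. m \<xi> - P n \<xi>) < inverse (real (Suc n))" by metis
  have "(\<lambda>n. l2norm M (\<lambda>\<xi>. m \<xi> - P n \<xi>)) \<longlonglongrightarrow> 0"
    by (rule tendsto_sandwich[OF _ _ tendsto_const LIMSEQ_inverse_real_of_nat])
       (use PQ(2) in \<open>auto intro!: always_eventually intro: less_imp_le simp del: of_nat_Suc\<close>)
  then show ?thesis using PQ(1) by (auto simp: approx_def)
qed

lemma approx_clos: assumes "m \<in> L2 M" "approx m P Q" shows "m \<in> clos"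
proof -
  have "\<exists>p q. (p, q) \<in> graph \<and> l2norm M (\<lambda>\<xi>. m \<xi> - p \<xi>) < \<epsilon>" if "\<epsilon> > 0" for \<epsilon>
  proof -
    have "\<forall>\<^sub>F n in sequentially. l2norm M (\<lambda>\<xi>. m \<xi> - P n \<xi>) < \<epsilon>"
      using assms(2) that unfolding approx_def by (auto elim: order_tendstoD)
    then show ?thesis using assms(2) unfolding approx_def eventually_sequentially by blast
  qed
  then show ?thesis using assms(1) by (simp add: clos_def)
qed

lemma approx_add:
  assumes m: "m \<in> L2 M" "m' \<in> L2 M" and a: "approx m P Q" "approx m' P' Q'"
  shows "approx (\<lambda>\<xi>. m \<xi> + m' \<xi>) (\<lambda>n \<xi>. P n \<xi> + P' n \<xi>) (\<lambda>n \<xi>. Q n \<xi> + Q' n \<xi>)"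
proof -
  have "l2norm M (\<lambda>\<xi>. m \<xi> + m' \<xi> - (P n \<xi> + P' n \<xi>))
      \<le> l2norm M (\<lambda>\<xi>. m \<xi> - P n \<xi>) + l2norm M (\<lambda>\<xi>. m' \<xi> - P' n \<xi>)" for n
  proof -
    note approx_L2(1)[OF a(1)] approx_L2(1)[OF a(2)]
    then have "l2norm M (\<lambda>\<xi>. (m \<xi> - P n \<xi>) + (m' \<xi> - P' n \<xi>))
      \<le> l2norm M (\<lambda>\<xi>. m \<xi> - P n \<xi>) + l2norm M (\<lambda>\<xi>. m' \<xi> - P' n \<xi>)"
      by (intro l2norm_add L2_diff m)
    then show ?thesis by (simp add: algebra_simps)
  qed
  then have "\<forall>\<^sub>F n in sequentially. norm (l2norm M (\<lambda>\<xi>. m \<xi> + m' \<xi> - (P n \<xi> + P' n \<xi>)))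
      \<le> l2norm M (\<lambda>\<xi>. m \<xi> - P n \<xi>) + l2norm M (\<lambda>\<xi>. m' \<xi> - P' n \<xi>)"
    by simp
  moreover have "(\<lambda>n. l2norm M (\<lambda>\<xi>. m \<xi> - P n \<xi>) + l2norm M (\<lambda>\<xi>. m' \<xi> - P' n \<xi>)) \<longlonglongrightarrow> 0"
    using a by (intro tendsto_add_zero) (auto simp: approx_def)
  ultimately have "(\<lambda>n. l2norm M (\<lambda>\<xi>. m \<xi> + m' \<xi> - (P n \<xi> + P' n \<xi>))) \<longlonglongrightarrow> 0"
    by (rule Lim_null_comparison)
  then show ?thesis using a by (auto simp: approx_def graph_add)
qed

lemma approx_scale:
  assumes a: "approx m P Q"
  shows "approx (\<lambda>\<xi>. c * m \<xi>) (\<lambda>n \<xi>. c * P n \<xi>) (\<lambda>n \<xi>. c * Q n \<xi>)"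
proof -
  have "(\<lambda>n. cmod c * l2norm M (\<lambda>\<xi>. m \<xi> - P n \<xi>)) \<longlonglongrightarrow> cmod c * 0"
    using a by (intro tendsto_intros) (auto simp: approx_def)
  then show ?thesis using a
    by (auto simp: approx_def graph_scale right_diff_distrib[symmetric] l2norm_scale)
qed

lemma approx_single: "x \<in> U \<Longrightarrow> approx (e x) (\<lambda>_. e x) (\<lambda>_. u x)"
  by (simp add: approx_def graph_single l2norm_def)

lemma clos_add: assumes m: "m \<in> clos" "m' \<in> clos" shows "(\<lambda>\<xi>. m \<xi> + m' \<xi>) \<in> clos"
proof -
  obtain P Q P' Q' where "approx m P Q" "approx m' P' Q'" using approx_exists m by meson
  then show ?thesis
    by (rule approx_clos[OF L2_add[OF clos_L2 clos_L2, OF m] approx_add[OF clos_L2 clos_L2, OF m]])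
qed

lemma clos_scale: assumes m: "m \<in> clos" shows "(\<lambda>\<xi>. c * m \<xi>) \<in> clos"
proof -
  obtain P Q where "approx m P Q" using approx_exists m by meson
  then show ?thesis by (rule approx_clos[OF L2_scale[OF clos_L2[OF m]] approx_scale])
qed

lemma clos_diff: "m \<in> clos \<Longrightarrow> m' \<in> clos \<Longrightarrow> (\<lambda>\<xi>. m \<xi> - m' \<xi>) \<in> clos"
  using clos_add[of m "\<lambda>\<xi>. (- 1) * m' \<xi>"] clos_scale[of m' "- 1"] by simp

lemma clos_single: "x \<in> U \<Longrightarrow> e x \<in> clos"
  using approx_single approx_clos e_L2 by blast

lemma clos_zero: "(\<lambda>\<xi>. 0) \<in> clos"
proof -
  have "((\<lambda>\<xi>. 0), (\<lambda>\<xi>. 0)) \<in> graph" unfolding graph_def by (auto intro!: exI[of _ "{}"])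
  then show ?thesis by (auto intro!: approx_clos[of _ "\<lambda>_ _. 0" "\<lambda>_ _. 0"] simp: approx_def L2_zero l2norm_def)
qed

lemma clos_sum: "(\<And>i. i \<in> I \<Longrightarrow> g i \<in> clos) \<Longrightarrow> (\<lambda>x. \<Sum>i\<in>I. g i x) \<in> clos"
  by (induction I rule: infinite_finite_induct) (auto intro: clos_add clos_zero)

text \<open>Stated for an arbitrary filter, so that it serves both the partial sums of a series and
  difference quotients.\<close>

lemma clos_closed:
  assumes m: "m \<in> L2 M" and ne: "F \<noteq> bot"
    and g: "\<forall>\<^sub>F t in F. g t \<in> clos" and lim: "((\<lambda>t. l2norm M (\<lambda>\<xi>. m \<xi> - g t \<xi>)) \<longlongrightarrow> 0) F"
  shows "m \<in> clos"
  unfolding clos_def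
proof (safe intro!: m)
  fix \<epsilon> :: real assume \<epsilon>: "\<epsilon> > 0"
  have "\<forall>\<^sub>F t in F. l2norm M (\<lambda>\<xi>. m \<xi> - g t \<xi>) < \<epsilon> / 2"
    using order_tendstoD(2)[OF lim, of "\<epsilon> / 2"] \<epsilon> by simp
  then have "\<forall>\<^sub>F t in F. g t \<in> clos \<and> l2norm M (\<lambda>\<xi>. m \<xi> - g t \<xi>) < \<epsilon> / 2"
    using g by eventually_elim auto
  then obtain t where t: "g t \<in> clos" "l2norm M (\<lambda>\<xi>. m \<xi> - g t \<xi>) < \<epsilon> / 2"
    using eventually_happens'[OF ne] by blast
  obtain p q where pq: "(p, q) \<in> graph" "l2norm M (\<lambda>\<xi>. g t \<xi> - p \<xi>) < \<epsilon> / 2"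
    using t(1) \<epsilon> half_gt_zero[OF \<epsilon>] unfolding clos_def by blast
  have "l2norm M (\<lambda>\<xi>. m \<xi> - p \<xi>) < \<epsilon>"
    using l2norm_diff_triangle[OF m clos_L2[OF t(1)] graph_L2(1)[OF pq(1)]] t(2) pq(2) by linarith
  then show "\<exists>p q. (p, q) \<in> graph \<and> l2norm M (\<lambda>\<xi>. m \<xi> - p \<xi>) < \<epsilon>" using pq(1) by blast
qed

text \<open>Both arguments of the form are replaced one after the other; the distances to \<open>m\<close> and \<open>m'\<close> control
  the change. This is the uniform continuity from which the existence and the uniqueness of the
  limits follow.\<close>

lemma weighted_form_graph_diff:
  assumes K: "\<kappa> \<in> borel_measurable M" "\<And>\<xi>. cmod (\<kappa> \<xi>) \<le> K"
    and g: "(p, q) \<in> graph" "(s, r) \<in> graph" "(p', q') \<in> graph" "(s', r') \<in> graph"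
    and m: "m \<in> L2 M" "m' \<in> L2 M"
    and d: "l2norm M (\<lambda>\<xi>. m \<xi> - s \<xi>) \<le> 1" "l2norm M (\<lambda>\<xi>. m' \<xi> - p' \<xi>) \<le> 1"
  shows "cmod (weighted_form M \<kappa> q q' - weighted_form M \<kappa> r r')
    \<le> K * C\<^sup>2 * (l2norm M m + l2norm M m' + 1) *
       (l2norm M (\<lambda>\<xi>. m \<xi> - p \<xi>) + l2norm M (\<lambda>\<xi>. m \<xi> - s \<xi>)
        + l2norm M (\<lambda>\<xi>. m' \<xi> - p' \<xi>) + l2norm M (\<lambda>\<xi>. m' \<xi> - s' \<xi>))"
proof -
  have K0: "K \<ge> 0" using K(2) norm_ge_zero order_trans by blast
  have bw: "bounded_weight M \<kappa>" using K by (auto simp: bounded_weight_def)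
  note L = graph_L2[OF g(1)] graph_L2[OF g(2)] graph_L2[OF g(3)] graph_L2[OF g(4)]
  have b: "cmod (weighted_form M \<kappa> q q') \<le> K * C\<^sup>2 * (l2norm M p * l2norm M p')"
    if "(p, q) \<in> graph" "(p', q') \<in> graph" for p q p' q'
  proof -
    have "cmod (weighted_form M \<kappa> q q') \<le> K * (l2norm M q * l2norm M q')"
      unfolding weighted_form_def by (rule L2_form_bound) (use that graph_L2 K in auto)
    also have "\<dots> \<le> K * ((C * l2norm M p) * (C * l2norm M p'))"
      using graph_bound[OF that(1)] graph_bound[OF that(2)] K0 C_nonneg
      by (intro mult_left_mono mult_mono) auto
    finally show ?thesis by (simp add: power2_eq_square mult_ac)
  qed
  have tri: "l2norm M (\<lambda>\<xi>. a \<xi> - b \<xi>) \<le> l2norm M (\<lambda>\<xi>. v \<xi> - a \<xi>) + l2norm M (\<lambda>\<xi>. v \<xi> - b \<xi>)"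
    if "a \<in> L2 M" "b \<in> L2 M" "v \<in> L2 M" for a b v
    using l2norm_diff_triangle[OF that(1,3,2)] by (simp add: l2norm_diff_commute[of M a v])
  have nb: "l2norm M a \<le> l2norm M v + l2norm M (\<lambda>\<xi>. v \<xi> - a \<xi>)"
    if "a \<in> L2 M" "v \<in> L2 M" for a v
    using l2norm_diff_triangle[OF that L2_zero] by (simp add: l2norm_diff_commute[of M a v])
  have "weighted_form M \<kappa> q q' - weighted_form M \<kappa> r r'
      = weighted_form M \<kappa> (\<lambda>\<xi>. q \<xi> - r \<xi>) q' + weighted_form M \<kappa> r (\<lambda>\<xi>. q' \<xi> - r' \<xi>)"
    using L by (simp add: weighted_form_simps[OF bw])
  also have "cmod \<dots> \<le> K * C\<^sup>2 * (l2norm M (\<lambda>\<xi>. p \<xi> - s \<xi>) * l2norm M p')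
      + K * C\<^sup>2 * (l2norm M s * l2norm M (\<lambda>\<xi>. p' \<xi> - s' \<xi>))"
    by (intro norm_triangle_mono b graph_diff g)
  also have "\<dots> \<le> K * C\<^sup>2 * ((l2norm M (\<lambda>\<xi>. m \<xi> - p \<xi>) + l2norm M (\<lambda>\<xi>. m \<xi> - s \<xi>)) * (l2norm M m + l2norm M m' + 1))
      + K * C\<^sup>2 * ((l2norm M m + l2norm M m' + 1) * (l2norm M (\<lambda>\<xi>. m' \<xi> - p' \<xi>) + l2norm M (\<lambda>\<xi>. m' \<xi> - s' \<xi>)))"
  proof (intro add_mono mult_left_mono mult_mono)
    show "l2norm M p' \<le> l2norm M m + l2norm M m' + 1"
      using nb[OF L(5) m(2)] d l2norm_nonneg[of M m] by linarith
    show "l2norm M s \<le> l2norm M m + l2norm M m' + 1"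
      using nb[OF L(3) m(1)] d l2norm_nonneg[of M m'] by linarith
  qed (use tri[OF L(1,3) m(1)] tri[OF L(5,7) m(2)] K0 in auto)
  finally show ?thesis by (simp add: algebra_simps)
qed

definition ext_form :: "('a \<Rightarrow> complex) \<Rightarrow> ('a \<Rightarrow> complex) \<Rightarrow> ('a \<Rightarrow> complex) \<Rightarrow> complex" where
  "ext_form \<kappa> m m' = (SOME L. \<forall>P Q P' Q'. approx m P Q \<longrightarrow> approx m' P' Q' \<longrightarrow>
      (\<lambda>n. weighted_form M \<kappa> (Q n) (Q' n)) \<longlonglongrightarrow> L)"

lemma ext_form_tendsto:
  assumes bw: "bounded_weight M \<kappa>" and m: "m \<in> clos" "m' \<in> clos"
    and a: "approx m P Q" "approx m' P' Q'"
  shows "(\<lambda>n. weighted_form M \<kappa> (Q n) (Q' n)) \<longlonglongrightarrow> ext_form \<kappa> m m'"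
proof -
  obtain K where K: "\<kappa> \<in> borel_measurable M" "\<And>\<xi>. cmod (\<kappa> \<xi>) \<le> K"
    using bw by (auto simp: bounded_weight_def)
  have K0: "K \<ge> 0" using K(2) norm_ge_zero order_trans by blast
  define D where "D = K * C\<^sup>2 * (l2norm M m + l2norm M m' + 1) + 1"
  have D: "D > 0" using K0 by (auto simp: D_def intro!: add_nonneg_pos mult_nonneg_nonneg)
  \<comment> \<open>With equal sequences this is the Cauchy property, with equal indices the uniqueness of the limit.\<close>
  have close: "\<exists>N. \<forall>n\<ge>N. \<forall>k\<ge>N. dist (weighted_form M \<kappa> (Q n) (Q' n)) (weighted_form M \<kappa> (R k) (R' k)) < \<epsilon>"
    if ap: "approx m P Q" "approx m' P' Q'" "approx m S R" "approx m' S' R'" and \<epsilon>: "\<epsilon> > 0"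
    for P Q P' Q' S R S' R' \<epsilon>
  proof -
    define \<delta> where "\<delta> = min 1 (\<epsilon> / (5 * D))"
    have \<delta>: "\<delta> > 0" "\<delta> \<le> 1" "\<delta> \<le> \<epsilon> / (5 * D)" using \<epsilon> D by (auto simp: \<delta>_def)
    have "\<forall>\<^sub>F n in sequentially. l2norm M (\<lambda>\<xi>. m \<xi> - P n \<xi>) < \<delta> \<and> l2norm M (\<lambda>\<xi>. m' \<xi> - P' n \<xi>) < \<delta>
        \<and> l2norm M (\<lambda>\<xi>. m \<xi> - S n \<xi>) < \<delta> \<and> l2norm M (\<lambda>\<xi>. m' \<xi> - S' n \<xi>) < \<delta>"
      using ap \<delta>(1) unfolding approx_def
      by (intro eventually_conj) (auto elim: order_tendstoD(2))
    then obtain N where N: "\<And>n. n \<ge> N \<Longrightarrow> l2norm M (\<lambda>\<xi>. m \<xi> - P n \<xi>) < \<delta> \<and> l2norm M (\<lambda>\<xi>. m' \<xi> - P' n \<xi>) < \<delta>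
        \<and> l2norm M (\<lambda>\<xi>. m \<xi> - S n \<xi>) < \<delta> \<and> l2norm M (\<lambda>\<xi>. m' \<xi> - S' n \<xi>) < \<delta>"
      unfolding eventually_sequentially by blast
    show ?thesis
    proof (intro exI[of _ N] allI impI)
      fix n k assume nk: "N \<le> n" "N \<le> k"
      have "cmod (weighted_form M \<kappa> (Q n) (Q' n) - weighted_form M \<kappa> (R k) (R' k))
        \<le> K * C\<^sup>2 * (l2norm M m + l2norm M m' + 1) *
       (l2norm M (\<lambda>\<xi>. m \<xi> - P n \<xi>) + l2norm M (\<lambda>\<xi>. m \<xi> - S k \<xi>)
        + l2norm M (\<lambda>\<xi>. m' \<xi> - P' n \<xi>) + l2norm M (\<lambda>\<xi>. m' \<xi> - S' k \<xi>))"
        by (rule weighted_form_graph_diff[OF K])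
           (use ap m N[OF nk(1)] N[OF nk(2)] \<delta>(2) in \<open>auto simp: approx_def clos_L2\<close>)
      also have "\<dots> \<le> D * (\<delta> + \<delta> + \<delta> + \<delta>)"
        using N[OF nk(1)] N[OF nk(2)] D by (intro mult_mono add_mono) (auto simp: D_def)
      also have "\<dots> < D * (5 * \<delta>)" using \<delta> D by simp
      also have "\<dots> \<le> \<epsilon>" using \<delta>(3) D by (simp add: field_simps)
      finally show "dist (weighted_form M \<kappa> (Q n) (Q' n)) (weighted_form M \<kappa> (R k) (R' k)) < \<epsilon>"
        by (simp add: dist_norm)
    qed
  qed
  have "Cauchy (\<lambda>n. weighted_form M \<kappa> (Q n) (Q' n))"
    unfolding Cauchy_def using close[OF a a] by blast
  then obtain L where L: "(\<lambda>n. weighted_form M \<kappa> (Q n) (Q' n)) \<longlonglongrightarrow> L"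
    using Cauchy_convergent convergentD by blast
  have all: "\<forall>P Q P' Q'. approx m P Q \<longrightarrow> approx m' P' Q' \<longrightarrow>
      (\<lambda>n. weighted_form M \<kappa> (Q n) (Q' n)) \<longlonglongrightarrow> L"
  proof (intro allI impI)
    fix S R S' R' assume ap: "approx m S R" "approx m' S' R'"
    have "(\<lambda>n. weighted_form M \<kappa> (R n) (R' n) - weighted_form M \<kappa> (Q n) (Q' n)) \<longlonglongrightarrow> 0"
    proof (rule LIMSEQ_I)
      fix \<epsilon> :: real assume "\<epsilon> > 0"
      from close[OF a ap this] obtain N where N: "\<And>n k. n \<ge> N \<Longrightarrow> k \<ge> N \<Longrightarrow>
          dist (weighted_form M \<kappa> (Q n) (Q' n)) (weighted_form M \<kappa> (R k) (R' k)) < \<epsilon>" by blast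
      show "\<exists>N. \<forall>n\<ge>N. norm (weighted_form M \<kappa> (R n) (R' n) - weighted_form M \<kappa> (Q n) (Q' n) - 0) < \<epsilon>"
        using N[of n n for n] by (intro exI[of _ N]) (simp add: dist_norm norm_minus_commute)
    qed
    from tendsto_add[OF this L] show "(\<lambda>n. weighted_form M \<kappa> (R n) (R' n)) \<longlonglongrightarrow> L"
      by simp
  qed
  then have "\<forall>P Q P' Q'. approx m P Q \<longrightarrow> approx m' P' Q' \<longrightarrow>
      (\<lambda>n. weighted_form M \<kappa> (Q n) (Q' n)) \<longlonglongrightarrow> ext_form \<kappa> m m'"
    unfolding ext_form_def by (rule someI)
  then show ?thesis using a by blast
qed

lemma ext_form_single:
  assumes "bounded_weight M \<kappa>" "x \<in> U" "y \<in> U"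
  shows "ext_form \<kappa> (e x) (e y) = weighted_form M \<kappa> (u x) (u y)"
  using ext_form_tendsto[OF assms(1) clos_single clos_single approx_single approx_single] assms(2,3)
  by (simp add: LIMSEQ_const_iff)

lemma ext_form_eqI:
  assumes "bounded_weight M \<kappa>" "m \<in> clos" "l \<in> clos" "approx m P Q" "approx l R S"
    and "(\<lambda>n. weighted_form M \<kappa> (Q n) (S n)) \<longlonglongrightarrow> L"
  shows "ext_form \<kappa> m l = L"
  using ext_form_tendsto[OF assms(1-5)] assms(6) by (rule LIMSEQ_unique)

lemma ext_form_add:
  assumes bw: "bounded_weight M \<kappa>" and m: "m \<in> clos" "m' \<in> clos" "l \<in> clos"
  shows ext_form_add_left: "ext_form \<kappa> (\<lambda>\<xi>. m \<xi> + m' \<xi>) l = ext_form \<kappa> m l + ext_form \<kappa> m' l"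
    and ext_form_add_right: "ext_form \<kappa> l (\<lambda>\<xi>. m \<xi> + m' \<xi>) = ext_form \<kappa> l m + ext_form \<kappa> l m'"
proof -
  obtain P Q P' Q' R S where a: "approx m P Q" "approx m' P' Q'" "approx l R S"
    using approx_exists m by meson
  have q: "Q n \<in> L2 M" "Q' n \<in> L2 M" "S n \<in> L2 M" for n using approx_L2 a by blast+
  note sum = approx_add[OF clos_L2[OF m(1)] clos_L2[OF m(2)] a(1,2)]
  show "ext_form \<kappa> (\<lambda>\<xi>. m \<xi> + m' \<xi>) l = ext_form \<kappa> m l + ext_form \<kappa> m' l"
    by (rule ext_form_eqI[OF bw clos_add[OF m(1,2)] m(3) sum a(3)], unfold weighted_form_simps(1)[OF bw q])
       (rule tendsto_add[OF ext_form_tendsto[OF bw m(1,3) a(1,3)] ext_form_tendsto[OF bw m(2,3) a(2,3)]])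
  show "ext_form \<kappa> l (\<lambda>\<xi>. m \<xi> + m' \<xi>) = ext_form \<kappa> l m + ext_form \<kappa> l m'"
    by (rule ext_form_eqI[OF bw m(3) clos_add[OF m(1,2)] a(3) sum], unfold weighted_form_simps(3)[OF bw q])
       (rule tendsto_add[OF ext_form_tendsto[OF bw m(3,1) a(3,1)] ext_form_tendsto[OF bw m(3,2) a(3,2)]])
qed

lemma ext_form_scale:
  assumes bw: "bounded_weight M \<kappa>" and m: "m \<in> clos" "l \<in> clos"
  shows ext_form_scale_left: "ext_form \<kappa> (\<lambda>\<xi>. c * m \<xi>) l = c * ext_form \<kappa> m l"
    and ext_form_scale_right: "ext_form \<kappa> l (\<lambda>\<xi>. c * m \<xi>) = cnj c * ext_form \<kappa> l m"
proof -
  obtain P Q R S where a: "approx m P Q" "approx l R S"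
    using approx_exists m by meson
  show "ext_form \<kappa> (\<lambda>\<xi>. c * m \<xi>) l = c * ext_form \<kappa> m l"
    by (rule ext_form_eqI[OF bw clos_scale[OF m(1)] m(2) approx_scale[OF a(1)] a(2)], unfold weighted_form_scale)
       (rule tendsto_mult[OF tendsto_const ext_form_tendsto[OF bw m a]])
  show "ext_form \<kappa> l (\<lambda>\<xi>. c * m \<xi>) = cnj c * ext_form \<kappa> l m"
    by (rule ext_form_eqI[OF bw m(2) clos_scale[OF m(1)] a(2) approx_scale[OF a(1)]], unfold weighted_form_scale)
       (rule tendsto_mult[OF tendsto_const ext_form_tendsto[OF bw m(2,1) a(2,1)]])
qed

lemma l2norm_approx:
  assumes "m \<in> L2 M" "approx m P Q"
  shows "(\<lambda>n. l2norm M (P n)) \<longlonglongrightarrow> l2norm M m"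
proof -
  have P: "P n \<in> L2 M" for n using approx_L2 assms(2) by blast
  have "\<bar>l2norm M (P n) - l2norm M m\<bar> \<le> l2norm M (\<lambda>\<xi>. m \<xi> - P n \<xi>)" for n
    using l2norm_diff_triangle[OF P[of n] assms(1) L2_zero] l2norm_diff_triangle[OF assms(1) P[of n] L2_zero]
      l2norm_diff_commute[of M "P n" m] by (simp add: abs_le_iff)
  then have "\<forall>\<^sub>F n in sequentially. norm (l2norm M (P n) - l2norm M m) \<le> l2norm M (\<lambda>\<xi>. m \<xi> - P n \<xi>)"
    by simp
  then have "(\<lambda>n. l2norm M (P n) - l2norm M m) \<longlonglongrightarrow> 0"
    by (rule Lim_null_comparison) (use assms(2) in \<open>simp add: approx_def\<close>)
  then show ?thesis by (simp add: LIM_zero_iff)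
qed

lemma ext_form_bound:
  assumes bw: "bounded_weight M \<kappa>"
  shows "\<exists>K\<ge>0. \<forall>m\<in>clos. \<forall>l\<in>clos. cmod (ext_form \<kappa> m l) \<le> K * (l2norm M m * l2norm M l)"
proof -
  obtain K where K: "\<kappa> \<in> borel_measurable M" "\<And>\<xi>. cmod (\<kappa> \<xi>) \<le> K"
    using bw by (auto simp: bounded_weight_def)
  have K0: "K \<ge> 0" using K(2) norm_ge_zero order_trans by blast
  show ?thesis
  proof (intro exI[of _ "K * C\<^sup>2"] conjI ballI)
    show "K * C\<^sup>2 \<ge> 0" using K0 by simp
    fix m l assume m: "m \<in> clos" "l \<in> clos"
    obtain P Q R S where a: "approx m P Q" "approx l R S"
      using approx_exists m by meson
    show "cmod (ext_form \<kappa> m l) \<le> K * C\<^sup>2 * (l2norm M m * l2norm M l)"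
    proof (rule LIMSEQ_le[OF tendsto_norm[OF ext_form_tendsto[OF bw m a]]])
      show "(\<lambda>n. K * C\<^sup>2 * (l2norm M (P n) * l2norm M (R n))) \<longlonglongrightarrow> K * C\<^sup>2 * (l2norm M m * l2norm M l)"
        using m a clos_L2 by (intro tendsto_intros l2norm_approx) auto
      have "cmod (weighted_form M \<kappa> (Q n) (S n)) \<le> K * C\<^sup>2 * (l2norm M (P n) * l2norm M (R n))" for n
      proof -
        have g: "(P n, Q n) \<in> graph" "(R n, S n) \<in> graph" using a by (auto simp: approx_def)
        have "cmod (weighted_form M \<kappa> (Q n) (S n)) \<le> K * (l2norm M (Q n) * l2norm M (S n))"
          unfolding weighted_form_def by (rule L2_form_bound) (use g graph_L2 K in auto)
        also have "\<dots> \<le> K * ((C * l2norm M (P n)) * (C * l2norm M (R n)))"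
          using graph_bound[OF g(1)] graph_bound[OF g(2)] K0 C_nonneg
          by (intro mult_left_mono mult_mono) auto
        finally show ?thesis by (simp add: power2_eq_square mult_ac)
      qed
      then show "\<exists>N. \<forall>n\<ge>N. cmod (weighted_form M \<kappa> (Q n) (S n)) \<le> K * C\<^sup>2 * (l2norm M (P n) * l2norm M (R n))"
        by blast
    qed
  qed
qed

end

section \<open>Exponential waves under exponential moments\<close>

definition cdot :: "complex^'d \<Rightarrow> real^'d \<Rightarrow> complex" where
  "cdot z \<xi> = (\<Sum>l\<in>UNIV. z $ l * of_real (\<xi> $ l))"

definition exp_wave :: "complex^'d \<Rightarrow> real^'d \<Rightarrow> complex" where
  "exp_wave z \<xi> = exp (\<i> * cdot z \<xi>)"

definition im_vec :: "complex^'d \<Rightarrow> real^'d" where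
  "im_vec z = (\<chi> l. Im (z $ l))"

definition cnj_vec :: "complex^'d \<Rightarrow> complex^'d" where
  "cnj_vec z = (\<chi> l. cnj (z $ l))"

lemma tube_im_vec: "tube a = {z. norm (im_vec z) < a}"
  by (simp add: tube_def im_vec_def)

lemma cdot_add [simp]: "cdot (z + w) \<xi> = cdot z \<xi> + cdot w \<xi>"
  by (simp add: cdot_def sum.distrib distrib_right)

lemma cdot_scale [simp]: "cdot (c *s z) \<xi> = c * cdot z \<xi>"
  by (simp add: cdot_def sum_distrib_left mult.assoc)

lemma cdot_scaleR [simp]: "cdot (t *\<^sub>R z) \<xi> = of_real t * cdot z \<xi>"
  unfolding cdot_def sum_distrib_left vector_scaleR_component
  by (auto simp: scaleR_conv_of_real[where 'a=complex] mult.assoc intro!: sum.cong)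

lemma cdot_cvec [simp]: "cdot (cvec x) \<xi> = of_real (x \<bullet> \<xi>)"
  by (simp add: cdot_def cvec_def inner_vec_def)

lemma Im_cdot: "Im (cdot z \<xi>) = im_vec z \<bullet> \<xi>"
  by (simp add: cdot_def im_vec_def inner_vec_def)

lemma norm_cdot_le: "cmod (cdot z \<xi>) \<le> norm z * norm \<xi>"
proof -
  have "cmod (cdot z \<xi>) \<le> (\<Sum>l\<in>UNIV. cmod (z $ l) * \<bar>\<xi> $ l\<bar>)"
    unfolding cdot_def by (rule order_trans[OF norm_sum]) (simp add: norm_mult)
  also have "\<dots> \<le> norm z * norm \<xi>"
    using L2_set_mult_ineq[of "\<lambda>l. cmod (z $ l)" "\<lambda>l. \<xi> $ l" UNIV] by (simp add: norm_vec_def L2_set_def)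
  finally show ?thesis .
qed

lemma cdot_measurable [measurable]: "cdot z \<in> borel_measurable borel"
proof -
  have "continuous_on UNIV (cdot z)" unfolding cdot_def[abs_def] by (intro continuous_intros)
  then show ?thesis by (rule borel_measurable_continuous_onI)
qed

lemma exp_wave_measurable [measurable]: "exp_wave z \<in> borel_measurable borel"
  unfolding exp_wave_def[abs_def] by measurable

lemma exp_wave_add: "exp_wave (z + w) \<xi> = exp_wave z \<xi> * exp_wave w \<xi>"
  by (simp add: exp_wave_def distrib_left exp_add)

lemma cnj_exp_wave_cvec: "cnj (exp_wave (cvec x) \<xi>) = exp_wave (cvec (- x)) \<xi>"
  by (simp add: exp_wave_def exp_cnj)

lemma cmod_exp_wave_cvec [simp]: "cmod (exp_wave (cvec x) \<xi>) = 1"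
  by (simp add: exp_wave_def)

lemma cmod_exp_wave_le: "cmod (exp_wave z \<xi>) \<le> exp (norm (im_vec z) * norm \<xi>)"
proof -
  have "cmod (exp_wave z \<xi>) = exp (- (im_vec z \<bullet> \<xi>))"
    by (simp add: exp_wave_def Im_cdot)
  also have "\<dots> \<le> exp (norm (im_vec z) * norm \<xi>)"
    using Cauchy_Schwarz_ineq2[of "im_vec z" \<xi>] by (simp add: abs_le_iff)
  finally show ?thesis .
qed

lemma cvec_add: "cvec (x + y) = cvec x + cvec y"
  by (simp add: cvec_def vec_eq_iff)

lemma cvec_scaleR: "cvec (t *\<^sub>R x) = t *\<^sub>R cvec x"
  unfolding cvec_def vec_eq_iff vector_scaleR_component by (simp add: scaleR_conv_of_real[where 'a=complex])

lemma cvec_diff: "cvec (x - y) = cvec x - cvec y"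
  by (simp add: cvec_def vec_eq_iff)

lemma norm_cvec [simp]: "norm (cvec x) = norm x"
  by (simp add: cvec_def norm_vec_def)

lemma im_vec_cvec [simp]: "im_vec (cvec x) = 0"
  by (simp add: cvec_def im_vec_def vec_eq_iff)

lemma im_vec_add: "im_vec (z + w) = im_vec z + im_vec w"
  by (simp add: im_vec_def vec_eq_iff)

lemma norm_im_vec_le: "norm (im_vec z) \<le> norm z"
  unfolding norm_vec_def im_vec_def
  by (rule L2_set_mono) (auto simp: abs_Im_le_cmod)

lemma norm_cnj_vec [simp]: "norm (cnj_vec z) = norm z"
  by (simp add: cnj_vec_def norm_vec_def)

lemma cnj_vec_add: "cnj_vec (z + w) = cnj_vec z + cnj_vec w"
  by (simp add: cnj_vec_def vec_eq_iff)

lemma cnj_vec_cvec [simp]: "cnj_vec (cvec x) = cvec x"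
  by (simp add: cnj_vec_def cvec_def vec_eq_iff)

lemma im_vec_cnj_vec: "im_vec (cnj_vec z) = - im_vec z"
  by (simp add: cnj_vec_def im_vec_def vec_eq_iff)

lemma cnj_vec_tube [simp]: "cnj_vec z \<in> tube a \<longleftrightarrow> z \<in> tube a"
  by (simp add: tube_im_vec im_vec_cnj_vec)

text \<open>Subexponential factors: multiplying by them keeps all the exponential moments below a given
  rate, so the polynomial factors produced by differentiation cost nothing.\<close>

definition subexp :: "(real^'d \<Rightarrow> complex) \<Rightarrow> bool" where
  "subexp P \<longleftrightarrow> P \<in> borel_measurable borel \<and>
     (\<forall>\<delta>>0. \<exists>K\<ge>0. \<forall>\<xi>. cmod (P \<xi>) \<le> K * exp (\<delta> * norm \<xi>))"

lemma subexp_measurable: "subexp P \<Longrightarrow> P \<in> borel_measurable borel"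
  by (simp add: subexp_def)

lemma subexp_one [simp]: "subexp (\<lambda>_. 1)"
  unfolding subexp_def by (auto intro!: exI[of _ 1])

lemma subexp_cdot [simp]: "subexp (cdot w)"
  unfolding subexp_def
proof (intro conjI allI impI)
  fix \<delta> :: real assume \<delta>: "\<delta> > 0"
  have "cmod (cdot w \<xi>) \<le> norm w / \<delta> * exp (\<delta> * norm \<xi>)" for \<xi>
  proof -
    have "cmod (cdot w \<xi>) \<le> norm w / \<delta> * (\<delta> * norm \<xi>)"
      using norm_cdot_le[of w \<xi>] \<delta> by simp
    also have "\<dots> \<le> norm w / \<delta> * exp (\<delta> * norm \<xi>)"
    proof (rule mult_left_mono)
      show "\<delta> * norm \<xi> \<le> exp (\<delta> * norm \<xi>)"
        using exp_ge_add_one_self[of "\<delta> * norm \<xi>"] by linarith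
    qed (use \<delta> in simp)
    finally show ?thesis .
  qed
  then show "\<exists>K\<ge>0. \<forall>\<xi>. cmod (cdot w \<xi>) \<le> K * exp (\<delta> * norm \<xi>)"
    using \<delta> by (intro exI[of _ "norm w / \<delta>"]) auto
qed simp

lemma subexp_mult: assumes "subexp P" "subexp Q" shows "subexp (\<lambda>\<xi>. P \<xi> * Q \<xi>)"
  unfolding subexp_def
proof (intro conjI allI impI)
  show "(\<lambda>\<xi>. P \<xi> * Q \<xi>) \<in> borel_measurable borel"
    using assms by (auto simp: subexp_def)
  fix \<delta> :: real assume \<delta>: "\<delta> > 0"
  obtain K where K: "K \<ge> 0" "\<And>\<xi>. cmod (P \<xi>) \<le> K * exp (\<delta> / 2 * norm \<xi>)"
    using assms(1) half_gt_zero[OF \<delta>] unfolding subexp_def by blast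
  obtain L where L: "L \<ge> 0" "\<And>\<xi>. cmod (Q \<xi>) \<le> L * exp (\<delta> / 2 * norm \<xi>)"
    using assms(2) half_gt_zero[OF \<delta>] unfolding subexp_def by blast
  have "cmod (P \<xi> * Q \<xi>) \<le> K * L * exp (\<delta> * norm \<xi>)" for \<xi>
  proof -
    have "cmod (P \<xi> * Q \<xi>) \<le> (K * exp (\<delta> / 2 * norm \<xi>)) * (L * exp (\<delta> / 2 * norm \<xi>))"
      unfolding norm_mult using K L by (intro mult_mono) auto
    also have "\<dots> = K * L * exp (\<delta> / 2 * norm \<xi> + \<delta> / 2 * norm \<xi>)" by (simp only: exp_add mult_ac)
    also have "\<delta> / 2 * norm \<xi> + \<delta> / 2 * norm \<xi> = \<delta> * norm \<xi>" by simp
    finally show ?thesis .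
  qed
  then show "\<exists>K\<ge>0. \<forall>\<xi>. cmod (P \<xi> * Q \<xi>) \<le> K * exp (\<delta> * norm \<xi>)"
    using K L by (intro exI[of _ "K * L"]) auto
qed

lemma subexp_norm_square: "subexp (\<lambda>\<xi>. of_real ((norm \<xi>)\<^sup>2))"
  unfolding subexp_def
proof (intro conjI allI impI)
  fix \<delta> :: real assume \<delta>: "\<delta> > 0"
  have "(norm \<xi>)\<^sup>2 \<le> 4 / \<delta>\<^sup>2 * exp (\<delta> * norm \<xi>)" for \<xi> :: "real^'d"
  proof -
    have "(\<delta> / 2 * norm \<xi>)\<^sup>2 \<le> (exp (\<delta> / 2 * norm \<xi>))\<^sup>2"
    proof (rule power_mono)
      show "\<delta> / 2 * norm \<xi> \<le> exp (\<delta> / 2 * norm \<xi>)"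
        using exp_ge_add_one_self[of "\<delta> / 2 * norm \<xi>"] by linarith
    qed (use \<delta> in simp)
    also have "\<dots> = exp (\<delta> * norm \<xi>)" by (simp flip: exp_of_nat_mult)
    finally show ?thesis using \<delta> by (simp add: field_simps power2_eq_square)
  qed
  then show "\<exists>K\<ge>0. \<forall>\<xi>::real^'d. cmod (of_real ((norm \<xi>)\<^sup>2)) \<le> K * exp (\<delta> * norm \<xi>)"
    using \<delta> by (intro exI[of _ "4 / \<delta>\<^sup>2"]) (auto simp: norm_power)
qed measurable

text \<open>The remainder of the first-order expansion of \<open>z \<mapsto> P e\<^sub>z\<close> in the direction \<open>h\<close>.\<close>

abbreviation wave_rest :: "(real^'d \<Rightarrow> complex) \<Rightarrow> complex^'d \<Rightarrow> complex^'d \<Rightarrow> real^'d \<Rightarrow> complex" where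
  "wave_rest P z h \<equiv> \<lambda>\<xi>. P \<xi> * exp_wave (z + h) \<xi> - (P \<xi> * exp_wave z \<xi> + \<i> * (cdot h \<xi> * P \<xi> * exp_wave z \<xi>))"

text \<open>Exponential moments of order below \<open>2 a\<close> are what makes the waves \<open>e\<^sub>z\<close> with \<open>z\<close> in the tube of
  radius \<open>a\<close> square-integrable.\<close>

locale exp_moment_measure = finite_measure M for M :: "(real^'d) measure" +
  fixes a :: real
  assumes sets_M: "sets M = sets borel"
    and a_pos: "a > 0"
    and exp_moment: "\<And>b. b < a \<Longrightarrow> integrable M (\<lambda>\<xi>. exp (2 * b * norm \<xi>))"
begin

lemma measurable_M: "g \<in> borel_measurable borel \<Longrightarrow> g \<in> borel_measurable M"
  using measurable_cong_sets[OF sets_M refl] by blast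

definition moment :: "real \<Rightarrow> real" where
  "moment b = sqrt (LINT \<xi>|M. exp (2 * b * norm \<xi>))"

lemma moment_nonneg [simp]: "moment b \<ge> 0"
  by (simp add: moment_def)

lemma exp_bounded_L2:
  assumes "g \<in> borel_measurable borel" "b < a" "K \<ge> 0" "\<And>\<xi>. cmod (g \<xi>) \<le> K * exp (b * norm \<xi>)"
  shows "g \<in> L2 M" "l2norm M g \<le> K * moment b"
proof -
  have sq: "(K * exp (b * norm \<xi>))\<^sup>2 = K\<^sup>2 * exp (2 * b * norm \<xi>)" for \<xi> :: "real^'d"
    by (simp add: power_mult_distrib mult.assoc flip: exp_of_nat_mult)
  have I: "integrable M (\<lambda>\<xi>. (K * exp (b * norm \<xi>))\<^sup>2)"
    unfolding sq using exp_moment[OF assms(2)] by simp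
  note D = L2_dominated[OF measurable_M[OF assms(1)] I assms(4)]
  show "g \<in> L2 M" by (rule D)
  have "sqrt (LINT \<xi>|M. (K * exp (b * norm \<xi>))\<^sup>2) = K * moment b"
    unfolding sq using assms(3) by (simp add: moment_def real_sqrt_mult)
  then show "l2norm M g \<le> K * moment b" using D(2) by simp
qed

lemma subexp_exp_wave_L2:
  assumes "subexp P" "z \<in> tube a"
  shows "(\<lambda>\<xi>. P \<xi> * exp_wave z \<xi>) \<in> L2 M"
proof -
  define \<delta> where "\<delta> = (a - norm (im_vec z)) / 2"
  have \<delta>: "\<delta> > 0" "\<delta> + norm (im_vec z) < a" using assms(2) by (auto simp: \<delta>_def tube_im_vec field_simps)
  obtain K where K: "K \<ge> 0" "\<And>\<xi>. cmod (P \<xi>) \<le> K * exp (\<delta> * norm \<xi>)"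
    using assms(1) \<delta> unfolding subexp_def by blast
  show ?thesis
  proof (rule exp_bounded_L2[OF _ \<delta>(2) K(1)])
    show "(\<lambda>\<xi>. P \<xi> * exp_wave z \<xi>) \<in> borel_measurable borel"
      using subexp_measurable[OF assms(1)] by measurable
    fix \<xi>
    have "cmod (P \<xi> * exp_wave z \<xi>) \<le> (K * exp (\<delta> * norm \<xi>)) * exp (norm (im_vec z) * norm \<xi>)"
      unfolding norm_mult using K cmod_exp_wave_le[of z \<xi>] by (intro mult_mono) auto
    then show "cmod (P \<xi> * exp_wave z \<xi>) \<le> K * exp ((\<delta> + norm (im_vec z)) * norm \<xi>)"
      by (simp add: distrib_right exp_add)
  qed
qed

text \<open>The second-order Taylor estimate of the exponential bounds the remainder pointwise by \<open>|h|\<^sup>2\<close> times a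
  subexponential factor and a wave of slightly larger exponent.\<close>

lemma exp_wave_taylor:
  assumes P: "subexp P" and z: "z \<in> tube a"
  shows "\<exists>K\<ge>0. \<exists>\<delta>>0. \<forall>h. norm h < \<delta> \<longrightarrow> z + h \<in> tube a \<and>
     l2norm M (wave_rest P z h)
       \<le> K * (norm h)\<^sup>2"
proof -
  define \<delta> where "\<delta> = (a - norm (im_vec z)) / 3"
  have \<delta>: "\<delta> > 0" "\<delta> + \<delta> + norm (im_vec z) < a" using z by (auto simp: \<delta>_def tube_im_vec field_simps)
  have "subexp (\<lambda>\<xi>. of_real ((norm \<xi>)\<^sup>2) * P \<xi>)"
    by (rule subexp_mult[OF subexp_norm_square P])
  then obtain K where K: "K \<ge> 0" "\<And>\<xi>. cmod (of_real ((norm \<xi>)\<^sup>2) * P \<xi>) \<le> K * exp (\<delta> * norm \<xi>)"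
    using \<delta>(1) unfolding subexp_def by blast
  show ?thesis
  proof (rule exI[of _ "K * moment (\<delta> + \<delta> + norm (im_vec z))"],
      intro conjI exI[of _ \<delta>] allI impI)
    fix h :: "complex^'d" assume h: "norm h < \<delta>"
    have "norm (im_vec (z + h)) \<le> norm (im_vec z) + norm h"
      unfolding im_vec_add using norm_triangle_ineq[of "im_vec z" "im_vec h"] norm_im_vec_le[of h] by linarith
    then show "z + h \<in> tube a" using h \<delta> by (auto simp: tube_im_vec)
    have "l2norm M (wave_rest P z h)
        \<le> ((norm h)\<^sup>2 * K) * moment (\<delta> + \<delta> + norm (im_vec z))"
    proof (rule exp_bounded_L2(2)[OF _ \<delta>(2)])
      show "(wave_rest P z h)
          \<in> borel_measurable borel"
        using subexp_measurable[OF P] by measurable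
      show "(norm h)\<^sup>2 * K \<ge> 0" using K by simp
      fix \<xi> :: "real^'d"
      define w where "w = \<i> * cdot h \<xi>"
      have w: "cmod w \<le> norm h * norm \<xi>" using norm_cdot_le[of h \<xi>] by (simp add: w_def norm_mult)
      have "\<bar>Re w\<bar> \<le> norm h * norm \<xi>" using abs_Re_le_cmod[of w] w by linarith
      also have "\<dots> \<le> \<delta> * norm \<xi>" using h by (intro mult_right_mono) auto
      finally have Rew: "\<bar>Re w\<bar> \<le> \<delta> * norm \<xi>" .
      have "cmod (exp w - (1 + w)) \<le> exp \<bar>Re w\<bar> * cmod w ^ 2"
        using Taylor_exp[of w 1] by (simp add: atMost_Suc power2_eq_square add.commute)
      also have "\<dots> \<le> exp (\<delta> * norm \<xi>) * (norm h * norm \<xi>)\<^sup>2"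
        using Rew w by (intro mult_mono power_mono) auto
      finally have T: "cmod (exp w - (1 + w)) \<le> exp (\<delta> * norm \<xi>) * (norm h * norm \<xi>)\<^sup>2" .
      have "P \<xi> * exp_wave (z + h) \<xi> - (P \<xi> * exp_wave z \<xi> + \<i> * (cdot h \<xi> * P \<xi> * exp_wave z \<xi>))
          = P \<xi> * exp_wave z \<xi> * (exp w - (1 + w))"
        by (simp add: exp_wave_add w_def exp_wave_def[of h] algebra_simps)
      also have "cmod \<dots> \<le> cmod (P \<xi>) * exp (norm (im_vec z) * norm \<xi>) * (exp (\<delta> * norm \<xi>) * (norm h * norm \<xi>)\<^sup>2)"
        unfolding norm_mult using T cmod_exp_wave_le[of z \<xi>] by (intro mult_mono) auto
      also have "\<dots> = (norm h)\<^sup>2 * cmod (of_real ((norm \<xi>)\<^sup>2) * P \<xi>) * (exp (norm (im_vec z) * norm \<xi>) * exp (\<delta> * norm \<xi>))"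
        by (simp add: norm_mult power_mult_distrib norm_power mult_ac)
      also have "\<dots> \<le> (norm h)\<^sup>2 * (K * exp (\<delta> * norm \<xi>)) * (exp (norm (im_vec z) * norm \<xi>) * exp (\<delta> * norm \<xi>))"
        using K by (intro mult_mono) auto
      also have "\<dots> = (norm h)\<^sup>2 * K * exp ((\<delta> + \<delta> + norm (im_vec z)) * norm \<xi>)"
        by (simp only: distrib_right exp_add) (simp only: mult_ac)
      finally show "cmod (P \<xi> * exp_wave (z + h) \<xi> - (P \<xi> * exp_wave z \<xi> + \<i> * (cdot h \<xi> * P \<xi> * exp_wave z \<xi>)))
          \<le> (norm h)\<^sup>2 * K * exp ((\<delta> + \<delta> + norm (im_vec z)) * norm \<xi>)" .
    qed
    then show "l2norm M (wave_rest P z h)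
       \<le> K * moment (\<delta> + \<delta> + norm (im_vec z)) * (norm h)\<^sup>2"
      by (simp add: mult_ac)
  qed (use K \<delta> in auto)
qed

text \<open>Along a vector \<open>w\<close> shorter than \<open>a\<close> the partial sums of the exponential series are dominated by
  \<open>exp (|w| |\<xi>|)\<close>, which is square-integrable; so the pointwise convergence is convergence in the
  mean.\<close>

lemma exp_wave_series:
  assumes "norm w < a"
  shows "(\<lambda>n. l2norm M (\<lambda>\<xi>. exp_wave (cvec x + w) \<xi> - (\<Sum>k<n. (\<i> * cdot w \<xi>) ^ k / fact k) * exp_wave (cvec x) \<xi>))
    \<longlonglongrightarrow> 0"
proof -
  define R where "R = (\<lambda>n \<xi>. exp_wave (cvec x + w) \<xi> - (\<Sum>k<n. (\<i> * cdot w \<xi>) ^ k / fact k) * exp_wave (cvec x) \<xi>)"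
  have R: "cmod (R n \<xi>) = cmod (exp (\<i> * cdot w \<xi>) - (\<Sum>k<n. (\<i> * cdot w \<xi>) ^ k / fact k))" for n \<xi>
  proof -
    have "R n \<xi> = exp_wave (cvec x) \<xi> * (exp (\<i> * cdot w \<xi>) - (\<Sum>k<n. (\<i> * cdot w \<xi>) ^ k / fact k))"
      by (simp add: R_def exp_wave_add exp_wave_def[of w] algebra_simps)
    then show ?thesis by (simp add: norm_mult)
  qed
  have bound: "cmod (R n \<xi>) \<le> 2 * exp (norm w * norm \<xi>)" for n \<xi>
  proof -
    define t where "t = \<i> * cdot w \<xi>"
    have t: "cmod t \<le> norm w * norm \<xi>" using norm_cdot_le[of w \<xi>] by (simp add: t_def norm_mult)
    have s: "(\<lambda>k. cmod t ^ k / fact k) sums exp (cmod t)"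
      using exp_converges[of "cmod t"] by (simp add: scaleR_conv_of_real divide_inverse mult.commute)
    have "cmod (\<Sum>k<n. t ^ k / fact k) \<le> (\<Sum>k<n. cmod t ^ k / fact k)"
      by (rule order_trans[OF norm_sum]) (simp add: norm_divide norm_power)
    also have "\<dots> \<le> exp (cmod t)"
      using sum_le_suminf[OF sums_summable[OF s], of "{..<n}"] sums_unique[OF s] by simp
    finally have "cmod (\<Sum>k<n. t ^ k / fact k) \<le> exp (cmod t)" .
    moreover have "cmod (exp t) \<le> exp (cmod t)" by (rule norm_exp)
    moreover have "exp (cmod t) \<le> exp (norm w * norm \<xi>)" using t by simp
    ultimately show ?thesis unfolding R t_def[symmetric]
      using norm_triangle_ineq4[of "exp t" "\<Sum>k<n. t ^ k / fact k"] by linarith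
  qed
  have meas: "R n \<in> borel_measurable borel" for n unfolding R_def by measurable
  have "(\<lambda>n. LINT \<xi>|M. (cmod (R n \<xi>))\<^sup>2) \<longlonglongrightarrow> (LINT \<xi>|M. 0)"
  proof (rule integral_dominated_convergence[where w="\<lambda>\<xi>. 4 * exp (2 * norm w * norm \<xi>)"])
    show "(\<lambda>\<xi>. (cmod (R n \<xi>))\<^sup>2) \<in> borel_measurable M" for n
      using measurable_M[OF meas[of n]] by measurable
    show "integrable M (\<lambda>\<xi>. 4 * exp (2 * norm w * norm \<xi>))"
      using exp_moment[OF assms] by simp
    show "AE \<xi> in M. (\<lambda>n. (cmod (R n \<xi>))\<^sup>2) \<longlonglongrightarrow> 0"
    proof (rule AE_I2)
      fix \<xi>
      have "(\<lambda>k. (\<i> * cdot w \<xi>) ^ k / fact k) sums exp (\<i> * cdot w \<xi>)"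
        using exp_converges[of "\<i> * cdot w \<xi>"] by (simp add: scaleR_conv_of_real divide_inverse mult.commute)
      then have "(\<lambda>n. exp (\<i> * cdot w \<xi>) - (\<Sum>k<n. (\<i> * cdot w \<xi>) ^ k / fact k)) \<longlonglongrightarrow> 0"
        unfolding sums_def using tendsto_diff[OF tendsto_const[of "exp (\<i> * cdot w \<xi>)"]] by force
      then show "(\<lambda>n. (cmod (R n \<xi>))\<^sup>2) \<longlonglongrightarrow> 0"
        unfolding R by (auto intro!: tendsto_eq_intros tendsto_norm_zero)
    qed
    show "AE \<xi> in M. norm ((cmod (R n \<xi>))\<^sup>2) \<le> 4 * exp (2 * norm w * norm \<xi>)" for n
    proof (rule AE_I2)
      fix \<xi>
      have "(cmod (R n \<xi>))\<^sup>2 \<le> (2 * exp (norm w * norm \<xi>))\<^sup>2" by (intro power_mono bound) auto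
      then show "norm ((cmod (R n \<xi>))\<^sup>2) \<le> 4 * exp (2 * norm w * norm \<xi>)"
        by (simp add: power_mult_distrib mult.assoc flip: exp_of_nat_mult)
    qed
  qed simp
  then have "(\<lambda>n. l2norm M (R n)) \<longlonglongrightarrow> sqrt 0"
    unfolding l2norm_def by (intro tendsto_real_sqrt) simp
  then show ?thesis by (simp add: R_def)
qed

end

section \<open>Analytic continuation of the waves in the closed span\<close>

lemma norm_vector_scalar_mult: "norm (c *s (z::complex^'d)) = cmod c * norm z"
  by (simp add: norm_vec_def norm_mult L2_set_right_distrib)

lemma norm_component_le_vec: "cmod ((h::complex^'d) $ m) \<le> norm h"
  unfolding norm_vec_def by (rule member_le_L2_set) auto

lemma subexp_power: "subexp P \<Longrightarrow> subexp (\<lambda>\<xi>. P \<xi> ^ n)"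
  by (induction n) (auto intro: subexp_mult)

lemma cdot_axis: "cdot (axis m 1) \<xi> = of_real (\<xi> $ m)"
proof -
  have "(\<Sum>l\<in>UNIV. axis m 1 $ l * complex_of_real (\<xi> $ l)) = (\<Sum>l\<in>UNIV. if l = m then complex_of_real (\<xi> $ l) else 0)"
    by (intro sum.cong) (auto simp: axis_def)
  then show ?thesis by (simp add: cdot_def)
qed

lemma has_derivative_quadratic:
  fixes F :: "'a::real_normed_vector \<Rightarrow> 'b::real_normed_vector"
  assumes L: "bounded_linear L" and \<delta>: "\<delta> > 0"
    and b: "\<And>h. norm h < \<delta> \<Longrightarrow> norm (F (z + h) - F z - L h) \<le> K * (norm h)\<^sup>2"
  shows "(F has_derivative L) (at z)"
  unfolding has_derivative_at
proof (intro conjI L)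
  have "\<forall>\<^sub>F h in at 0. norm (norm (F (z + h) - F z - L h) / norm h) \<le> K * norm h"
    unfolding eventually_at
  proof (intro exI[of _ \<delta>] conjI \<delta> ballI impI)
    fix h :: 'a assume "h \<noteq> 0 \<and> dist h 0 < \<delta>"
    then show "norm (norm (F (z + h) - F z - L h) / norm h) \<le> K * norm h"
      using b[of h] by (simp add: divide_le_eq power2_eq_square mult.assoc)
  qed
  moreover have "((\<lambda>h. K * norm h) \<longlongrightarrow> 0) (at (0::'a))"
    by (auto intro!: tendsto_eq_intros)
  ultimately show "(\<lambda>h. norm (F (z + h) - F z - L h) / norm h) \<midarrow>0\<rightarrow> 0"
    by (rule Lim_null_comparison)
qed

lemma gradient_bounded_linear: "bounded_linear (\<lambda>h::complex^'d. \<Sum>m\<in>UNIV. h $ m * c m)"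
proof -
  have "bounded_linear (\<lambda>h::complex^'d. h $ m * c m)" for m
    using bounded_linear_compose[OF bounded_linear_mult_left bounded_linear_vec_nth] by blast
  then show ?thesis by (intro bounded_linear_sum) auto
qed

text \<open>The data left of the composition operator: in the space of square-integrable functions of the
  spectral measure, its adjoint is \<open>e\<^sub>x \<mapsto> e\<^bsub>f x\<^esub>\<close> for real points \<open>x\<close> of \<open>U\<close>.\<close>

locale wave_transfer = exp_moment_measure M a for M :: "(real^'d) measure" and a :: real +
  fixes U :: "(real^'d) set" and f :: "real^'d \<Rightarrow> real^'d" and C :: real
  assumes open_U: "open U" and U_nonempty: "U \<noteq> {}" and C0: "0 \<le> C"
    and wave_bound: "\<And>S c. finite S \<Longrightarrow> S \<subseteq> U \<Longrightarrow>
       l2norm M (\<lambda>\<xi>. \<Sum>x\<in>S. c x * exp_wave (cvec (f x)) \<xi>)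
         \<le> C * l2norm M (\<lambda>\<xi>. \<Sum>x\<in>S. c x * exp_wave (cvec x) \<xi>)"
begin

lemma real_in_tube: "cvec x \<in> tube a"
  by (simp add: tube_im_vec a_pos)

lemma exp_wave_L2: "z \<in> tube a \<Longrightarrow> exp_wave z \<in> L2 M"
  using subexp_exp_wave_L2[OF subexp_one] by simp

sublocale l2_transfer M U "\<lambda>x. exp_wave (cvec x)" "\<lambda>x. exp_wave (cvec (f x))" C
  by unfold_locales (auto intro: exp_wave_L2 real_in_tube C0 wave_bound)

text \<open>The derivative is a limit of difference quotients, which stay in the closed span.\<close>

lemma clos_directional_derivative:
  assumes P: "subexp P" and z: "z \<in> tube a"
    and ev: "\<forall>\<^sub>F t in at 0. (\<lambda>\<xi>. P \<xi> * exp_wave (z + t *\<^sub>R w) \<xi>) \<in> clos"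
    and m: "(\<lambda>\<xi>. P \<xi> * exp_wave z \<xi>) \<in> clos"
  shows "(\<lambda>\<xi>. cdot w \<xi> * P \<xi> * exp_wave z \<xi>) \<in> clos"
proof -
  obtain K \<delta> where K: "K \<ge> 0" "\<delta> > 0" and b: "\<And>h. norm h < \<delta> \<Longrightarrow>
     l2norm M (wave_rest P z h)
       \<le> K * (norm h)\<^sup>2"
    using exp_wave_taylor[OF P z] by blast
  define g where "g = (\<lambda>t \<xi>. (1 / (\<i> * of_real t)) * (P \<xi> * exp_wave (z + t *\<^sub>R w) \<xi> - P \<xi> * exp_wave z \<xi>))"
  show ?thesis
  proof (rule clos_closed[where F="at 0" and g=g])
    show "(\<lambda>\<xi>. cdot w \<xi> * P \<xi> * exp_wave z \<xi>) \<in> L2 M"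
      by (rule subexp_exp_wave_L2[OF subexp_mult[OF subexp_cdot P] z])
    show "at (0::real) \<noteq> bot" by simp
    show "\<forall>\<^sub>F t in at 0. g t \<in> clos"
      using ev by eventually_elim (unfold g_def, intro clos_scale clos_diff m)
    have "\<forall>\<^sub>F t in at (0::real). norm (l2norm M (\<lambda>\<xi>. cdot w \<xi> * P \<xi> * exp_wave z \<xi> - g t \<xi>)) \<le> K * (norm w)\<^sup>2 * \<bar>t\<bar>"
      unfolding eventually_at
    proof (intro exI[of _ "\<delta> / (norm w + 1)"] conjI ballI impI)
      show "\<delta> / (norm w + 1) > 0" using K norm_ge_zero[of w] by (intro divide_pos_pos) linarith+
      fix t :: real assume t: "t \<noteq> 0 \<and> dist t 0 < \<delta> / (norm w + 1)"
      have w1: "norm w + 1 > 0" using norm_ge_zero[of w] by linarith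
      have "norm (t *\<^sub>R w) \<le> \<bar>t\<bar> * (norm w + 1)" by (simp add: mult_left_mono)
      also have "\<dots> < \<delta>" using t w1 by (simp add: pos_less_divide_eq)
      finally have h: "norm (t *\<^sub>R w) < \<delta>" .
      have "(\<lambda>\<xi>. cdot w \<xi> * P \<xi> * exp_wave z \<xi> - g t \<xi>) = (\<lambda>\<xi>. (- 1 / (\<i> * of_real t)) *
         (P \<xi> * exp_wave (z + t *\<^sub>R w) \<xi> - (P \<xi> * exp_wave z \<xi> + \<i> * (cdot (t *\<^sub>R w) \<xi> * P \<xi> * exp_wave z \<xi>))))"
        using t by (auto simp: g_def fun_eq_iff field_simps)
      then have "l2norm M (\<lambda>\<xi>. cdot w \<xi> * P \<xi> * exp_wave z \<xi> - g t \<xi>) = 1 / \<bar>t\<bar> *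
         l2norm M (\<lambda>\<xi>. P \<xi> * exp_wave (z + t *\<^sub>R w) \<xi> - (P \<xi> * exp_wave z \<xi> + \<i> * (cdot (t *\<^sub>R w) \<xi> * P \<xi> * exp_wave z \<xi>)))"
        by (simp only: l2norm_scale) (simp add: norm_divide norm_mult)
      also have "\<dots> \<le> 1 / \<bar>t\<bar> * (K * (norm (t *\<^sub>R w))\<^sup>2)"
        using b[OF h] by (intro mult_left_mono) auto
      also have "\<dots> = K * (norm w)\<^sup>2 * \<bar>t\<bar>" using t by (simp add: power_mult_distrib power2_eq_square field_simps)
      finally show "norm (l2norm M (\<lambda>\<xi>. cdot w \<xi> * P \<xi> * exp_wave z \<xi> - g t \<xi>)) \<le> K * (norm w)\<^sup>2 * \<bar>t\<bar>"
        by simp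
    qed
    moreover have "((\<lambda>t. K * (norm w)\<^sup>2 * \<bar>t\<bar>) \<longlongrightarrow> 0) (at (0::real))"
      by (auto intro!: tendsto_eq_intros)
    ultimately show "((\<lambda>t. l2norm M (\<lambda>\<xi>. cdot w \<xi> * P \<xi> * exp_wave z \<xi> - g t \<xi>)) \<longlongrightarrow> 0) (at 0)"
      by (rule Lim_null_comparison)
  qed
qed

lemma clos_power_on_segment:
  assumes "\<And>t. \<bar>t\<bar> < r \<Longrightarrow> exp_wave (cvec (x + t *\<^sub>R v)) \<in> clos" "\<bar>t\<bar> < r"
  shows "(\<lambda>\<xi>. cdot (cvec v) \<xi> ^ m * exp_wave (cvec (x + t *\<^sub>R v)) \<xi>) \<in> clos"
  using assms(2)
proof (induction m arbitrary: t)
  case 0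
  then show ?case using assms(1) by simp
next
  case (Suc m)
  have "(\<lambda>\<xi>. cdot (cvec v) \<xi> * cdot (cvec v) \<xi> ^ m * exp_wave (cvec (x + t *\<^sub>R v)) \<xi>) \<in> clos"
  proof (rule clos_directional_derivative[OF subexp_power[OF subexp_cdot] real_in_tube _ Suc.IH[OF Suc.prems]])
    show "\<forall>\<^sub>F s in at 0. (\<lambda>\<xi>. cdot (cvec v) \<xi> ^ m * exp_wave (cvec (x + t *\<^sub>R v) + s *\<^sub>R cvec v) \<xi>) \<in> clos"
      unfolding eventually_at
    proof (intro exI[of _ "r - \<bar>t\<bar>"] conjI ballI impI)
      show "r - \<bar>t\<bar> > 0" using Suc.prems by simp
      fix s :: real assume "s \<noteq> 0 \<and> dist s 0 < r - \<bar>t\<bar>"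
      then have "\<bar>t + s\<bar> < r" by auto
      moreover have "cvec (x + t *\<^sub>R v) + s *\<^sub>R cvec v = cvec (x + (t + s) *\<^sub>R v)"
        by (simp add: cvec_add cvec_scaleR scaleR_left_distrib)
      ultimately show "(\<lambda>\<xi>. cdot (cvec v) \<xi> ^ m * exp_wave (cvec (x + t *\<^sub>R v) + s *\<^sub>R cvec v) \<xi>) \<in> clos"
        using Suc.IH[of "t + s"] by simp
    qed
  qed
  then show ?case by simp
qed

text \<open>The wave is known to lie in the closed span only along a short real segment. That already gives
  all its derivatives in the real direction \<open>v\<close>, and the exponential series then reaches every complex
  parameter within distance \<open>a\<close>: a step of analytic continuation whose length does not depend on the
  segment.\<close>

lemma clos_complex_line:
  assumes "r > 0" "\<And>t. \<bar>t\<bar> < r \<Longrightarrow> exp_wave (cvec (x + t *\<^sub>R v)) \<in> clos"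
    and s: "cmod s * norm v < a"
  shows "exp_wave (cvec x + s *s cvec v) \<in> clos"
proof -
  have nw: "norm (s *s cvec v) < a" using s by (simp add: norm_vector_scalar_mult)
  define g where "g = (\<lambda>n \<xi>. (\<Sum>k<n. (\<i> * cdot (s *s cvec v) \<xi>) ^ k / fact k) * exp_wave (cvec x) \<xi>)"
  show ?thesis
  proof (rule clos_closed[where F=sequentially and g=g])
    have "norm (im_vec (cvec x + s *s cvec v)) < a"
      using norm_im_vec_le[of "s *s cvec v"] nw by (simp add: im_vec_add)
    then show "exp_wave (cvec x + s *s cvec v) \<in> L2 M" by (intro exp_wave_L2) (simp add: tube_im_vec)
    show "(\<lambda>n. l2norm M (\<lambda>\<xi>. exp_wave (cvec x + s *s cvec v) \<xi> - g n \<xi>)) \<longlonglongrightarrow> 0"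
      unfolding g_def by (rule exp_wave_series[OF nw])
    have "g n \<in> clos" for n
    proof -
      have "g n = (\<lambda>\<xi>. \<Sum>k<n. ((\<i> * s) ^ k / fact k) * (cdot (cvec v) \<xi> ^ k * exp_wave (cvec x) \<xi>))"
        unfolding g_def sum_distrib_right cdot_scale
        by (intro ext sum.cong refl) (simp add: power_mult_distrib)
      moreover have "(\<lambda>\<xi>. cdot (cvec v) \<xi> ^ k * exp_wave (cvec x) \<xi>) \<in> clos" for k
        using clos_power_on_segment[of r x v 0 k] assms(1,2) by (simp del: cdot_cvec)
      ultimately show ?thesis by (simp only:) (intro clos_sum clos_scale)
    qed
    then show "\<forall>\<^sub>F n in sequentially. g n \<in> clos" by simp
  qed simp
qed

text \<open>The set of real points around which all waves lie in the closed span is open, contains \<open>U\<close>, and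
  contains with each point the ball of radius \<open>a\<close>; so it is also closed, hence everything.\<close>

lemma clos_real: "exp_wave (cvec x) \<in> clos"
proof -
  define R where "R = {x. \<exists>r>0. \<forall>y\<in>ball x r. exp_wave (cvec y) \<in> clos}"
  have in_R: "ball x r \<subseteq> R" if "\<forall>y\<in>ball x r. exp_wave (cvec y) \<in> clos" for x r
  proof
    fix y assume "y \<in> ball x r"
    then obtain e where "e > 0" "ball y e \<subseteq> ball x r" using open_contains_ball by blast
    then show "y \<in> R" using that unfolding R_def by blast
  qed
  have step: "ball x a \<subseteq> R" if xR: "x \<in> R" for x
  proof (rule in_R, rule ballI)
    obtain r where r: "r > 0" "\<forall>y\<in>ball x r. exp_wave (cvec y) \<in> clos" using xR unfolding R_def by blast
    fix y assume y: "y \<in> ball x a"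
    define v where "v = y - x"
    have v1: "norm v + 1 > 0" using norm_ge_zero[of v] by linarith
    have "exp_wave (cvec x + 1 *s cvec v) \<in> clos"
    proof (rule clos_complex_line[of "r / (norm v + 1)"])
      show "r / (norm v + 1) > 0" using r v1 by simp
      fix t :: real assume "\<bar>t\<bar> < r / (norm v + 1)"
      then have "\<bar>t\<bar> * (norm v + 1) < r" using v1 by (simp add: pos_less_divide_eq)
      moreover have "\<bar>t\<bar> * norm v \<le> \<bar>t\<bar> * (norm v + 1)" by (intro mult_left_mono) auto
      ultimately show "exp_wave (cvec (x + t *\<^sub>R v)) \<in> clos" using r(2) by (auto simp: dist_norm)
    qed (use y in \<open>auto simp: v_def dist_norm norm_minus_commute\<close>)
    moreover have "cvec x + 1 *s cvec v = cvec y" by (simp add: v_def vec_eq_iff cvec_def)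
    ultimately show "exp_wave (cvec y) \<in> clos" by simp
  qed
  have "open R" unfolding open_contains_ball using step a_pos by blast
  moreover have "open (- R)" unfolding open_contains_ball
  proof
    fix x assume "x \<in> - R"
    have "ball x a \<subseteq> - R"
    proof
      fix y assume "y \<in> ball x a"
      then have "x \<in> ball y a" by (simp add: dist_commute)
      then show "y \<in> - R" using step[of y] \<open>x \<in> - R\<close> by blast
    qed
    then show "\<exists>e>0. ball x e \<subseteq> - R" using a_pos by blast
  qed
  moreover have "R \<noteq> {}"
  proof -
    obtain x0 r where "x0 \<in> U" "r > 0" "ball x0 r \<subseteq> U"
      using U_nonempty open_U open_contains_ball by blast
    then have "x0 \<in> R" unfolding R_def using clos_single by blast
    then show ?thesis by blast
  qed
  ultimately have "R = UNIV" using clopen[of R] by (simp add: closed_def)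
  then have "x \<in> R" by simp
  then show ?thesis unfolding R_def by force
qed

text \<open>One more step, in the imaginary direction, fills the tube around the real points.\<close>

lemma clos_tube: assumes "z \<in> tube a" shows "exp_wave z \<in> clos"
proof -
  have "exp_wave (cvec (\<chi> l. Re (z $ l)) + \<i> *s cvec (im_vec z)) \<in> clos"
    by (rule clos_complex_line[of 1]) (use assms clos_real in \<open>auto simp: tube_im_vec\<close>)
  moreover have "cvec (\<chi> l. Re (z $ l)) + \<i> *s cvec (im_vec z) = z"
    by (simp add: vec_eq_iff cvec_def im_vec_def complex_eq_iff)
  ultimately show ?thesis by simp
qed

text \<open>Factors \<open>P\<close> for which the whole family \<open>P e\<^sub>z\<close> lies in the closed span; differentiating in
  \<open>z\<close> multiplies \<open>P\<close> by a linear factor, so the class is closed under that.\<close>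

definition admissible :: "(real^'d \<Rightarrow> complex) \<Rightarrow> bool" where
  "admissible P \<longleftrightarrow> subexp P \<and> (\<forall>z\<in>tube a. (\<lambda>\<xi>. P \<xi> * exp_wave z \<xi>) \<in> clos)"

lemma admissible_one: "admissible (\<lambda>_. 1)"
  by (simp add: admissible_def clos_tube)

lemma admissible_cdot: assumes "admissible P" shows "admissible (\<lambda>\<xi>. cdot w \<xi> * P \<xi>)"
  unfolding admissible_def
proof (intro conjI ballI)
  show "subexp (\<lambda>\<xi>. cdot w \<xi> * P \<xi>)" using assms by (auto simp: admissible_def intro: subexp_mult)
  fix z :: "complex^'d" assume z: "z \<in> tube a"
  obtain \<delta> where \<delta>: "\<delta> > 0" "\<And>h. norm h < \<delta> \<Longrightarrow> z + h \<in> tube a"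
    using exp_wave_taylor[OF subexp_one z] by blast
  have w1: "norm w + 1 > 0" using norm_ge_zero[of w] by linarith
  show "(\<lambda>\<xi>. cdot w \<xi> * P \<xi> * exp_wave z \<xi>) \<in> clos"
  proof (rule clos_directional_derivative)
    show "\<forall>\<^sub>F t in at 0. (\<lambda>\<xi>. P \<xi> * exp_wave (z + t *\<^sub>R w) \<xi>) \<in> clos"
      unfolding eventually_at
    proof (intro exI[of _ "\<delta> / (norm w + 1)"] conjI ballI impI)
      show "\<delta> / (norm w + 1) > 0" using \<delta> w1 by simp
      fix t :: real assume "t \<noteq> 0 \<and> dist t 0 < \<delta> / (norm w + 1)"
      then have "\<bar>t\<bar> * (norm w + 1) < \<delta>" using w1 by (simp add: pos_less_divide_eq)
      moreover have "\<bar>t\<bar> * norm w \<le> \<bar>t\<bar> * (norm w + 1)" by (intro mult_left_mono) auto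
      ultimately have "z + t *\<^sub>R w \<in> tube a" by (intro \<delta>(2)) simp
      then show "(\<lambda>\<xi>. P \<xi> * exp_wave (z + t *\<^sub>R w) \<xi>) \<in> clos" using assms by (simp add: admissible_def)
    qed
  qed (use assms z in \<open>auto simp: admissible_def\<close>)
qed

lemma ext_form_sum_left:
  assumes bw: "bounded_weight M \<kappa>" and l: "l \<in> clos" and m: "\<And>i. i \<in> I \<Longrightarrow> m i \<in> clos"
  shows "ext_form \<kappa> (\<lambda>\<xi>. \<Sum>i\<in>I. c i * m i \<xi>) l = (\<Sum>i\<in>I. c i * ext_form \<kappa> (m i) l)"
  using m
proof (induction I rule: infinite_finite_induct)
  case (insert i I)
  have "ext_form \<kappa> (\<lambda>\<xi>. c i * m i \<xi> + (\<Sum>i\<in>I. c i * m i \<xi>)) l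
      = ext_form \<kappa> (\<lambda>\<xi>. c i * m i \<xi>) l + ext_form \<kappa> (\<lambda>\<xi>. \<Sum>i\<in>I. c i * m i \<xi>) l"
    by (rule ext_form_add_left[OF bw _ _ l]) (auto intro!: clos_scale clos_sum insert.prems)
  then show ?case using insert by (simp add: ext_form_scale_left[OF bw _ l])
qed (use ext_form_scale_left[OF bw clos_zero l, of 0] in auto)

lemma ext_form_sum_right:
  assumes bw: "bounded_weight M \<kappa>" and l: "l \<in> clos" and m: "\<And>i. i \<in> I \<Longrightarrow> m i \<in> clos"
  shows "ext_form \<kappa> l (\<lambda>\<xi>. \<Sum>i\<in>I. c i * m i \<xi>) = (\<Sum>i\<in>I. cnj (c i) * ext_form \<kappa> l (m i))"
  using m
proof (induction I rule: infinite_finite_induct)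
  case (insert i I)
  have "ext_form \<kappa> l (\<lambda>\<xi>. c i * m i \<xi> + (\<Sum>i\<in>I. c i * m i \<xi>))
      = ext_form \<kappa> l (\<lambda>\<xi>. c i * m i \<xi>) + ext_form \<kappa> l (\<lambda>\<xi>. \<Sum>i\<in>I. c i * m i \<xi>)"
    by (rule ext_form_add_right[OF bw _ _ l]) (auto intro!: clos_scale clos_sum insert.prems)
  then show ?case using insert by (simp add: ext_form_scale_right[OF bw _ l])
qed (use ext_form_scale_right[OF bw clos_zero l, of 0] in auto)

text \<open>The extended form on a pair of waves, with the second point conjugated: a form that is antilinear
  in its second argument then depends holomorphically on \<open>z\<close>. At real \<open>z = x\<close> in \<open>U\<close> and \<open>P = Q = 1\<close> it is
  \<open>\<integral> \<kappa> e\<^bsub>f x\<^esub> cnj e\<^bsub>f x\<^esub>\<close>.\<close>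

definition pairing :: "(real^'d \<Rightarrow> complex) \<Rightarrow> (real^'d \<Rightarrow> complex) \<Rightarrow> (real^'d \<Rightarrow> complex) \<Rightarrow> complex^'d \<Rightarrow> complex" where
  "pairing \<kappa> P Q z = ext_form \<kappa> (\<lambda>\<xi>. P \<xi> * exp_wave z \<xi>) (\<lambda>\<xi>. Q \<xi> * exp_wave (cnj_vec z) \<xi>)"

lemma wave_increment:
  assumes P: "admissible P" and z: "z \<in> tube a"
  shows "\<exists>K D \<delta>. K \<ge> 0 \<and> D \<ge> 0 \<and> \<delta> > 0 \<and> (\<forall>h. norm h < \<delta> \<longrightarrow> z + h \<in> tube a \<and>
     l2norm M (wave_rest P z h)
       \<le> K * (norm h)\<^sup>2 \<and>
     l2norm M (\<lambda>\<xi>. \<i> * (cdot h \<xi> * P \<xi> * exp_wave z \<xi>)) \<le> D * norm h)"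
proof -
  have sP: "subexp P" using P by (simp add: admissible_def)
  obtain K \<delta> where K: "K \<ge> 0" "\<delta> > 0" and b: "\<And>h. norm h < \<delta> \<Longrightarrow> z + h \<in> tube a \<and>
     l2norm M (wave_rest P z h)
       \<le> K * (norm h)\<^sup>2"
    using exp_wave_taylor[OF sP z] by blast
  define e where "e = (\<lambda>m \<xi>. of_real (\<xi> $ m) * P \<xi> * exp_wave z \<xi>)"
  have e: "e m \<in> L2 M" for m
    unfolding e_def cdot_axis[symmetric]
    by (rule subexp_exp_wave_L2[OF subexp_mult[OF subexp_cdot sP] z])
  define D where "D = (\<Sum>m\<in>UNIV. l2norm M (e m))"
  have "l2norm M (\<lambda>\<xi>. \<i> * (cdot h \<xi> * P \<xi> * exp_wave z \<xi>)) \<le> D * norm h" for h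
  proof -
    have tri: "l2norm M (\<lambda>\<xi>. \<Sum>m\<in>I. h $ m * e m \<xi>) \<le> (\<Sum>m\<in>I. cmod (h $ m) * l2norm M (e m))" for I
    proof (induction I rule: infinite_finite_induct)
      case (insert m I)
      have "l2norm M (\<lambda>\<xi>. h $ m * e m \<xi> + (\<Sum>m\<in>I. h $ m * e m \<xi>))
          \<le> l2norm M (\<lambda>\<xi>. h $ m * e m \<xi>) + l2norm M (\<lambda>\<xi>. \<Sum>m\<in>I. h $ m * e m \<xi>)"
        by (intro l2norm_add L2_scale L2_sum e)
      then show ?case using insert by (simp add: l2norm_scale)
    qed (auto simp: l2norm_def)
    have "l2norm M (\<lambda>\<xi>. \<i> * (cdot h \<xi> * P \<xi> * exp_wave z \<xi>)) = l2norm M (\<lambda>\<xi>. \<Sum>m\<in>UNIV. h $ m * e m \<xi>)"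
      unfolding l2norm_scale cdot_def sum_distrib_right e_def by (simp add: mult.assoc)
    also have "\<dots> \<le> (\<Sum>m\<in>UNIV. cmod (h $ m) * l2norm M (e m))" by (rule tri)
    also have "\<dots> \<le> (\<Sum>m\<in>UNIV. norm h * l2norm M (e m))"
      by (intro sum_mono mult_right_mono norm_component_le_vec) auto
    finally show ?thesis by (simp add: D_def sum_distrib_left mult.commute)
  qed
  moreover have "D \<ge> 0" by (simp add: D_def sum_nonneg)
  ultimately show ?thesis using K b by blast
qed

text \<open>The product rule for a bounded sesquilinear form. Antilinearity in the second argument and the
  conjugation of the point cancel, so the derivative is complex linear.\<close>

lemma pairing_has_derivative:
  assumes bw: "bounded_weight M \<kappa>" and P: "admissible P" and Q: "admissible Q" and z: "z \<in> tube a"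
  shows "(pairing \<kappa> P Q has_derivative (\<lambda>h. \<Sum>m\<in>UNIV. h $ m *
     (\<i> * pairing \<kappa> (\<lambda>\<xi>. cdot (axis m 1) \<xi> * P \<xi>) Q z - \<i> * pairing \<kappa> P (\<lambda>\<xi>. cdot (axis m 1) \<xi> * Q \<xi>) z))) (at z)"
    (is "(_ has_derivative ?L) _")
proof -
  define z' where "z' = cnj_vec z"
  have z': "z' \<in> tube a" using z by (simp add: z'_def)
  obtain K D \<delta> where K: "K \<ge> 0" "D \<ge> 0" "\<delta> > 0" and b: "\<And>h. norm h < \<delta> \<Longrightarrow> z + h \<in> tube a \<and>
     l2norm M (wave_rest P z h)
       \<le> K * (norm h)\<^sup>2 \<and>
     l2norm M (\<lambda>\<xi>. \<i> * (cdot h \<xi> * P \<xi> * exp_wave z \<xi>)) \<le> D * norm h"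
    using wave_increment[OF P z] by blast
  obtain K' D' \<delta>' where K': "K' \<ge> 0" "D' \<ge> 0" "\<delta>' > 0" and b': "\<And>h. norm h < \<delta>' \<Longrightarrow> z' + h \<in> tube a \<and>
     l2norm M (wave_rest Q z' h)
       \<le> K' * (norm h)\<^sup>2 \<and>
     l2norm M (\<lambda>\<xi>. \<i> * (cdot h \<xi> * Q \<xi> * exp_wave z' \<xi>)) \<le> D' * norm h"
    using wave_increment[OF Q z'] by blast
  obtain \<beta> where \<beta>: "\<beta> \<ge> 0" "\<And>m l. m \<in> clos \<Longrightarrow> l \<in> clos \<Longrightarrow> cmod (ext_form \<kappa> m l) \<le> \<beta> * (l2norm M m * l2norm M l)"
    using ext_form_bound[OF bw] by blast
  define m where "m = (\<lambda>\<xi>. P \<xi> * exp_wave z \<xi>)"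
  define l where "l = (\<lambda>\<xi>. Q \<xi> * exp_wave z' \<xi>)"
  define A where "A = \<beta> * (K * (l2norm M l + D' + K') + l2norm M m * K' + D * (D' + K'))"
  show ?thesis
  proof (rule has_derivative_quadratic[where \<delta>="min 1 (min \<delta> \<delta>')" and K=A])
    show "bounded_linear ?L" by (rule gradient_bounded_linear)
    show "min 1 (min \<delta> \<delta>') > 0" using K K' by simp
    fix h :: "complex^'d" assume h: "norm h < min 1 (min \<delta> \<delta>')"
    define h' where "h' = cnj_vec h"
    have h': "norm h' = norm h" by (simp add: h'_def)
    have h1: "norm h \<le> 1" "norm h < \<delta>" "norm h' < \<delta>'" using h h' by auto
    define d where "d = (\<lambda>\<xi>. \<i> * (cdot h \<xi> * P \<xi> * exp_wave z \<xi>))"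
    define d' where "d' = (\<lambda>\<xi>. \<i> * (cdot h' \<xi> * Q \<xi> * exp_wave z' \<xi>))"
    define m1 where "m1 = (\<lambda>\<xi>. P \<xi> * exp_wave (z + h) \<xi>)"
    define l1 where "l1 = (\<lambda>\<xi>. Q \<xi> * exp_wave (z' + h') \<xi>)"
    define r where "r = (\<lambda>\<xi>. m1 \<xi> - (m \<xi> + d \<xi>))"
    define r' where "r' = (\<lambda>\<xi>. l1 \<xi> - (l \<xi> + d' \<xi>))"
    have bd: "z + h \<in> tube a" "l2norm M r \<le> K * (norm h)\<^sup>2" "l2norm M d \<le> D * norm h"
      using b[OF h1(2)] by (auto simp: r_def m1_def m_def d_def)
    have bd': "z' + h' \<in> tube a" "l2norm M r' \<le> K' * (norm h)\<^sup>2" "l2norm M d' \<le> D' * norm h"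
      using b'[OF h1(3)] by (auto simp: r'_def l1_def l_def d'_def h')
    have mem: "m \<in> clos" "m1 \<in> clos" "l \<in> clos" "l1 \<in> clos"
      using P Q z z' bd(1) bd'(1) by (auto simp: admissible_def m_def m1_def l_def l1_def)
    have "d \<in> clos" unfolding d_def
      using admissible_cdot[OF P, of h] z by (intro clos_scale) (auto simp: admissible_def)
    moreover have "d' \<in> clos" unfolding d'_def
      using admissible_cdot[OF Q, of h'] z' by (intro clos_scale) (auto simp: admissible_def)
    ultimately have mem2: "d \<in> clos" "d' \<in> clos" "r \<in> clos" "r' \<in> clos"
      using mem by (auto simp: r_def r'_def intro!: clos_diff clos_add)
    have m1: "m1 = (\<lambda>\<xi>. r \<xi> + (\<lambda>\<xi>. m \<xi> + d \<xi>) \<xi>)" and l1: "l1 = (\<lambda>\<xi>. l \<xi> + (\<lambda>\<xi>. d' \<xi> + r' \<xi>) \<xi>)"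
      by (auto simp: r_def r'_def)
    note add = ext_form_add_left[OF bw] ext_form_add_right[OF bw]
    have md: "(\<lambda>\<xi>. m \<xi> + d \<xi>) \<in> clos" and dr: "(\<lambda>\<xi>. d' \<xi> + r' \<xi>) \<in> clos"
      using mem mem2 by (auto intro: clos_add)
    have "ext_form \<kappa> m1 l1 = ext_form \<kappa> r l1 + (ext_form \<kappa> m l1 + ext_form \<kappa> d l1)"
      by (subst m1) (simp only: add(1)[OF mem2(3) md mem(4)] add(1)[OF mem(1) mem2(1) mem(4)])
    also have "ext_form \<kappa> m l1 = ext_form \<kappa> m l + (ext_form \<kappa> m d' + ext_form \<kappa> m r')"
      by (subst l1) (simp only: add(2)[OF mem(3) dr mem(1)] add(2)[OF mem2(2) mem2(4) mem(1)])
    also have "ext_form \<kappa> d l1 = ext_form \<kappa> d l + ext_form \<kappa> d (\<lambda>\<xi>. d' \<xi> + r' \<xi>)"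
      by (subst l1) (simp only: add(2)[OF mem(3) dr mem2(1)])
    finally have split: "ext_form \<kappa> m1 l1 - ext_form \<kappa> m l - (ext_form \<kappa> d l + ext_form \<kappa> m d')
        = ext_form \<kappa> r l1 + ext_form \<kappa> m r' + ext_form \<kappa> d (\<lambda>\<xi>. d' \<xi> + r' \<xi>)" by simp
    have Pm: "(\<lambda>\<xi>. cdot (axis k 1) \<xi> * P \<xi> * exp_wave z \<xi>) \<in> clos" for k
      using admissible_cdot[OF P, of "axis k 1"] z by (auto simp: admissible_def)
    have Qm: "(\<lambda>\<xi>. cdot (axis k 1) \<xi> * Q \<xi> * exp_wave z' \<xi>) \<in> clos" for k
      using admissible_cdot[OF Q, of "axis k 1"] z' by (auto simp: admissible_def)
    have "d = (\<lambda>\<xi>. \<Sum>k\<in>UNIV. (\<i> * h $ k) * (cdot (axis k 1) \<xi> * P \<xi> * exp_wave z \<xi>))"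
      by (simp add: d_def cdot_axis cdot_def[of h] sum_distrib_right sum_distrib_left mult_ac)
    then have dl: "ext_form \<kappa> d l = (\<Sum>k\<in>UNIV. (\<i> * h $ k) * ext_form \<kappa> (\<lambda>\<xi>. cdot (axis k 1) \<xi> * P \<xi> * exp_wave z \<xi>) l)"
      by (simp only: ext_form_sum_left[OF bw mem(3) Pm])
    have "d' = (\<lambda>\<xi>. \<Sum>k\<in>UNIV. (\<i> * h' $ k) * (cdot (axis k 1) \<xi> * Q \<xi> * exp_wave z' \<xi>))"
      by (simp add: d'_def cdot_axis cdot_def[of h'] sum_distrib_right sum_distrib_left mult_ac)
    then have md': "ext_form \<kappa> m d' = (\<Sum>k\<in>UNIV. cnj (\<i> * h' $ k) * ext_form \<kappa> m (\<lambda>\<xi>. cdot (axis k 1) \<xi> * Q \<xi> * exp_wave z' \<xi>))"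
      by (simp only: ext_form_sum_right[OF bw mem(1) Qm])
    have Lh: "?L h = ext_form \<kappa> d l + ext_form \<kappa> m d'"
      unfolding dl md' sum.distrib[symmetric] pairing_def z'_def[symmetric] l_def[symmetric] m_def[symmetric]
      by (intro sum.cong refl) (simp add: h'_def cnj_vec_def algebra_simps)
    have "cnj_vec (z + h) = z' + h'" by (simp add: z'_def h'_def cnj_vec_add)
    then have "cmod (pairing \<kappa> P Q (z + h) - pairing \<kappa> P Q z - ?L h)
        = cmod (ext_form \<kappa> r l1 + ext_form \<kappa> m r' + ext_form \<kappa> d (\<lambda>\<xi>. d' \<xi> + r' \<xi>))"
      unfolding Lh split[symmetric] by (simp add: pairing_def m_def l_def m1_def l1_def z'_def)
    also have "\<dots> \<le> cmod (ext_form \<kappa> r l1) + cmod (ext_form \<kappa> m r') + cmod (ext_form \<kappa> d (\<lambda>\<xi>. d' \<xi> + r' \<xi>))"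
      by (intro norm_triangle_le add_mono norm_triangle_ineq order_refl)
    also have "\<dots> \<le> \<beta> * (l2norm M r * l2norm M l1) + \<beta> * (l2norm M m * l2norm M r')
        + \<beta> * (l2norm M d * l2norm M (\<lambda>\<xi>. d' \<xi> + r' \<xi>))"
      by (intro add_mono \<beta>(2) mem mem2 dr)
    also have "\<dots> \<le> \<beta> * (K * (norm h)\<^sup>2 * (l2norm M l + D' + K')) + \<beta> * (l2norm M m * (K' * (norm h)\<^sup>2))
        + \<beta> * (D * norm h * (norm h * (D' + K')))"
    proof -
      have n2: "(norm h)\<^sup>2 \<le> norm h * 1" unfolding power2_eq_square using h1 by (intro mult_left_mono) auto
      have "l2norm M (\<lambda>\<xi>. d' \<xi> + r' \<xi>) \<le> D' * norm h + K' * (norm h)\<^sup>2"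
        using l2norm_add[OF clos_L2[OF mem2(2)] clos_L2[OF mem2(4)]] bd' by linarith
      also have "\<dots> \<le> D' * norm h + K' * norm h" using n2 K' by (simp add: mult_left_mono)
      finally have s: "l2norm M (\<lambda>\<xi>. d' \<xi> + r' \<xi>) \<le> norm h * (D' + K')" by (simp add: algebra_simps)
      also have "\<dots> \<le> 1 * (D' + K')" using h1 K' by (intro mult_right_mono) auto
      finally have "l2norm M l1 \<le> l2norm M l + D' + K'"
        using l2norm_add[OF clos_L2[OF mem(3)] clos_L2[OF dr]] by (subst l1) simp
      then show ?thesis using s bd bd' K K' \<beta>(1)
        by (intro add_mono mult_left_mono mult_mono) auto
    qed
    also have "\<dots> = A * (norm h)\<^sup>2" by (simp add: A_def algebra_simps power2_eq_square)
    finally show "cmod (pairing \<kappa> P Q (z + h) - pairing \<kappa> P Q z - ?L h) \<le> A * (norm h)\<^sup>2" .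
  qed
qed

end

section \<open>Radial primitives of holomorphic functions\<close>

text \<open>Differentiating under the integral sign shows that the radial primitive of an arbitrary tuple of
  continuously complex differentiable functions is complex differentiable. Its gradient is the tuple
  only when the tuple is closed; in the application that is decided near the base point alone, by the
  fundamental theorem of calculus.\<close>

lemma radial_primitive:
  fixes S :: "(complex^'d) set" and D :: "'d \<Rightarrow> complex^'d \<Rightarrow> complex"
    and G :: "'d \<Rightarrow> 'd \<Rightarrow> complex^'d \<Rightarrow> complex"
  assumes S: "open S" "convex S" "p \<in> S"
    and D: "\<And>l z. z \<in> S \<Longrightarrow> (D l has_derivative (\<lambda>h. \<Sum>m\<in>UNIV. h $ m * G l m z)) (at z)"
    and G: "\<And>l m. continuous_on S (G l m)"
    and z: "z \<in> S"
  shows "\<exists>c. ((\<lambda>z. integral {0..1} (\<lambda>s. \<Sum>l\<in>UNIV. (z - p) $ l * D l (p + s *\<^sub>R (z - p))))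
    has_derivative (\<lambda>h. \<Sum>m\<in>UNIV. h $ m * c m)) (at z)"
proof -
  define y where "y = (\<lambda>z (s::real). p + s *\<^sub>R (z - p))"
  have yS: "y z s \<in> S" if "z \<in> S" "s \<in> {0..1}" for z s
  proof -
    have "y z s = (1 - s) *\<^sub>R p + s *\<^sub>R z" by (simp add: y_def algebra_simps)
    then show ?thesis using convexD[OF S(2,3) that(1), of "1 - s" s] that(2) by simp
  qed
  define F where "F = (\<lambda>z s. \<Sum>l\<in>UNIV. (z - p) $ l * D l (y z s))"
  define W where "W = (\<lambda>m z s. D m (y z s) + of_real s * (\<Sum>l\<in>UNIV. (z - p) $ l * G l m (y z s)))"
  define E where "E = (\<lambda>m::'d. Blinfun (\<lambda>h::complex^'d. h $ m))"
  have E [simp]: "blinfun_apply (E m) h = h $ m" for m h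
    by (simp add: E_def bounded_linear_Blinfun_apply bounded_linear_vec_nth)
  define Fx where "Fx = (\<lambda>z s. \<Sum>m\<in>UNIV. blinfun_mult_right (W m z s) o\<^sub>L E m)"
  have Fx: "blinfun_apply (Fx z s) = (\<lambda>h. \<Sum>m\<in>UNIV. h $ m * W m z s)" for z s
    by (rule ext) (simp add: Fx_def blinfun.sum_left mult.commute)
  have contD: "continuous_on S (D l)" for l
    by (rule has_derivative_continuous_on) (use D has_derivative_at_withinI in blast)
  have conty: "continuous_on (S \<times> {0..1}) (\<lambda>q. y (fst q) (snd q))"
    unfolding y_def by (intro continuous_intros)
  have comp: "continuous_on (S \<times> {0..1}) (\<lambda>q. g (y (fst q) (snd q)))"
    if "continuous_on S g" for g :: "complex^'d \<Rightarrow> complex"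
    by (rule continuous_on_compose2[OF that conty]) (use yS in auto)
  have contW: "continuous_on (S \<times> {0..1}) (\<lambda>q. W m (fst q) (snd q))" for m
    unfolding W_def by (intro continuous_intros comp contD G)
  have contF: "continuous_on (S \<times> {0..1}) (\<lambda>q. F (fst q) (snd q))"
    unfolding F_def by (intro continuous_intros comp contD)
  have contFx: "continuous_on (S \<times> {0..1}) (\<lambda>q. Fx (fst q) (snd q))"
    unfolding Fx_def
    by (intro continuous_intros bounded_linear.continuous_on[OF bounded_linear_blinfun_mult_right] contW)
  have slice: "continuous_on {0..1} (\<lambda>s. g z s)"
    if "continuous_on (S \<times> {0..1}) (\<lambda>q. g (fst q) (snd q))" for g :: "_ \<Rightarrow> real \<Rightarrow> 'c::topological_space"
  proof -
    have "continuous_on {0..1} (\<lambda>s::real. (z, s))" by (intro continuous_intros)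
    from continuous_on_compose2[OF that this] z show ?thesis by auto
  qed
  have der: "((\<lambda>z. F z s) has_derivative blinfun_apply (Fx z s)) (at z within S)"
    if "z \<in> S" "s \<in> cbox 0 1" for z s
  proof -
    have ys: "y z s \<in> S" using yS[OF that(1)] that(2) by simp
    have dy: "((\<lambda>z. y z s) has_derivative (\<lambda>h. s *\<^sub>R h)) (at z within S)"
      unfolding y_def by (auto intro!: derivative_eq_intros)
    have dD: "((\<lambda>z. D l (y z s)) has_derivative (\<lambda>h. \<Sum>m\<in>UNIV. (s *\<^sub>R h) $ m * G l m (y z s))) (at z within S)" for l
      by (rule has_derivative_compose[OF dy D[OF ys]])
    have dc: "((\<lambda>z. (z - p) $ l) has_derivative (\<lambda>h. h $ l)) (at z within S)" for l
    proof -
      have "((\<lambda>z. (z - p) $ l) has_derivative (\<lambda>h. (h - 0) $ l)) (at z within S)"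
        by (intro bounded_linear.has_derivative[OF bounded_linear_vec_nth] derivative_intros)
      then show ?thesis by simp
    qed
    have "((\<lambda>z. F z s) has_derivative (\<lambda>h. \<Sum>l\<in>UNIV. (z - p) $ l * (\<Sum>m\<in>UNIV. (s *\<^sub>R h) $ m * G l m (y z s)) + h $ l * D l (y z s))) (at z within S)"
      unfolding F_def by (intro has_derivative_sum has_derivative_mult dc dD)
    moreover have "(\<Sum>l\<in>UNIV. (z - p) $ l * (\<Sum>m\<in>UNIV. (s *\<^sub>R h) $ m * G l m (y z s)) + h $ l * D l (y z s))
        = (\<Sum>m\<in>UNIV. h $ m * W m z s)" for h
    proof -
      have "(\<Sum>l\<in>UNIV. (z - p) $ l * (\<Sum>m\<in>UNIV. (s *\<^sub>R h) $ m * G l m (y z s)))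
          = (\<Sum>m\<in>UNIV. \<Sum>l\<in>UNIV. (z - p) $ l * ((s *\<^sub>R h) $ m * G l m (y z s)))"
        unfolding sum_distrib_left by (rule sum.swap)
      also have "\<dots> = (\<Sum>m\<in>UNIV. h $ m * (of_real s * (\<Sum>l\<in>UNIV. (z - p) $ l * G l m (y z s))))"
        unfolding sum_distrib_left vector_scaleR_component
        by (intro sum.cong refl) (simp add: scaleR_conv_of_real[where 'a=complex] mult_ac)
      finally show ?thesis by (simp add: W_def sum.distrib distrib_left)
    qed
    ultimately show ?thesis by (simp add: Fx)
  qed
  have "((\<lambda>z. integral (cbox 0 1) (F z)) has_derivative blinfun_apply (integral (cbox 0 1) (Fx z))) (at z within S)"
  proof (rule leibniz_rule[OF der _ _ z S(2)])
    show "F z integrable_on cbox 0 1" if "z \<in> S" for z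
    proof (rule integrable_continuous)
      show "continuous_on (cbox 0 1) (F z)"
      proof -
        have "continuous_on {0..1} (\<lambda>s::real. (z, s))" by (intro continuous_intros)
        from continuous_on_compose2[OF contF this] that show ?thesis by auto
      qed
    qed
    show "continuous_on (S \<times> cbox 0 1) (\<lambda>(x, t). Fx x t)"
      using contFx by (simp add: case_prod_beta')
  qed
  moreover have "blinfun_apply (integral (cbox 0 1) (Fx z)) = (\<lambda>h. \<Sum>m\<in>UNIV. h $ m * integral {0..1} (W m z))"
  proof
    fix h
    have iFx: "Fx z integrable_on {0..1}" using slice[OF contFx] by (rule integrable_continuous_real)
    have iW: "W m z integrable_on {0..1}" for m using slice[OF contW] by (rule integrable_continuous_real)
    have bl: "bounded_linear (\<lambda>b::(complex^'d) \<Rightarrow>\<^sub>L complex. blinfun_apply b h)"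
      by (rule blinfun.bounded_linear_left)
    have "blinfun_apply (integral {0..1} (Fx z)) h = integral {0..1} ((\<lambda>b. blinfun_apply b h) \<circ> Fx z)"
      by (rule integral_linear[OF iFx bl, symmetric])
    also have "\<dots> = integral {0..1} (\<lambda>s. \<Sum>m\<in>UNIV. h $ m * W m z s)" by (simp add: o_def Fx)
    also have "\<dots> = (\<Sum>m\<in>UNIV. h $ m * integral {0..1} (W m z))"
      using iW by (subst integral_sum) (auto intro!: integrable_on_mult_right)
    finally show "blinfun_apply (integral (cbox 0 1) (Fx z)) h = (\<Sum>m\<in>UNIV. h $ m * integral {0..1} (W m z))"
      by simp
  qed
  ultimately have "((\<lambda>z. integral {0..1} (F z)) has_derivative (\<lambda>h. \<Sum>m\<in>UNIV. h $ m * integral {0..1} (W m z))) (at z within S)"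
    by simp
  then have "((\<lambda>z. integral {0..1} (F z)) has_derivative (\<lambda>h. \<Sum>m\<in>UNIV. h $ m * integral {0..1} (W m z))) (at z)"
    using at_within_open[OF z S(1)] by simp
  then show ?thesis unfolding F_def y_def
    by (rule exI[of _ "\<lambda>m. integral {0..1} (W m z)"])
qed

text \<open>This brings the identity theorem for one complex variable to bear on functions of several.\<close>

lemma gradient_along_line:
  fixes g :: "complex^'d \<Rightarrow> complex"
  assumes "(g has_derivative (\<lambda>h. \<Sum>m\<in>UNIV. h $ m * c m)) (at (p + s *s v))"
  shows "((\<lambda>s. g (p + s *s v)) has_field_derivative (\<Sum>m\<in>UNIV. v $ m * c m)) (at s)"
proof -
  have bl: "bounded_linear (\<lambda>t. t *s v)"
  proof -
    have "linear (\<lambda>t. t *s v)"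
      by (rule linearI) (auto simp: vec_eq_iff algebra_simps)
    then show ?thesis by (rule linear_conv_bounded_linear[THEN iffD1])
  qed
  have "((\<lambda>s. p + s *s v) has_derivative (\<lambda>t. t *s v)) (at s)"
    using has_derivative_add[OF has_derivative_const bounded_linear.has_derivative[OF bl has_derivative_ident], of p "at s"] by simp
  from has_derivative_compose[OF this assms]
  have "((\<lambda>s. g (p + s *s v)) has_derivative (\<lambda>t. \<Sum>m\<in>UNIV. (t *s v) $ m * c m)) (at s)" .
  moreover have "(\<lambda>t. \<Sum>m\<in>UNIV. (t *s v) $ m * c m) = (\<lambda>t. (\<Sum>m\<in>UNIV. v $ m * c m) * t)"
    by (simp add: sum_distrib_left fun_eq_iff mult_ac)
  ultimately show ?thesis unfolding has_field_derivative_def by simp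
qed

section \<open>Characteristic functions that decay at infinity\<close>

context exp_moment_measure
begin

lemma weighted_wave_integrable:
  assumes "g \<in> borel_measurable M" "\<And>\<xi>. cmod (g \<xi>) \<le> K"
  shows "integrable M g"
  by (rule integrable_const_bound[of _ K]) (use assms in auto)

text \<open>A bounded linear functional applied to the expansion of \<open>P e\<^sub>z\<close>. It is given on a subspace \<open>V\<close> because the
  extended forms live on the closed span, and the remainder is kept quadratic because it will be compared
  with the quadratic error of the characteristic function.\<close>

lemma functional_wave_quadratic:
  assumes V: "V \<subseteq> L2 M" "\<And>m l. m \<in> V \<Longrightarrow> l \<in> V \<Longrightarrow> (\<lambda>\<xi>. m \<xi> + l \<xi>) \<in> V"
      "\<And>c m. m \<in> V \<Longrightarrow> (\<lambda>\<xi>. c * m \<xi>) \<in> V"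
    and \<Lambda>: "\<And>m l. m \<in> V \<Longrightarrow> l \<in> V \<Longrightarrow> \<Lambda> (\<lambda>\<xi>. m \<xi> + l \<xi>) = \<Lambda> m + \<Lambda> l"
      "\<And>c m. m \<in> V \<Longrightarrow> \<Lambda> (\<lambda>\<xi>. c * m \<xi>) = c * \<Lambda> m"
      "\<And>m. m \<in> V \<Longrightarrow> cmod (\<Lambda> m) \<le> \<beta> * l2norm M m" "\<beta> \<ge> 0"
    and P: "subexp P" "\<And>z. z \<in> tube a \<Longrightarrow> (\<lambda>\<xi>. P \<xi> * exp_wave z \<xi>) \<in> V"
      "\<And>z w. z \<in> tube a \<Longrightarrow> (\<lambda>\<xi>. cdot w \<xi> * P \<xi> * exp_wave z \<xi>) \<in> V"
    and z: "z \<in> tube a"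
  shows "\<exists>K\<ge>0. \<exists>\<delta>>0. \<forall>h. norm h < \<delta> \<longrightarrow>
    cmod (\<Lambda> (\<lambda>\<xi>. P \<xi> * exp_wave (z + h) \<xi>) - \<Lambda> (\<lambda>\<xi>. P \<xi> * exp_wave z \<xi>)
      - (\<Sum>m\<in>UNIV. h $ m * (\<i> * \<Lambda> (\<lambda>\<xi>. cdot (axis m 1) \<xi> * P \<xi> * exp_wave z \<xi>)))) \<le> K * (norm h)\<^sup>2"
proof -
  obtain K \<delta> where K: "K \<ge> 0" "\<delta> > 0" and b: "\<And>h. norm h < \<delta> \<Longrightarrow> z + h \<in> tube a \<and>
     l2norm M (wave_rest P z h)
       \<le> K * (norm h)\<^sup>2"
    using exp_wave_taylor[OF P(1) z] by blast
  have zero: "(\<lambda>\<xi>. 0) \<in> V" using V(3)[OF P(2)[OF z], of 0] by simp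
  have \<Lambda>0: "\<Lambda> (\<lambda>\<xi>. 0) = 0" using \<Lambda>(2)[OF zero, of 0] by simp
  have sumV: "(\<lambda>\<xi>. \<Sum>i\<in>I. c i * g i \<xi>) \<in> V \<and> \<Lambda> (\<lambda>\<xi>. \<Sum>i\<in>I. c i * g i \<xi>) = (\<Sum>i\<in>I. c i * \<Lambda> (g i))"
    if "\<And>i. g i \<in> V" for I and c :: "'d \<Rightarrow> complex" and g
    by (induction I rule: infinite_finite_induct)
       (simp_all add: zero \<Lambda>0 V(2) V(3) that \<Lambda>(1) \<Lambda>(2))
  show ?thesis
  proof (rule exI[of _ "\<beta> * K"], intro conjI exI[of _ \<delta>] allI impI)
    show "\<beta> * K \<ge> 0" using \<Lambda>(4) K by simp
    fix h :: "complex^'d" assume h: "norm h < \<delta>"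
    define m where "m = (\<lambda>\<xi>. P \<xi> * exp_wave z \<xi>)"
    define m1 where "m1 = (\<lambda>\<xi>. P \<xi> * exp_wave (z + h) \<xi>)"
    define d where "d = (\<lambda>\<xi>. \<Sum>k\<in>UNIV. (\<i> * h $ k) * (cdot (axis k 1) \<xi> * P \<xi> * exp_wave z \<xi>))"
    have d: "d = (\<lambda>\<xi>. \<i> * (cdot h \<xi> * P \<xi> * exp_wave z \<xi>))"
      by (simp add: d_def cdot_axis cdot_def[of h] sum_distrib_right sum_distrib_left mult_ac)
    have mem: "m \<in> V" "m1 \<in> V" "d \<in> V"
      using P z b[OF h] sumV by (auto simp: m_def m1_def d_def)
    define r where "r = (\<lambda>\<xi>. m1 \<xi> + (- 1) * (\<lambda>\<xi>. m \<xi> + d \<xi>) \<xi>)"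
    have r: "r \<in> V" unfolding r_def using mem by (intro V(2) V(3))
    have "\<Lambda> r = \<Lambda> m1 + (- 1) * (\<Lambda> m + \<Lambda> d)"
      unfolding r_def using mem by (simp only: \<Lambda>(1) \<Lambda>(2) V(2) V(3))
    moreover have "\<Lambda> d = (\<Sum>k\<in>UNIV. (\<i> * h $ k) * \<Lambda> (\<lambda>\<xi>. cdot (axis k 1) \<xi> * P \<xi> * exp_wave z \<xi>))"
      unfolding d_def
      using sumV[where g="\<lambda>k \<xi>. cdot (axis k 1) \<xi> * P \<xi> * exp_wave z \<xi>" and c="\<lambda>k. \<i> * h $ k" and I=UNIV]
        P(3)[OF z] by blast
    ultimately have "\<Lambda> m1 - \<Lambda> m - (\<Sum>k\<in>UNIV. h $ k * (\<i> * \<Lambda> (\<lambda>\<xi>. cdot (axis k 1) \<xi> * P \<xi> * exp_wave z \<xi>))) = \<Lambda> r"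
      by (simp add: mult_ac)
    moreover have "cmod (\<Lambda> r) \<le> \<beta> * (K * (norm h)\<^sup>2)"
    proof -
      have "r = (wave_rest P z h)"
        by (simp add: r_def m1_def m_def d fun_eq_iff)
      then have "l2norm M r \<le> K * (norm h)\<^sup>2" using b[OF h] by (simp only:)
      then show ?thesis using \<Lambda>(3)[OF r] \<Lambda>(4) mult_left_mono order_trans by blast
    qed
    ultimately show "cmod (\<Lambda> (\<lambda>\<xi>. P \<xi> * exp_wave (z + h) \<xi>) - \<Lambda> (\<lambda>\<xi>. P \<xi> * exp_wave z \<xi>)
      - (\<Sum>m\<in>UNIV. h $ m * (\<i> * \<Lambda> (\<lambda>\<xi>. cdot (axis m 1) \<xi> * P \<xi> * exp_wave z \<xi>)))) \<le> \<beta> * K * (norm h)\<^sup>2"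
      by (simp add: m_def m1_def mult.assoc)
  qed (use K in auto)
qed

end

lemma norm_le_one_plus_square: "norm x \<le> 1 + (norm x)\<^sup>2"
proof -
  have "2 * norm x \<le> 1 + norm x * norm x"
    using sum_squares_bound[of 1 "norm x"] by (simp add: power2_eq_square)
  then show ?thesis using norm_ge_zero[of x] unfolding power2_eq_square by linarith
qed

definition char_fun :: "(real^'d) measure \<Rightarrow> real^'d \<Rightarrow> complex" where
  "char_fun M t = (LINT \<xi>|M. exp_wave (cvec t) \<xi>)"

text \<open>The decay of the characteristic function expresses, in the form in which it enters the proof,
  that the measure has a density: waves with distinct real frequencies can be told apart, also when
  one of the frequencies escapes to infinity.\<close>

locale decaying_measure = exp_moment_measure M a for M :: "(real^'d) measure" and a :: real +
  assumes nontrivial: "measure M (space M) > 0"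
    and decay: "(char_fun M \<longlongrightarrow> 0) at_infinity"
begin

lemma wave_integrable: "integrable M (exp_wave (cvec t))"
  by (rule weighted_wave_integrable[of _ 1]) (auto intro: measurable_M)

lemma char_fun_0: "char_fun M 0 = of_real (measure M (space M))"
proof -
  have "exp_wave (cvec 0) = (\<lambda>\<xi>::real^'d. 1)" by (simp add: exp_wave_def fun_eq_iff)
  then show ?thesis by (simp add: char_fun_def scaleR_conv_of_real)
qed

text \<open>If the wave of frequency \<open>t\<close> is trivial, so are its powers, the waves of frequency \<open>n t\<close>; unless
  \<open>t = 0\<close>, these frequencies tend to infinity and contradict the decay.\<close>

lemma wave_AE_one_imp_zero:
  assumes "AE \<xi> in M. exp_wave (cvec t) \<xi> = 1"
  shows "t = 0"
proof (rule ccontr)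
  assume t: "t \<noteq> 0"
  have "char_fun M (real n *\<^sub>R t) = char_fun M 0" for n
    unfolding char_fun_def
  proof (rule integral_cong_AE)
    show "exp_wave (cvec (real n *\<^sub>R t)) \<in> borel_measurable M" "exp_wave (cvec 0) \<in> borel_measurable M"
      by (auto intro: measurable_M)
    show "AE \<xi> in M. exp_wave (cvec (real n *\<^sub>R t)) \<xi> = exp_wave (cvec 0) \<xi>"
      using assms
    proof eventually_elim
      case (elim \<xi>)
      have "exp_wave (cvec (real n *\<^sub>R t)) \<xi> = exp_wave (cvec t) \<xi> ^ n"
        by (simp add: exp_wave_def mult_ac flip: exp_of_nat_mult)
      then show ?case using elim by (simp add: exp_wave_def)
    qed
  qed
  then have c: "(\<lambda>n. char_fun M (real n *\<^sub>R t)) = (\<lambda>n. char_fun M 0)" by simp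
  have "filterlim (\<lambda>n. real n *\<^sub>R t) at_infinity sequentially"
  proof -
    have "filterlim (\<lambda>n. real n * norm t) at_top sequentially"
      using t by (intro filterlim_at_top_mult_tendsto_pos[OF tendsto_const _ filterlim_real_sequentially]) auto
    then show ?thesis by (intro filterlim_norm_at_top_imp_at_infinity) simp
  qed
  then have "(\<lambda>n. char_fun M (real n *\<^sub>R t)) \<longlonglongrightarrow> 0" by (rule filterlim_compose[OF decay])
  then have "char_fun M 0 = 0" unfolding c by (simp add: LIMSEQ_const_iff)
  then show False using nontrivial by (simp add: char_fun_0)
qed

lemma char_fun_eq_imp_zero:
  assumes "char_fun M t = char_fun M 0"
  shows "t = 0"
proof (rule wave_AE_one_imp_zero)
  have int: "integrable M (\<lambda>\<xi>. 1 - Re (exp_wave (cvec t) \<xi>))"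
    using integrable_Re[OF wave_integrable[of t]] by simp
  have le: "0 \<le> 1 - Re (exp_wave (cvec t) \<xi>)" for \<xi> :: "real^'d"
    using complex_Re_le_cmod[of "exp_wave (cvec t) \<xi>"] by simp
  have "(LINT \<xi>|M. 1 - Re (exp_wave (cvec t) \<xi>)) = measure M (space M) - Re (char_fun M t)"
    using integrable_Re[OF wave_integrable[of t]] wave_integrable[of t] by (simp add: char_fun_def)
  also have "\<dots> = 0" using assms by (simp add: char_fun_0)
  finally have "AE \<xi> in M. 1 - Re (exp_wave (cvec t) \<xi>) = 0"
    using integral_nonneg_eq_0_iff_AE[OF int] le by simp
  then show "AE \<xi> in M. exp_wave (cvec t) \<xi> = 1"
  proof eventually_elim
    case (elim \<xi>)
    then have "Re (exp_wave (cvec t) \<xi>) = 1" by simp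
    moreover have "(Re (exp_wave (cvec t) \<xi>))\<^sup>2 + (Im (exp_wave (cvec t) \<xi>))\<^sup>2 = 1"
      using cmod_power2[of "exp_wave (cvec t) \<xi>"] by simp
    ultimately show ?case by (simp add: complex_eq_iff)
  qed
qed

lemma char_fun_continuous: "continuous_on UNIV (char_fun M)"
  unfolding continuous_on_sequentially
proof (intro ballI allI impI, elim conjE)
  fix t and x :: "nat \<Rightarrow> real^'d" assume x: "x \<longlonglongrightarrow> t"
  show "(char_fun M \<circ> x) \<longlonglongrightarrow> char_fun M t"
    unfolding o_def char_fun_def
  proof (rule integral_dominated_convergence[where w="\<lambda>_. 1"])
    show "AE \<xi> in M. (\<lambda>n. exp_wave (cvec (x n)) \<xi>) \<longlonglongrightarrow> exp_wave (cvec t) \<xi>"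
      using x by (auto simp: exp_wave_def intro!: tendsto_intros)
  qed (auto intro: measurable_M)
qed

text \<open>Near infinity the decay keeps the characteristic function away from its value at the origin, and on a
  compact annulus around the origin its distance to that value has a positive minimum.\<close>

lemma tendsto_zero_of_char_fun:
  assumes "((\<lambda>y. char_fun M (g y)) \<longlongrightarrow> char_fun M 0) F"
  shows "(g \<longlongrightarrow> 0) F"
  unfolding tendsto_iff
proof (intro allI impI)
  fix e :: real assume e: "e > 0"
  define \<mu> where "\<mu> = measure M (space M)"
  obtain B where B: "\<And>t. norm t \<ge> B \<Longrightarrow> cmod (char_fun M t) < \<mu> / 2"
    using decay[unfolded tendsto_iff, rule_format, of "\<mu> / 2"] nontrivial
    by (auto simp: eventually_at_infinity \<mu>_def)
  define A where "A = cball (0::real^'d) B - ball 0 e"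
  have cA: "compact A" unfolding A_def by (rule compact_diff) auto
  obtain c where c: "c > 0" "\<And>t. t \<in> A \<Longrightarrow> c \<le> cmod (char_fun M t - char_fun M 0)"
  proof (cases "A = {}")
    case True
    then show ?thesis using that[of 1] by simp
  next
    case False
    have "continuous_on A (\<lambda>t. cmod (char_fun M t - char_fun M 0))"
      by (intro continuous_intros continuous_on_subset[OF char_fun_continuous]) auto
    from continuous_attains_inf[OF cA False this] obtain t0 where t0: "t0 \<in> A"
      "\<And>t. t \<in> A \<Longrightarrow> cmod (char_fun M t0 - char_fun M 0) \<le> cmod (char_fun M t - char_fun M 0)" by blast
    have "t0 \<noteq> 0" using t0(1) e by (auto simp: A_def)
    then show ?thesis using that[of "cmod (char_fun M t0 - char_fun M 0)"] t0 char_fun_eq_imp_zero by auto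
  qed
  have "min c (\<mu> / 2) > 0" using c nontrivial by (simp add: \<mu>_def)
  then have "\<forall>\<^sub>F y in F. dist (char_fun M (g y)) (char_fun M 0) < min c (\<mu> / 2)"
    using assms unfolding tendsto_iff by blast
  then show "\<forall>\<^sub>F y in F. dist (g y) 0 < e"
  proof eventually_elim
    case (elim y)
    show ?case
    proof (rule ccontr)
      assume n: "\<not> dist (g y) 0 < e"
      show False
      proof (cases "norm (g y) \<ge> B")
        case True
        have "cmod (char_fun M 0) \<le> cmod (char_fun M (g y)) + dist (char_fun M (g y)) (char_fun M 0)"
          using norm_triangle_sub[of "char_fun M 0" "char_fun M (g y)"] by (simp add: dist_norm norm_minus_commute)
        then show False using B[OF True] elim by (simp add: char_fun_0 \<mu>_def)
      next
        case False
        then have "g y \<in> A" using n by (auto simp: A_def dist_norm)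
        then show False using c(2)[of "g y"] elim by (simp add: dist_norm)
      qed
    qed
  qed
qed

lemma norm_square_integrable: "integrable M (\<lambda>\<xi>. (norm \<xi>)\<^sup>2)"
proof -
  obtain K where K: "K \<ge> 0" "\<And>\<xi>::real^'d. cmod (of_real ((norm \<xi>)\<^sup>2)) \<le> K * exp (a / 2 * norm \<xi>)"
    using subexp_norm_square half_gt_zero[OF a_pos] unfolding subexp_def by blast
  show ?thesis
  proof (rule Bochner_Integration.integrable_bound)
    show "integrable M (\<lambda>\<xi>. K * exp (2 * (a / 4) * norm \<xi>))"
      using exp_moment[of "a / 4"] a_pos by simp
    show "(\<lambda>\<xi>::real^'d. (norm \<xi>)\<^sup>2) \<in> borel_measurable M" by (rule measurable_M) measurable
    show "AE \<xi> in M. norm ((norm \<xi>)\<^sup>2) \<le> norm (K * exp (2 * (a / 4) * norm \<xi>))"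
      using K by (auto simp: norm_power)
  qed
qed

text \<open>The symmetric matrix with entries \<open>\<integral> \<xi>\<^sub>j \<xi>\<^sub>k / (1 + |\<xi>|\<^sup>2)\<close> is positive definite, since a null vector would
  make the measure live on a hyperplane. Its inverse, applied to the bounded map
  \<open>\<xi> \<mapsto> \<xi> / (1 + |\<xi>|\<^sup>2)\<close>, gives the weights.\<close>

lemma dual_weights:
  "\<exists>\<kappa> :: 'd \<Rightarrow> real^'d \<Rightarrow> real. (\<forall>j. \<kappa> j \<in> borel_measurable borel) \<and> (\<exists>K. \<forall>j \<xi>. \<bar>\<kappa> j \<xi>\<bar> \<le> K) \<and>
     (\<forall>j v. (LINT \<xi>|M. \<kappa> j \<xi> * (v \<bullet> \<xi>)) = v $ j)"
proof -
  define u :: "real^'d \<Rightarrow> real^'d" where "u = (\<lambda>\<xi>. (1 / (1 + (norm \<xi>)\<^sup>2)) *\<^sub>R \<xi>)"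
  have pos: "1 + (norm \<xi>)\<^sup>2 > 0" for \<xi> :: "real^'d" using zero_le_power2[of "norm \<xi>"] by linarith
  have contu: "continuous_on UNIV u" unfolding u_def
    using pos by (intro continuous_intros) (auto simp: less_imp_neq[symmetric])
  have u1: "norm (u \<xi>) * norm \<xi> \<le> 1" for \<xi>
    using pos[of \<xi>] by (simp add: u_def divide_le_eq power2_eq_square)
  have u2: "norm (u \<xi>) \<le> 1" for \<xi>
  proof -
    note norm_le_one_plus_square[of \<xi>]
    then show ?thesis using pos[of \<xi>] by (simp add: u_def divide_le_eq)
  qed
  have meas: "(\<lambda>\<xi>. (v \<bullet> \<xi>) *\<^sub>R u \<xi>) \<in> borel_measurable M" for v
    by (intro measurable_M borel_measurable_continuous_onI continuous_intros contu)
  have int: "integrable M (\<lambda>\<xi>. (v \<bullet> \<xi>) *\<^sub>R u \<xi>)" for v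
  proof (rule integrable_const_bound[of _ "norm v"])
    have "norm ((v \<bullet> \<xi>) *\<^sub>R u \<xi>) \<le> norm v" for \<xi>
    proof -
      have "norm ((v \<bullet> \<xi>) *\<^sub>R u \<xi>) \<le> (norm v * norm \<xi>) * norm (u \<xi>)"
        using Cauchy_Schwarz_ineq2[of v \<xi>] by (simp add: mult_right_mono)
      also have "\<dots> = norm v * (norm (u \<xi>) * norm \<xi>)" by simp
      also have "\<dots> \<le> norm v * 1" by (intro mult_left_mono u1) auto
      finally show ?thesis by simp
    qed
    then show "AE \<xi> in M. norm ((v \<bullet> \<xi>) *\<^sub>R u \<xi>) \<le> norm v" by simp
  qed (rule meas)
  define A where "A = (\<lambda>v. LINT \<xi>|M. (v \<bullet> \<xi>) *\<^sub>R u \<xi>)"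
  have linA: "linear A"
    by (rule linearI) (simp_all add: A_def inner_add_left scaleR_left_distrib int flip: scaleR_scaleR)
  have "inj A"
  proof (subst linear_injective_0[OF linA], intro allI impI)
    fix v assume "A v = 0"
    have "(LINT \<xi>|M. v \<bullet> ((v \<bullet> \<xi>) *\<^sub>R u \<xi>)) = v \<bullet> A v"
      unfolding A_def by (rule integral_inner_right) (use int in auto)
    also have "\<dots> = 0" using \<open>A v = 0\<close> by simp
    finally have "(LINT \<xi>|M. v \<bullet> ((v \<bullet> \<xi>) *\<^sub>R u \<xi>)) = 0" .
    moreover have "v \<bullet> ((v \<bullet> \<xi>) *\<^sub>R u \<xi>) = (v \<bullet> \<xi>)\<^sup>2 / (1 + (norm \<xi>)\<^sup>2)" for \<xi>
      by (simp add: u_def power2_eq_square)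
    ultimately have "(LINT \<xi>|M. (v \<bullet> \<xi>)\<^sup>2 / (1 + (norm \<xi>)\<^sup>2)) = 0" by simp
    moreover have "integrable M (\<lambda>\<xi>. (v \<bullet> \<xi>)\<^sup>2 / (1 + (norm \<xi>)\<^sup>2))"
      using integrable_inner_right[OF int, of v v] by (simp add: u_def power2_eq_square)
    ultimately have "AE \<xi> in M. (v \<bullet> \<xi>)\<^sup>2 / (1 + (norm \<xi>)\<^sup>2) = 0"
      using pos by (subst (asm) integral_nonneg_eq_0_iff_AE) (auto intro: divide_nonneg_pos)
    then have "AE \<xi> in M. exp_wave (cvec v) \<xi> = 1"
    proof eventually_elim
      case (elim \<xi>)
      then show ?case using pos[of \<xi>] by (simp add: exp_wave_def)
    qed
    then show "v = 0" by (rule wave_AE_one_imp_zero)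
  qed
  then obtain B where B: "linear B" "B \<circ> A = id" using linear_injective_left_inverse[OF linA] by blast
  have blB: "bounded_linear B" using B(1) by (rule linear_conv_bounded_linear[THEN iffD1])
  obtain K where K: "\<And>x. norm (B x) \<le> norm x * K" "K > 0" using bounded_linear.pos_bounded[OF blB] by blast
  show ?thesis
  proof (intro exI[of _ "\<lambda>j \<xi>. B (u \<xi>) $ j"] conjI allI)
    show "(\<lambda>\<xi>. B (u \<xi>) $ j) \<in> borel_measurable borel" for j
      by (intro borel_measurable_continuous_onI continuous_on_component
          bounded_linear.continuous_on[OF blB] contu)
    have "\<bar>B (u \<xi>) $ j\<bar> \<le> K" for j \<xi>
    proof -
      have "\<bar>B (u \<xi>) $ j\<bar> \<le> norm (u \<xi>) * K"
        using component_le_norm_cart[of "B (u \<xi>)" j] K(1)[of "u \<xi>"] by linarith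
      also have "\<dots> \<le> 1 * K" using K(2) by (intro mult_right_mono u2) auto
      finally show ?thesis by simp
    qed
    then show "\<exists>K. \<forall>j \<xi>. \<bar>B (u \<xi>) $ j\<bar> \<le> K" by blast
    fix j v
    have bl: "bounded_linear (\<lambda>x. B x $ j)"
      using bounded_linear_compose[OF bounded_linear_vec_nth blB] .
    have "(LINT \<xi>|M. B (u \<xi>) $ j * (v \<bullet> \<xi>)) = (LINT \<xi>|M. B ((v \<bullet> \<xi>) *\<^sub>R u \<xi>) $ j)"
      using linear_cmul[OF B(1)] by (simp add: mult.commute)
    also have "\<dots> = B (A v) $ j" unfolding A_def by (rule integral_bounded_linear[OF bl int])
    also have "\<dots> = v $ j" using B(2) by (metis comp_apply id_apply)
    finally show "(LINT \<xi>|M. B (u \<xi>) $ j * (v \<bullet> \<xi>)) = v $ j" .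
  qed
qed

text \<open>A dual weight reads off a coordinate of a small frequency \<open>t\<close> from the wave \<open>e\<^sub>t\<close>, up to a
  quadratic error. Applied to \<open>t = f (x + h) - f x\<close> this recovers \<open>f\<close> from functions that are known to be
  holomorphic.\<close>

lemma weighted_char_fun_expansion:
  assumes \<kappa>: "\<kappa> \<in> borel_measurable borel" "\<And>\<xi>. \<bar>\<kappa> \<xi>\<bar> \<le> K"
    and dual: "\<And>v. (LINT \<xi>|M. \<kappa> \<xi> * (v \<bullet> \<xi>)) = v $ j"
  shows "\<exists>L\<ge>0. \<forall>t. cmod ((LINT \<xi>|M. of_real (\<kappa> \<xi>) * exp_wave (cvec t) \<xi>) - (LINT \<xi>|M. of_real (\<kappa> \<xi>))
     - \<i> * of_real (t $ j)) \<le> L * (norm t)\<^sup>2"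
proof -
  define L where "L = (LINT \<xi>|M. K * (norm \<xi>)\<^sup>2)"
  have K0: "K \<ge> 0" using \<kappa>(2)[of 0] by linarith
  have [measurable]: "\<kappa> \<in> borel_measurable borel" by (rule \<kappa>)
  have i1: "integrable M (\<lambda>\<xi>. of_real (\<kappa> \<xi>) * exp_wave (cvec t) \<xi>)" for t
    by (rule weighted_wave_integrable[of _ K]) (auto intro!: measurable_M simp: norm_mult \<kappa>)
  have i2: "integrable M (\<lambda>\<xi>. complex_of_real (\<kappa> \<xi>))"
    by (rule weighted_wave_integrable[of _ K]) (auto intro!: measurable_M simp: \<kappa>)
  have i4: "integrable M (\<lambda>\<xi>. K * (norm \<xi>)\<^sup>2)" using norm_square_integrable by simp
  have i3: "integrable M (\<lambda>\<xi>. \<kappa> \<xi> * (t \<bullet> \<xi>))" for t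
  proof (rule Bochner_Integration.integrable_bound)
    show "integrable M (\<lambda>\<xi>. K * norm t * (1 + (norm \<xi>)\<^sup>2))" using norm_square_integrable by simp
    show "(\<lambda>\<xi>. \<kappa> \<xi> * (t \<bullet> \<xi>)) \<in> borel_measurable M" by (rule measurable_M) measurable
    have "\<bar>\<kappa> \<xi> * (t \<bullet> \<xi>)\<bar> \<le> K * norm t * (1 + (norm \<xi>)\<^sup>2)" for \<xi>
    proof -
      have "\<bar>\<kappa> \<xi> * (t \<bullet> \<xi>)\<bar> \<le> K * (norm t * norm \<xi>)"
        unfolding abs_mult using \<kappa>(2) Cauchy_Schwarz_ineq2 K0 by (intro mult_mono) auto
      also have "\<dots> \<le> K * (norm t * (1 + (norm \<xi>)\<^sup>2))"
        using norm_le_one_plus_square[of \<xi>] K0 by (intro mult_left_mono) auto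
      finally show ?thesis by (simp add: mult.assoc)
    qed
    then show "AE \<xi> in M. norm (\<kappa> \<xi> * (t \<bullet> \<xi>)) \<le> norm (K * norm t * (1 + (norm \<xi>)\<^sup>2))"
      by (intro AE_I2) (auto intro: order_trans[OF _ abs_ge_self])
  qed
  show ?thesis
  proof (intro exI[of _ L] conjI allI)
    show "L \<ge> 0" unfolding L_def using K0 by (intro integral_nonneg_AE) auto
    fix t :: "real^'d"
    have "\<i> * of_real (t $ j) = \<i> * (LINT \<xi>|M. complex_of_real (\<kappa> \<xi> * (t \<bullet> \<xi>)))"
      unfolding integral_complex_of_real dual ..
    also have "\<dots> = (LINT \<xi>|M. \<i> * complex_of_real (\<kappa> \<xi> * (t \<bullet> \<xi>)))" by simp
    finally have "(LINT \<xi>|M. of_real (\<kappa> \<xi>) * exp_wave (cvec t) \<xi>) - (LINT \<xi>|M. of_real (\<kappa> \<xi>)) - \<i> * of_real (t $ j)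
        = (LINT \<xi>|M. of_real (\<kappa> \<xi>) * exp_wave (cvec t) \<xi> - of_real (\<kappa> \<xi>) - \<i> * complex_of_real (\<kappa> \<xi> * (t \<bullet> \<xi>)))"
      using i1 i2 i3 by (simp del: of_real_mult)
    also have "cmod \<dots> \<le> (LINT \<xi>|M. (norm t)\<^sup>2 * (K * (norm \<xi>)\<^sup>2))"
    proof (rule Bochner_Integration.integral_norm_bound_integral)
      show "integrable M (\<lambda>\<xi>. of_real (\<kappa> \<xi>) * exp_wave (cvec t) \<xi> - of_real (\<kappa> \<xi>) - \<i> * complex_of_real (\<kappa> \<xi> * (t \<bullet> \<xi>)))"
        using i1 i2 i3 by (simp del: of_real_mult)
      show "integrable M (\<lambda>\<xi>. (norm t)\<^sup>2 * (K * (norm \<xi>)\<^sup>2))" using i4 by simp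
      fix \<xi> :: "real^'d"
      have "cmod (exp (\<i> * of_real (t \<bullet> \<xi>)) - (1 + \<i> * of_real (t \<bullet> \<xi>))) \<le> \<bar>t \<bullet> \<xi>\<bar>\<^sup>2"
        using Taylor_exp[of "\<i> * of_real (t \<bullet> \<xi>)" 1] by (simp add: atMost_Suc power2_eq_square norm_mult add.commute)
      also have "\<dots> \<le> (norm t * norm \<xi>)\<^sup>2" using Cauchy_Schwarz_ineq2 by (intro power_mono) auto
      finally have T: "cmod (exp (\<i> * of_real (t \<bullet> \<xi>)) - (1 + \<i> * of_real (t \<bullet> \<xi>))) \<le> (norm t * norm \<xi>)\<^sup>2" .
      have "of_real (\<kappa> \<xi>) * exp_wave (cvec t) \<xi> - of_real (\<kappa> \<xi>) - \<i> * complex_of_real (\<kappa> \<xi> * (t \<bullet> \<xi>))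
          = of_real (\<kappa> \<xi>) * (exp (\<i> * of_real (t \<bullet> \<xi>)) - (1 + \<i> * of_real (t \<bullet> \<xi>)))"
        by (simp add: exp_wave_def algebra_simps)
      also have "cmod \<dots> \<le> K * (norm t * norm \<xi>)\<^sup>2"
        unfolding norm_mult using T \<kappa>(2) K0 by (intro mult_mono) auto
      finally show "cmod (of_real (\<kappa> \<xi>) * exp_wave (cvec t) \<xi> - of_real (\<kappa> \<xi>) - \<i> * complex_of_real (\<kappa> \<xi> * (t \<bullet> \<xi>)))
          \<le> (norm t)\<^sup>2 * (K * (norm \<xi>)\<^sup>2)" by (simp add: power_mult_distrib mult_ac)
    qed
    also have "\<dots> = L * (norm t)\<^sup>2" by (simp add: L_def mult.commute)
    finally show "cmod ((LINT \<xi>|M. of_real (\<kappa> \<xi>) * exp_wave (cvec t) \<xi>) - (LINT \<xi>|M. of_real (\<kappa> \<xi>))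
     - \<i> * of_real (t $ j)) \<le> L * (norm t)\<^sup>2" .
  qed
qed

end

section \<open>Differentiability of the map on the open set\<close>

lemma exp_wave_zero [simp]: "exp_wave (cvec 0) \<xi> = 1"
  by (simp add: exp_wave_def)

text \<open>The weights \<open>\<kappa>\<^sub>j\<close> are dual to the coordinates: they make the derivative of the waves \<open>e\<^bsub>f x\<^esub>\<close> in \<open>x\<close>
  display the components of the derivative of \<open>f\<close>.\<close>

locale dual_wave_transfer = wave_transfer M a U f C + decaying_measure M a
  for M :: "(real^'d) measure" and a :: real and U f C +
  fixes \<kappa> :: "'d \<Rightarrow> real^'d \<Rightarrow> real" and \<kappa>_bound :: real
  assumes \<kappa>_measurable: "\<And>j. \<kappa> j \<in> borel_measurable borel"
    and \<kappa>_le: "\<And>j \<xi>. \<bar>\<kappa> j \<xi>\<bar> \<le> \<kappa>_bound"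
    and \<kappa>_dual: "\<And>j v. (LINT \<xi>|M. \<kappa> j \<xi> * (v \<bullet> \<xi>)) = v $ j"
begin

lemma bounded_weight_one: "bounded_weight M (\<lambda>_. 1)"
  by (auto simp: bounded_weight_def)

lemma bounded_weight_dual: "bounded_weight M (\<lambda>\<xi>. of_real (\<kappa> j \<xi>))"
  using \<kappa>_le[of j] measurable_M[OF \<kappa>_measurable[of j]] by (auto simp: bounded_weight_def)

lemma ext_left_quadratic:
  assumes bw: "bounded_weight M \<eta>" and P: "admissible P" and l: "l \<in> clos" and z: "z \<in> tube a"
  shows "\<exists>K\<ge>0. \<exists>\<delta>>0. \<forall>h. norm h < \<delta> \<longrightarrow>
    cmod (ext_form \<eta> (\<lambda>\<xi>. P \<xi> * exp_wave (z + h) \<xi>) l - ext_form \<eta> (\<lambda>\<xi>. P \<xi> * exp_wave z \<xi>) l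
      - (\<Sum>m\<in>UNIV. h $ m * (\<i> * ext_form \<eta> (\<lambda>\<xi>. cdot (axis m 1) \<xi> * P \<xi> * exp_wave z \<xi>) l))) \<le> K * (norm h)\<^sup>2"
proof -
  obtain \<beta> where \<beta>: "\<beta> \<ge> 0" "\<And>m l. m \<in> clos \<Longrightarrow> l \<in> clos \<Longrightarrow> cmod (ext_form \<eta> m l) \<le> \<beta> * (l2norm M m * l2norm M l)"
    using ext_form_bound[OF bw] by blast
  show ?thesis
  proof (rule functional_wave_quadratic[of clos "\<lambda>m. ext_form \<eta> m l" "\<beta> * l2norm M l" P z])
    show "cmod (ext_form \<eta> m l) \<le> \<beta> * l2norm M l * l2norm M m" if "m \<in> clos" for m
      using \<beta>(2)[OF that l] by (simp add: mult_ac)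
    show "(\<lambda>\<xi>. cdot w \<xi> * P \<xi> * exp_wave z \<xi>) \<in> clos" if "z \<in> tube a" for z w
      using admissible_cdot[OF P, of w] that by (auto simp: admissible_def)
  qed (use P z \<beta>(1) in \<open>auto simp: admissible_def clos_L2 clos_add clos_scale
        ext_form_add_left[OF bw _ _ l] ext_form_scale_left[OF bw _ l]\<close>)
qed

lemma ext_left_has_derivative:
  assumes "bounded_weight M \<eta>" "admissible P" "l \<in> clos" "z \<in> tube a"
  shows "((\<lambda>z. ext_form \<eta> (\<lambda>\<xi>. P \<xi> * exp_wave z \<xi>) l) has_derivative
    (\<lambda>h. \<Sum>m\<in>UNIV. h $ m * (\<i> * ext_form \<eta> (\<lambda>\<xi>. cdot (axis m 1) \<xi> * P \<xi> * exp_wave z \<xi>) l))) (at z)"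
proof -
  obtain K \<delta> where "\<delta> > 0" and b: "\<And>h. norm h < \<delta> \<Longrightarrow>
    cmod (ext_form \<eta> (\<lambda>\<xi>. P \<xi> * exp_wave (z + h) \<xi>) l - ext_form \<eta> (\<lambda>\<xi>. P \<xi> * exp_wave z \<xi>) l
      - (\<Sum>m\<in>UNIV. h $ m * (\<i> * ext_form \<eta> (\<lambda>\<xi>. cdot (axis m 1) \<xi> * P \<xi> * exp_wave z \<xi>) l))) \<le> K * (norm h)\<^sup>2"
    using ext_left_quadratic[OF assms] by blast
  then show ?thesis by (intro has_derivative_quadratic[OF gradient_bounded_linear]) auto
qed

lemma ext_form_real_points:
  assumes "bounded_weight M \<eta>" "x \<in> U" "y \<in> U"
  shows "ext_form \<eta> (exp_wave (cvec x)) (exp_wave (cvec y)) = (LINT \<xi>|M. \<eta> \<xi> * exp_wave (cvec (f x - f y)) \<xi>)"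
proof -
  have "exp_wave (cvec (f x)) \<xi> * cnj (exp_wave (cvec (f y)) \<xi>) = exp_wave (cvec (f x - f y)) \<xi>" for \<xi>
    by (simp add: cnj_exp_wave_cvec flip: exp_wave_add cvec_add)
  then show ?thesis
    unfolding ext_form_single[OF assms] weighted_form_def by (simp add: mult.assoc)
qed

text \<open>The form extended from \<open>U\<close> is continuous in the point, and on \<open>U\<close> it is the characteristic function
  of \<open>f (x + h) - f x\<close>; so continuity of \<open>f\<close> comes from inverting the characteristic function at the
  origin.\<close>

lemma tendsto_f:
  assumes x: "x \<in> U"
  shows "((\<lambda>h. f (x + h) - f x) \<longlongrightarrow> 0) (at 0)"
proof (rule tendsto_zero_of_char_fun)
  let ?g = "\<lambda>z. ext_form (\<lambda>_. 1) (\<lambda>\<xi>. 1 * exp_wave z \<xi>) (exp_wave (cvec x))"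
  have "isCont ?g (cvec (x + 0))"
    using has_derivative_continuous[OF ext_left_has_derivative[OF bounded_weight_one admissible_one clos_real real_in_tube, of x x]]
    by simp
  moreover have "((\<lambda>h. cvec (x + h)) \<longlongrightarrow> cvec (x + 0)) (at 0)"
    unfolding cvec_def by (intro tendsto_intros)
  ultimately have lim: "((\<lambda>h. ?g (cvec (x + h))) \<longlongrightarrow> ?g (cvec (x + 0))) (at 0)"
    by (rule isCont_tendsto_compose)
  have val: "?g (cvec (x + 0)) = char_fun M 0"
    using ext_form_real_points[OF bounded_weight_one x x] by (simp add: char_fun_def)
  have ev: "\<forall>\<^sub>F h in at 0. ?g (cvec (x + h)) = char_fun M (f (x + h) - f x)"
  proof -
    have "\<forall>\<^sub>F h in at 0. x + h \<in> U"
    proof (rule topological_tendstoD)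
      show "((\<lambda>h. x + h) \<longlongrightarrow> x + 0) (at 0)" by (intro tendsto_intros)
    qed (use open_U x in auto)
    then show ?thesis
      by eventually_elim (simp add: ext_form_real_points[OF bounded_weight_one _ x] char_fun_def)
  qed
  show "((\<lambda>h. char_fun M (f (x + h) - f x)) \<longlongrightarrow> char_fun M 0) (at 0)"
    by (rule Lim_transform_eventually[OF lim[unfolded val] ev])
qed

text \<open>The holomorphic extension of the partial derivative \<open>\<partial>\<^sub>l f\<^sub>j\<close> to the whole tube. Formally it is
  \<open>\<integral> \<kappa>\<^sub>j (- \<i> \<partial>\<^sub>l G) cnj G\<close> for the wave \<open>G = e\<^bsub>f x\<^esub>\<close>: since \<open>G cnj G = 1\<close>, dividing by \<open>G\<close> is the same as
  multiplying by its conjugate, and that keeps the expression sesquilinear and free of zeros in a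
  denominator.\<close>

definition jac :: "'d \<Rightarrow> 'd \<Rightarrow> complex^'d \<Rightarrow> complex" where
  "jac j l = pairing (\<lambda>\<xi>. of_real (\<kappa> j \<xi>)) (cdot (axis l 1)) (\<lambda>_. 1)"

lemma jac_real: "jac j l (cvec x) = ext_form (\<lambda>\<xi>. of_real (\<kappa> j \<xi>)) (\<lambda>\<xi>. cdot (axis l 1) \<xi> * 1 * exp_wave (cvec x) \<xi>) (exp_wave (cvec x))"
  by (simp add: jac_def pairing_def)

text \<open>With \<open>t = f (x + h) - f x\<close>, the vector \<open>t\<close> equals the expected linear function of \<open>h\<close> up to terms
  quadratic in \<open>h\<close> and terms quadratic in \<open>t\<close>. As \<open>t\<close> is small by continuity, the latter are absorbed
  into the left-hand side, which first gives \<open>|t| \<le> A |h|\<close> and then the claim.\<close>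

lemma f_quadratic:
  assumes x: "x \<in> U"
  shows "\<exists>K. \<exists>\<delta>>0. \<forall>h. norm h < \<delta> \<longrightarrow> (\<forall>j.
    cmod (of_real (f (x + h) $ j) - of_real (f x $ j) - (\<Sum>m\<in>UNIV. of_real (h $ m) * jac j m (cvec x))) \<le> K * (norm h)\<^sup>2)"
proof -
  let ?ext = "\<lambda>j z. ext_form (\<lambda>\<xi>. of_real (\<kappa> j \<xi>)) (\<lambda>\<xi>. 1 * exp_wave z \<xi>) (exp_wave (cvec x))"
  define near where "near = (\<lambda>j K \<delta>. K \<ge> 0 \<and> \<delta> > 0 \<and> (\<forall>h. norm h < \<delta> \<longrightarrow>
    cmod (?ext j (cvec x + h)
      - ?ext j (cvec x)
      - (\<Sum>m\<in>UNIV. h $ m * (\<i> * jac j m (cvec x)))) \<le> K * (norm h)\<^sup>2))"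
  have "\<exists>K \<delta>. near j K \<delta>" for j
    unfolding jac_real near_def
    using ext_left_quadratic[OF bounded_weight_dual[of j] admissible_one clos_real[of x] real_in_tube[of x]] by blast
  then obtain K1 \<delta>1 where near: "\<And>j. near j (K1 j) (\<delta>1 j)" by metis
  have K1: "\<And>j. K1 j \<ge> 0" "\<And>j. \<delta>1 j > 0" "\<And>j h. norm h < \<delta>1 j \<Longrightarrow>
    cmod (?ext j (cvec x + h)
      - ?ext j (cvec x)
      - (\<Sum>m\<in>UNIV. h $ m * (\<i> * jac j m (cvec x)))) \<le> K1 j * (norm h)\<^sup>2"
    using near unfolding near_def by blast+
  have "\<exists>L\<ge>0. \<forall>t. cmod ((LINT \<xi>|M. of_real (\<kappa> j \<xi>) * exp_wave (cvec t) \<xi>) - (LINT \<xi>|M. of_real (\<kappa> j \<xi>))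
     - \<i> * of_real (t $ j)) \<le> L * (norm t)\<^sup>2" for j
    by (rule weighted_char_fun_expansion[OF \<kappa>_measurable \<kappa>_le \<kappa>_dual])
  then obtain L1 where L1: "\<And>j. L1 j \<ge> 0" "\<And>j t. cmod ((LINT \<xi>|M. of_real (\<kappa> j \<xi>) * exp_wave (cvec t) \<xi>)
     - (LINT \<xi>|M. of_real (\<kappa> j \<xi>)) - \<i> * of_real (t $ j)) \<le> L1 j * (norm t)\<^sup>2"
    by metis
  define K where "K = (\<Sum>j\<in>UNIV. K1 j)"
  define L where "L = (\<Sum>j\<in>UNIV. L1 j)"
  define J where "J = (\<Sum>j\<in>UNIV. \<Sum>m\<in>UNIV. cmod (jac j m (cvec x)))"
  define d where "d = real CARD('d)"
  have K: "K1 j \<le> K" and L: "L1 j \<le> L" and J: "(\<Sum>m\<in>UNIV. cmod (jac j m (cvec x))) \<le> J" for j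
    unfolding K_def L_def J_def by (rule member_le_sum; use K1 L1 in \<open>auto intro: sum_nonneg\<close>)+
  have nn: "K \<ge> 0" "L \<ge> 0" "J \<ge> 0" "d \<ge> 0"
    using K1 L1 by (auto simp: K_def L_def J_def d_def intro!: sum_nonneg)
  \<comment> \<open>Below \<open>\<tau>\<close> the summed quadratic terms in \<open>t\<close> are at most half of \<open>|t|\<close>.\<close>
  define A where "A = 2 * (d * (J + K))"
  define \<tau> where "\<tau> = 1 / (2 * (d * L) + 1)"
  have \<tau>: "\<tau> > 0" using nn by (auto simp: \<tau>_def intro!: divide_pos_pos add_nonneg_pos)
  obtain \<delta>2 where \<delta>2: "\<delta>2 > 0" "\<And>h. h \<noteq> 0 \<Longrightarrow> norm h < \<delta>2 \<Longrightarrow> norm (f (x + h) - f x) < \<tau>"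
    using tendsto_f[OF x, unfolded tendsto_iff, rule_format, OF \<tau>] unfolding eventually_at by auto
  obtain \<delta>3 where \<delta>3: "\<delta>3 > 0" "ball x \<delta>3 \<subseteq> U" using open_U x open_contains_ball by blast
  define \<delta> where "\<delta> = min (min 1 (Min (range \<delta>1))) (min \<delta>2 \<delta>3)"
  have \<delta>: "\<delta> > 0" "\<delta> \<le> 1" "\<And>j. \<delta> \<le> \<delta>1 j" "\<delta> \<le> \<delta>2" "\<delta> \<le> \<delta>3"
  proof -
    have m: "Min (range \<delta>1) > 0" "\<And>j. Min (range \<delta>1) \<le> \<delta>1 j" using K1(2) by auto
    show "\<delta> > 0" using m(1) \<delta>2(1) \<delta>3(1) by (simp add: \<delta>_def)
    show "\<delta> \<le> 1" "\<delta> \<le> \<delta>2" "\<delta> \<le> \<delta>3" by (simp_all add: \<delta>_def min_le_iff_disj)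
    show "\<delta> \<le> \<delta>1 j" for j using m(2)[of j] by (simp add: \<delta>_def min_le_iff_disj)
  qed
  show ?thesis
  proof (rule exI[of _ "K + L * A\<^sup>2"], intro exI[of _ \<delta>] conjI \<delta>(1) allI impI)
    fix h :: "real^'d" and j assume h: "norm h < \<delta>"
    define t where "t = f (x + h) - f x"
    define S where "S = (\<lambda>j. \<Sum>m\<in>UNIV. of_real (h $ m) * jac j m (cvec x))"
    have xh: "x + h \<in> U" using h \<delta>(5) \<delta>3(2) by (auto simp: dist_norm)
    have t\<tau>: "norm t < \<tau>" using \<delta>2(2)[of h] h \<delta>(4) \<tau> by (cases "h = 0") (auto simp: t_def)
    have main: "cmod (of_real (t $ j) - S j) \<le> K * (norm h)\<^sup>2 + L * (norm t)\<^sup>2" for j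
    proof -
      let ?I = "LINT \<xi>|M. complex_of_real (\<kappa> j \<xi>)"
      let ?E = "LINT \<xi>|M. of_real (\<kappa> j \<xi>) * exp_wave (cvec t) \<xi>"
      have e1: "?ext j (cvec x + cvec h) = ?E"
        using ext_form_real_points[OF bounded_weight_dual[of j] xh x] by (simp add: cvec_add t_def)
      have e2: "?ext j (cvec x) = ?I"
        using ext_form_real_points[OF bounded_weight_dual[of j] x x] by simp
      have e3: "(\<Sum>m\<in>UNIV. cvec h $ m * (\<i> * jac j m (cvec x))) = \<i> * S j"
        by (simp add: S_def cvec_def sum_distrib_left mult_ac)
      have "cmod (?E - ?I - \<i> * S j) \<le> K1 j * (norm h)\<^sup>2"
        using K1(3)[of "cvec h" j] h \<delta>(3)[of j] unfolding e1 e2 e3 by simp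
      also have "\<dots> \<le> K * (norm h)\<^sup>2" by (intro mult_right_mono K) auto
      finally have b1: "cmod (?E - ?I - \<i> * S j) \<le> K * (norm h)\<^sup>2" .
      have "cmod (?E - ?I - \<i> * of_real (t $ j)) \<le> L1 j * (norm t)\<^sup>2" by (rule L1(2))
      also have "\<dots> \<le> L * (norm t)\<^sup>2" by (intro mult_right_mono L) auto
      finally have b2: "cmod (?E - ?I - \<i> * of_real (t $ j)) \<le> L * (norm t)\<^sup>2" .
      have "cmod (of_real (t $ j) - S j) = cmod (\<i> * (of_real (t $ j) - S j))" by (simp add: norm_mult)
      also have "\<i> * (of_real (t $ j) - S j) = (?E - ?I - \<i> * S j) - (?E - ?I - \<i> * of_real (t $ j))"
        by (simp add: algebra_simps)
      also have "cmod \<dots> \<le> cmod (?E - ?I - \<i> * S j) + cmod (?E - ?I - \<i> * of_real (t $ j))"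
        by (rule norm_triangle_ineq4)
      finally show ?thesis using b1 b2 by linarith
    qed
    have Sb: "cmod (S j) \<le> J * norm h" for j
    proof -
      have "cmod (S j) \<le> (\<Sum>m\<in>UNIV. norm h * cmod (jac j m (cvec x)))"
        unfolding S_def by (rule sum_norm_le) (auto simp: norm_mult intro!: mult_right_mono component_le_norm_cart)
      also have "\<dots> = (\<Sum>m\<in>UNIV. cmod (jac j m (cvec x))) * norm h" by (simp add: sum_distrib_left mult.commute)
      also have "\<dots> \<le> J * norm h" by (intro mult_right_mono J) auto
      finally show ?thesis .
    qed
    have h2: "(norm h)\<^sup>2 \<le> norm h"
      using h \<delta>(2) mult_left_mono[of "norm h" 1 "norm h"] by (simp add: power2_eq_square)
    have "norm t \<le> (\<Sum>j\<in>UNIV. \<bar>t $ j\<bar>)" by (rule norm_le_l1_cart)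
    also have "\<dots> \<le> (\<Sum>j\<in>(UNIV::'d set). (J + K) * norm h + L * (norm t)\<^sup>2)"
    proof (rule sum_mono)
      fix j
      have "\<bar>t $ j\<bar> = cmod (of_real (t $ j))" by simp
      also have "\<dots> \<le> cmod (S j) + cmod (of_real (t $ j) - S j)" by (rule norm_triangle_sub)
      also have "\<dots> \<le> J * norm h + (K * (norm h)\<^sup>2 + L * (norm t)\<^sup>2)" by (intro add_mono Sb main)
      also have "\<dots> \<le> J * norm h + (K * norm h + L * (norm t)\<^sup>2)" using h2 nn by (simp add: mult_left_mono)
      finally show "\<bar>t $ j\<bar> \<le> (J + K) * norm h + L * (norm t)\<^sup>2" by (simp add: algebra_simps)
    qed
    also have "\<dots> = d * (J + K) * norm h + d * L * (norm t)\<^sup>2" by (simp add: d_def algebra_simps)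
    also have "d * L * (norm t)\<^sup>2 \<le> 1 / 2 * norm t"
    proof -
      have "d * L * norm t \<le> d * L * \<tau>" using t\<tau> nn by (intro mult_left_mono) auto
      also have "\<dots> \<le> 1 / 2"
      proof -
        have "2 * (d * L) + 1 > 0" using nn by (intro add_nonneg_pos) auto
        then show ?thesis by (simp add: \<tau>_def divide_le_eq)
      qed
      finally have "d * L * norm t * norm t \<le> 1 / 2 * norm t" by (rule mult_right_mono) auto
      then show ?thesis by (simp add: power2_eq_square mult.assoc)
    qed
    finally have tA: "norm t \<le> A * norm h" by (simp add: A_def algebra_simps)
    have "K * (norm h)\<^sup>2 + L * (norm t)\<^sup>2 \<le> K * (norm h)\<^sup>2 + L * (A * norm h)\<^sup>2"
      using tA nn by (intro add_left_mono mult_left_mono power_mono) auto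
    also have "\<dots> = (K + L * A\<^sup>2) * (norm h)\<^sup>2" by (simp add: power_mult_distrib algebra_simps)
    finally show "cmod (of_real (f (x + h) $ j) - of_real (f x $ j) - (\<Sum>m\<in>UNIV. of_real (h $ m) * jac j m (cvec x)))
        \<le> (K + L * A\<^sup>2) * (norm h)\<^sup>2"
      using main[of j] by (simp add: t_def S_def)
  qed
qed

lemma f_has_derivative:
  assumes x: "x \<in> U"
  shows "((\<lambda>y. complex_of_real (f y $ j)) has_derivative (\<lambda>h. \<Sum>m\<in>UNIV. of_real (h $ m) * jac j m (cvec x))) (at x)"
proof -
  obtain K \<delta> where \<delta>: "\<delta> > 0" "\<And>h. norm h < \<delta> \<Longrightarrow>
    cmod (of_real (f (x + h) $ j) - of_real (f x $ j) - (\<Sum>m\<in>UNIV. of_real (h $ m) * jac j m (cvec x))) \<le> K * (norm h)\<^sup>2"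
    using f_quadratic[OF x] by blast
  show ?thesis
  proof (rule has_derivative_quadratic[OF _ \<delta>(1)])
    have "bounded_linear (\<lambda>h::real^'d. of_real (h $ m) * c)" for m and c :: complex
      by (intro bounded_linear_mult_const bounded_linear_compose[OF bounded_linear_of_real bounded_linear_vec_nth])
    then show "bounded_linear (\<lambda>h. \<Sum>m\<in>UNIV. of_real (h $ m) * jac j m (cvec x))"
      by (intro bounded_linear_sum) auto
  qed (use \<delta>(2) in auto)
qed

lemma jac_has_derivative:
  "\<exists>g. \<forall>z\<in>tube a. \<forall>j l. (jac j l has_derivative (\<lambda>h. \<Sum>m\<in>UNIV. h $ m * g j l m z)) (at z)
     \<and> (\<forall>m. continuous_on (tube a) (g j l m))"
proof -
  let ?k = "\<lambda>j \<xi>. complex_of_real (\<kappa> j \<xi>)"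
  have adm: "admissible (cdot (axis l 1))" "admissible (\<lambda>\<xi>. cdot (axis m 1) \<xi> * cdot (axis l 1) \<xi>)" for l m
    using admissible_cdot[OF admissible_one, of "axis l 1"] by (auto intro: admissible_cdot)
  define g where "g = (\<lambda>j l m z. \<i> * pairing (?k j) (\<lambda>\<xi>. cdot (axis m 1) \<xi> * cdot (axis l 1) \<xi>) (\<lambda>_. 1) z
      - \<i> * pairing (?k j) (cdot (axis l 1)) (\<lambda>\<xi>. cdot (axis m 1) \<xi> * 1) z)"
  have cont: "continuous_on (tube a) (pairing (?k j) P Q)" if "admissible P" "admissible Q" for j P Q
    by (rule has_derivative_continuous_on)
       (use pairing_has_derivative[OF bounded_weight_dual that] has_derivative_at_withinI in blast)
  have "(jac j l has_derivative (\<lambda>h. \<Sum>m\<in>UNIV. h $ m * g j l m z)) (at z)" if "z \<in> tube a" for j l z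
    unfolding jac_def g_def by (rule pairing_has_derivative[OF bounded_weight_dual adm(1) admissible_one that])
  moreover have "continuous_on (tube a) (g j l m)" for j l m
    unfolding g_def by (intro continuous_intros cont adm admissible_one admissible_cdot)
  ultimately show ?thesis by blast
qed

end

section \<open>Holomorphic extension to the tube\<close>

lemma open_tube: "open (tube a :: (complex^'d) set)"
proof -
  have "continuous_on UNIV (\<lambda>z::complex^'d. norm (im_vec z))"
    unfolding im_vec_def by (intro continuous_intros)
  then have "open {z::complex^'d. norm (im_vec z) < a}"
    by (rule open_Collect_less[OF _ continuous_on_const])
  then show ?thesis by (simp add: tube_im_vec)
qed

lemma convex_tube: "convex (tube a :: (complex^'d) set)"
proof -
  have "linear (im_vec :: complex^'d \<Rightarrow> _)" by (rule linearI) (auto simp: im_vec_def vec_eq_iff)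
  then have "convex (im_vec -` ball 0 a :: (complex^'d) set)" by (rule convex_linear_vimage[OF _ convex_ball])
  moreover have "(tube a :: (complex^'d) set) = im_vec -` ball 0 a" by (auto simp: tube_im_vec)
  ultimately show ?thesis by (simp only:)
qed

lemma has_derivative_vec_lambda:
  fixes g :: "'i::finite \<Rightarrow> 'a::real_normed_vector \<Rightarrow> complex"
  assumes "\<And>i. (g i has_derivative g' i) (at x)"
  shows "((\<lambda>x. \<chi> i. g i x) has_derivative (\<lambda>h. \<chi> i. g' i h)) (at x)"
proof -
  have vec: "(\<chi> i. y i) = (\<Sum>i\<in>UNIV. axis i (y i))" for y :: "'i \<Rightarrow> complex"
    by (simp add: vec_eq_iff axis_def)
  have bl: "bounded_linear (axis i :: complex \<Rightarrow> complex^'i)" for i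
  proof -
    have "linear (axis i :: complex \<Rightarrow> complex^'i)"
      by (rule linearI) (auto simp: vec_eq_iff axis_def)
    then show ?thesis by (rule linear_conv_bounded_linear[THEN iffD1])
  qed
  have "((\<lambda>x. \<Sum>i\<in>UNIV. axis i (g i x)) has_derivative (\<lambda>h. \<Sum>i\<in>UNIV. axis i (g' i h))) (at x)"
    by (rule has_derivative_sum) (rule bounded_linear.has_derivative[OF bl assms])
  then show ?thesis by (simp only: vec)
qed

context decaying_measure
begin

lemma pairing_with_wave_has_derivative:
  assumes z: "z \<in> tube a"
  shows "\<exists>c. ((\<lambda>z. weighted_form M (\<lambda>_. 1) (\<lambda>\<xi>. 1 * exp_wave z \<xi>) (exp_wave (cvec y)))
     has_derivative (\<lambda>h. \<Sum>m\<in>UNIV. h $ m * c m)) (at z)"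
proof -
  let ?l = "exp_wave (cvec y) :: real^'d \<Rightarrow> complex"
  have l: "?l \<in> L2 M"
    using subexp_exp_wave_L2[OF subexp_one, of "cvec y"] a_pos by (simp add: tube_im_vec)
  have bw: "bounded_weight M (\<lambda>_. 1)" by (auto simp: bounded_weight_def)
  have "\<exists>K\<ge>0. \<exists>\<delta>>0. \<forall>h. norm h < \<delta> \<longrightarrow>
    cmod (weighted_form M (\<lambda>_. 1) (\<lambda>\<xi>. 1 * exp_wave (z + h) \<xi>) ?l - weighted_form M (\<lambda>_. 1) (\<lambda>\<xi>. 1 * exp_wave z \<xi>) ?l
      - (\<Sum>m\<in>UNIV. h $ m * (\<i> * weighted_form M (\<lambda>_. 1) (\<lambda>\<xi>. cdot (axis m 1) \<xi> * 1 * exp_wave z \<xi>) ?l))) \<le> K * (norm h)\<^sup>2"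
  proof (rule functional_wave_quadratic[of "L2 M" "\<lambda>m. weighted_form M (\<lambda>_. 1) m ?l" "l2norm M ?l" "\<lambda>_. 1" z])
    show "cmod (weighted_form M (\<lambda>_. 1) m ?l) \<le> l2norm M ?l * l2norm M m" if "m \<in> L2 M" for m
      using L2_form_bound[OF that l, of "\<lambda>_. 1" 1] by (simp add: weighted_form_def mult.commute)
    show "(\<lambda>\<xi>. cdot w \<xi> * 1 * exp_wave z \<xi>) \<in> L2 M" if "z \<in> tube a" for z w
      using subexp_exp_wave_L2[OF subexp_cdot that] by simp
    show "(\<lambda>\<xi>. 1 * exp_wave z \<xi>) \<in> L2 M" if "z \<in> tube a" for z :: "complex^'d"
      by (rule subexp_exp_wave_L2[OF subexp_one that])
    show "weighted_form M (\<lambda>_. 1) (\<lambda>\<xi>. m \<xi> + m' \<xi>) ?l = weighted_form M (\<lambda>_. 1) m ?l + weighted_form M (\<lambda>_. 1) m' ?l"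
      if "m \<in> L2 M" "m' \<in> L2 M" for m m'
      by (rule weighted_form_simps(1)[OF bw that l])
  qed (use z in \<open>auto simp: L2_add L2_scale weighted_form_scale\<close>)
  then obtain K \<delta> where "\<delta> > 0" and b: "\<And>h. norm h < \<delta> \<Longrightarrow>
    cmod (weighted_form M (\<lambda>_. 1) (\<lambda>\<xi>. 1 * exp_wave (z + h) \<xi>) ?l - weighted_form M (\<lambda>_. 1) (\<lambda>\<xi>. 1 * exp_wave z \<xi>) ?l
      - (\<Sum>m\<in>UNIV. h $ m * (\<i> * weighted_form M (\<lambda>_. 1) (\<lambda>\<xi>. cdot (axis m 1) \<xi> * 1 * exp_wave z \<xi>) ?l))) \<le> K * (norm h)\<^sup>2"
    by blast
  show ?thesis
    by (rule exI, rule has_derivative_quadratic[OF gradient_bounded_linear \<open>\<delta> > 0\<close> b])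
qed

end

context dual_wave_transfer
begin

text \<open>The candidate is the radial primitive of the Jacobian; near the base point it agrees with the
  map by the fundamental theorem of calculus.\<close>

lemma radial_primitive_eq_f:
  assumes ball: "ball x0 r \<subseteq> U" and x: "x \<in> ball x0 r"
  shows "of_real (f x0 $ j) + integral {0..1} (\<lambda>s. \<Sum>l\<in>UNIV. (cvec x - cvec x0) $ l * jac j l (cvec x0 + s *\<^sub>R (cvec x - cvec x0)))
    = of_real (f x $ j)"
proof -
  define v where "v = x - x0"
  have nv: "norm v < r" using x by (simp add: v_def dist_norm norm_minus_commute)
  have "((\<lambda>s. \<Sum>l\<in>UNIV. of_real (v $ l) * jac j l (cvec (x0 + s *\<^sub>R v))) has_integral
      (of_real (f (x0 + 1 *\<^sub>R v) $ j) - of_real (f (x0 + 0 *\<^sub>R v) $ j))) {0..1}"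
  proof (rule fundamental_theorem_of_calculus)
    fix s :: real assume s: "s \<in> {0..1}"
    have "norm (s *\<^sub>R v) \<le> 1 * norm v" using s by (simp add: mult_left_le_one_le)
    then have U: "x0 + s *\<^sub>R v \<in> U" using nv ball by (auto simp: dist_norm)
    have d: "((\<lambda>s. x0 + s *\<^sub>R v) has_derivative (\<lambda>t. t *\<^sub>R v)) (at s within {0..1})"
      by (auto intro!: derivative_eq_intros)
    have "((\<lambda>s. complex_of_real (f (x0 + s *\<^sub>R v) $ j)) has_derivative
        (\<lambda>t. \<Sum>m\<in>UNIV. of_real ((t *\<^sub>R v) $ m) * jac j m (cvec (x0 + s *\<^sub>R v)))) (at s within {0..1})"
      by (rule has_derivative_compose[OF d f_has_derivative[OF U]])
    moreover have "(\<lambda>t. \<Sum>m\<in>UNIV. of_real ((t *\<^sub>R v) $ m) * jac j m (cvec (x0 + s *\<^sub>R v)))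
        = (\<lambda>t. t *\<^sub>R (\<Sum>l\<in>UNIV. of_real (v $ l) * jac j l (cvec (x0 + s *\<^sub>R v))))"
      unfolding scaleR_sum_right vector_scaleR_component
      by (intro ext sum.cong refl) (simp add: scaleR_conv_of_real[where 'a=complex])
    ultimately show "((\<lambda>s. complex_of_real (f (x0 + s *\<^sub>R v) $ j)) has_vector_derivative
        (\<Sum>l\<in>UNIV. of_real (v $ l) * jac j l (cvec (x0 + s *\<^sub>R v)))) (at s within {0..1})"
      unfolding has_vector_derivative_def by (simp only:)
  qed simp
  then have "integral {0..1} (\<lambda>s. \<Sum>l\<in>UNIV. of_real (v $ l) * jac j l (cvec (x0 + s *\<^sub>R v)))
      = of_real (f x $ j) - of_real (f x0 $ j)"
    by (simp add: integral_unique v_def)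
  moreover have "(cvec x - cvec x0) $ l = of_real (v $ l)" for l by (simp add: v_def cvec_def)
  moreover have "cvec x0 + s *\<^sub>R (cvec x - cvec x0) = cvec (x0 + s *\<^sub>R v)" for s
    by (simp add: v_def cvec_add cvec_scaleR cvec_diff)
  ultimately show ?thesis by simp
qed

text \<open>The radial primitive of the extended Jacobian is holomorphic on the tube and equals \<open>f\<close> on a ball
  around \<open>x0\<close> in \<open>U\<close>. As \<open>U\<close> may be disconnected, agreement at another point \<open>x1\<close> of \<open>U\<close> does not follow by
  continuation of \<open>f\<close> inside \<open>U\<close>. It is obtained on the complex line through \<open>x0\<close> and \<open>x1\<close>: the
  characteristic function at \<open>F - f x1\<close> and the form extended from \<open>U\<close>, paired with the wave at \<open>x1\<close>, agree
  near \<open>x0\<close>, hence at \<open>x1\<close>, where the latter has its value at the origin.\<close>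

theorem holomorphic_extension:
  "\<exists>F :: complex^'d \<Rightarrow> complex^'d. holomorphic_map_on F (tube a) \<and> (\<forall>x\<in>U. F (cvec x) = cvec (f x))"
proof -
  obtain x0 r where x0: "x0 \<in> U" and r: "r > 0" and ball: "ball x0 r \<subseteq> U"
    using U_nonempty open_U open_contains_ball by blast
  obtain g where g: "\<And>j l z. z \<in> tube a \<Longrightarrow> (jac j l has_derivative (\<lambda>h. \<Sum>m\<in>UNIV. h $ m * g j l m z)) (at z)"
    "\<And>j l m. continuous_on (tube a) (g j l m)"
    using jac_has_derivative real_in_tube by blast
  define G where "G = (\<lambda>j z. of_real (f x0 $ j) +
     integral {0..1} (\<lambda>s. \<Sum>l\<in>UNIV. (z - cvec x0) $ l * jac j l (cvec x0 + s *\<^sub>R (z - cvec x0))))"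
  have "\<exists>c. (G j has_derivative (\<lambda>h. \<Sum>m\<in>UNIV. h $ m * c m)) (at z)" if z: "z \<in> tube a" for j z
  proof -
    obtain c where "((\<lambda>z. integral {0..1} (\<lambda>s. \<Sum>l\<in>UNIV. (z - cvec x0) $ l * jac j l (cvec x0 + s *\<^sub>R (z - cvec x0))))
      has_derivative (\<lambda>h. \<Sum>m\<in>UNIV. h $ m * c m)) (at z)"
      using radial_primitive[where D="\<lambda>l. jac j l" and G="\<lambda>l m. g j l m" and p="cvec x0",
          OF open_tube convex_tube real_in_tube g(1) g(2) z] by blast
    from has_derivative_add[OF has_derivative_const this] show ?thesis
      unfolding G_def by auto
  qed
  note G_gradient = this
  define c where "c = (\<lambda>j z. SOME c. (G j has_derivative (\<lambda>h. \<Sum>m\<in>UNIV. h $ m * c m)) (at z))"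
  have c: "(G j has_derivative (\<lambda>h. \<Sum>m\<in>UNIV. h $ m * c j z m)) (at z)" if "z \<in> tube a" for j z
    unfolding c_def by (rule someI_ex[OF G_gradient[OF that]])
  define F :: "complex^'d \<Rightarrow> complex^'d" where "F = (\<lambda>z. \<chi> j. G j z)"
  have F: "(F has_derivative (\<lambda>h. \<chi> j. \<Sum>m\<in>UNIV. h $ m * c j z m)) (at z)" if "z \<in> tube a" for z
    unfolding F_def by (intro has_derivative_vec_lambda c that)
  have hol: "holomorphic_map_on F (tube a)"
    unfolding holomorphic_map_on_def
  proof
    fix z :: "complex^'d" assume z: "z \<in> tube a"
    have "(\<chi> j. \<Sum>m\<in>UNIV. (k *s v) $ m * c j z m) = k *s (\<chi> j. \<Sum>m\<in>UNIV. v $ m * c j z m)" for k and v :: "complex^'d"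
      by (simp add: vec_eq_iff sum_distrib_left mult.assoc)
    then show "\<exists>F'. (F has_derivative F') (at z) \<and> (\<forall>k v. F' (k *s v) = k *s F' v)"
      using F[OF z] by blast
  qed
  have near: "F (cvec x) = cvec (f x)" if "x \<in> ball x0 r" for x
    using radial_primitive_eq_f[OF ball that] by (simp add: F_def G_def vec_eq_iff cvec_def[of "f x"])
  have "F (cvec x1) = cvec (f x1)" if x1: "x1 \<in> U" for x1
  proof -
    define v where "v = x1 - x0"
    define line where "line = (\<lambda>s. cvec x0 + s *s cvec v)"
    have line_real: "line (of_real t) = cvec (x0 + t *\<^sub>R v)" for t
      by (simp add: line_def vec_eq_iff cvec_def)
    have line1: "line 1 = cvec x1" using line_real[of 1] by (simp add: v_def)
    have line_cnj: "line (cnj s) = cnj_vec (line s)" for s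
      by (simp add: line_def cnj_vec_def cvec_def vec_eq_iff)
    define \<Omega> where "\<Omega> = {s. line s \<in> tube a}"
    have line_cont: "continuous_on UNIV line"
      unfolding line_def vector_scalar_mult_def by (intro continuous_intros)
    have open_\<Omega>: "open \<Omega>"
      using open_vimage[OF open_tube line_cont] by (simp add: \<Omega>_def vimage_def)
    have "convex \<Omega>"
    proof (rule convexI)
      fix s t u w assume st: "s \<in> \<Omega>" "t \<in> \<Omega>" "0 \<le> (u::real)" "0 \<le> w" "u + w = 1"
      have "line (u *\<^sub>R s + w *\<^sub>R t) = u *\<^sub>R line s + w *\<^sub>R line t"
      proof -
        have u: "u = 1 - w" using st(5) by simp
        show ?thesis
          unfolding u vec_eq_iff vector_add_component vector_scaleR_component line_def vector_smult_component
          by (intro allI) (simp add: complex_eq_iff algebra_simps)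
      qed
      then show "u *\<^sub>R s + w *\<^sub>R t \<in> \<Omega>"
        using convexD[OF convex_tube, of "line s" a "line t" u w] st by (simp add: \<Omega>_def)
    qed
    then have conn_\<Omega>: "connected \<Omega>" by (rule convex_connected)
    have real_\<Omega>: "of_real t \<in> \<Omega>" for t by (simp add: \<Omega>_def line_real real_in_tube)
    define T where "T = {complex_of_real t | t. \<bar>t\<bar> < r / (norm v + 1)}"
    have v1: "norm v + 1 > 0" using norm_ge_zero[of v] by linarith
    have limT: "0 islimpt T"
      unfolding islimpt_approachable
    proof (intro allI impI)
      fix e :: real assume e: "e > 0"
      have "r / (norm v + 1) > 0" using r v1 by simp
      then obtain t where "t > 0" "t < e" "t < r / (norm v + 1)" using field_lbound_gt_zero[OF e] by blast
      then have "\<bar>t\<bar> < r / (norm v + 1)" "complex_of_real t \<noteq> 0" "dist (complex_of_real t) 0 < e"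
        by simp_all
      then show "\<exists>s\<in>T. s \<noteq> 0 \<and> dist s 0 < e" unfolding T_def by blast
    qed
    have T_ball: "x0 + t *\<^sub>R v \<in> ball x0 r" if "\<bar>t\<bar> < r / (norm v + 1)" for t
    proof -
      have "\<bar>t\<bar> * norm v \<le> \<bar>t\<bar> * (norm v + 1)" by (intro mult_left_mono) auto
      also have "\<dots> < r" using that v1 by (simp add: pos_less_divide_eq)
      finally show ?thesis by (simp add: dist_norm)
    qed
    have F_T: "F (line (of_real t)) = cvec (f (x0 + t *\<^sub>R v))" if "\<bar>t\<bar> < r / (norm v + 1)" for t
      unfolding line_real by (rule near[OF T_ball[OF that]])
    have G_der: "((\<lambda>s. G j (line s)) has_field_derivative (\<Sum>m\<in>UNIV. cvec v $ m * c j (line s) m)) (at s)"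
      if "s \<in> \<Omega>" for j s
      unfolding line_def by (rule gradient_along_line) (use c that in \<open>auto simp: \<Omega>_def line_def\<close>)
    have G_hol: "(\<lambda>s. G j (line s)) holomorphic_on \<Omega>" for j
      using G_der open_\<Omega> by (auto simp: holomorphic_on_open)
    \<comment> \<open>The extension stays real on the real line: it agrees with its reflected conjugate.\<close>
    have F_real: "\<exists>y. F (line (of_real t)) = cvec y" for t
    proof -
      have "cnj (G j (line (of_real t))) = G j (line (of_real t))" for j
      proof -
        have cnj_\<Omega>: "cnj ` \<Omega> = \<Omega>"
        proof -
          have "cnj s \<in> \<Omega>" if "s \<in> \<Omega>" for s using that by (simp add: \<Omega>_def line_cnj)
          then show ?thesis by (force intro: image_eqI[of _ cnj "cnj s" for s])
        qed
        have "(cnj \<circ> (\<lambda>s. G j (line s)) \<circ> cnj) holomorphic_on \<Omega>"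
          by (rule holomorphic_on_compose_cnj_cnj) (use G_hol cnj_\<Omega> open_\<Omega> in auto)
        then have "(\<lambda>s. cnj (G j (line (cnj s))) - G j (line s)) holomorphic_on \<Omega>"
          using G_hol by (auto simp: o_def intro!: holomorphic_on_diff)
        then have "cnj (G j (line (cnj (of_real t)))) - G j (line (of_real t)) = 0"
        proof (rule analytic_continuation[OF _ open_\<Omega> conn_\<Omega> _ _ limT])
          show "T \<subseteq> \<Omega>" using real_\<Omega> by (auto simp: T_def)
          show "0 \<in> \<Omega>" using real_\<Omega>[of 0] by simp
          fix s assume "s \<in> T"
          then obtain t' where t': "s = of_real t'" "\<bar>t'\<bar> < r / (norm v + 1)" by (auto simp: T_def)
          have "G j (line s) = of_real (f (x0 + t' *\<^sub>R v) $ j)"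
            using arg_cong[OF F_T[OF t'(2)], of "\<lambda>z. z $ j"] by (simp add: t'(1) F_def cvec_def)
          then show "cnj (G j (line (cnj s))) - G j (line s) = 0" by (simp add: t'(1))
        qed (rule real_\<Omega>)
        then show ?thesis by simp
      qed
      then have "F (line (of_real t)) = cvec (\<chi> j. Re (G j (line (of_real t))))"
        by (simp add: F_def cvec_def vec_eq_iff complex_eq_iff)
      then show ?thesis by blast
    qed
    define \<psi> where "\<psi> = (\<lambda>z. weighted_form M (\<lambda>_. 1) (\<lambda>\<xi>. 1 * exp_wave z \<xi>) (exp_wave (cvec (f x1))))"
    have \<psi>_real: "\<psi> (cvec y) = char_fun M (y - f x1)" for y
    proof -
      have "exp_wave (cvec y) \<xi> * cnj (exp_wave (cvec (f x1)) \<xi>) = exp_wave (cvec (y - f x1)) \<xi>" for \<xi>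
        by (simp add: cnj_exp_wave_cvec flip: exp_wave_add cvec_add)
      then show ?thesis by (simp add: \<psi>_def weighted_form_def char_fun_def)
    qed
    define p where "p = (\<lambda>s. ext_form (\<lambda>_. 1) (\<lambda>\<xi>. 1 * exp_wave (line s) \<xi>) (exp_wave (cvec x1)))"
    have p_real: "p (of_real t) = char_fun M (f (x0 + t *\<^sub>R v) - f x1)" if "x0 + t *\<^sub>R v \<in> U" for t
      using ext_form_real_points[OF bounded_weight_one that x1] by (simp add: p_def line_real char_fun_def)
    \<comment> \<open>The composition with \<open>F\<close> is defined where \<open>F\<close> takes values in the tube; the component of this set
      that contains the real line joins the two points.\<close>
    define \<Omega>' where "\<Omega>' = \<Omega> \<inter> (\<lambda>s. F (line s)) -` tube a"
    define S where "S = connected_component_set \<Omega>' 0"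
    have F_line: "((\<lambda>s. F (line s)) has_derivative (\<lambda>t. \<chi> j. (\<Sum>m\<in>UNIV. cvec v $ m * c j (line s) m) * t)) (at s)"
      if "s \<in> \<Omega>" for s
      unfolding F_def using G_der[OF that] by (intro has_derivative_vec_lambda) (simp add: has_field_derivative_def)
    have "continuous_on \<Omega> (\<lambda>s. F (line s))"
      by (rule has_derivative_continuous_on) (use F_line has_derivative_at_withinI in blast)
    then have open_\<Omega>': "open \<Omega>'"
      unfolding \<Omega>'_def using open_\<Omega> open_tube by (rule continuous_open_preimage)
    have "range complex_of_real \<subseteq> \<Omega>'"
    proof safe
      fix t :: real
      obtain y where "F (line (of_real t)) = cvec y" using F_real by blast
      then show "of_real t \<in> \<Omega>'" using real_\<Omega> real_in_tube by (auto simp: \<Omega>'_def)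
    qed
    moreover have "connected (range complex_of_real)"
      by (intro connected_continuous_image continuous_intros) auto
    moreover have "0 \<in> range complex_of_real" by (metis of_real_0 rangeI)
    ultimately have real_S: "of_real t \<in> S" for t
      unfolding S_def using connected_component_maximal[of 0 "range complex_of_real" \<Omega>'] by blast
    have S_sub: "S \<subseteq> \<Omega>'" unfolding S_def by (rule connected_component_subset)
    have "open S" unfolding S_def by (rule open_connected_component[OF open_\<Omega>'])
    have "connected S" unfolding S_def by (rule connected_connected_component)
    have p_hol: "p holomorphic_on S"
      unfolding holomorphic_on_open[OF \<open>open S\<close>]
    proof
      fix s assume "s \<in> S"
      then have "line s \<in> tube a" using S_sub by (auto simp: \<Omega>'_def \<Omega>_def)
      from gradient_along_line[OF ext_left_has_derivative[OF bounded_weight_one admissible_one clos_real this, unfolded line_def]]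
      show "\<exists>p'. (p has_field_derivative p') (at s)" unfolding p_def line_def by blast
    qed
    have q_hol: "(\<lambda>s. \<psi> (F (line s))) holomorphic_on S"
      unfolding holomorphic_on_open[OF \<open>open S\<close>]
    proof
      fix s assume "s \<in> S"
      then have s: "s \<in> \<Omega>" "F (line s) \<in> tube a" using S_sub by (auto simp: \<Omega>'_def)
      obtain k where k: "(\<psi> has_derivative (\<lambda>h. \<Sum>m\<in>UNIV. h $ m * k m)) (at (F (line s)))"
        using pairing_with_wave_has_derivative[OF s(2)] unfolding \<psi>_def by blast
      define D where "D = (\<lambda>j. \<Sum>m\<in>UNIV. cvec v $ m * c j (line s) m)"
      have "((\<lambda>s. \<psi> (F (line s))) has_derivative (\<lambda>t. \<Sum>m\<in>UNIV. (\<chi> j. D j * t) $ m * k m)) (at s)"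
        using has_derivative_compose[OF F_line[OF s(1)] k] by (simp add: D_def)
      moreover have "(\<lambda>t. \<Sum>m\<in>UNIV. (\<chi> j. D j * t) $ m * k m) = (*) (\<Sum>m\<in>UNIV. D m * k m)"
        unfolding sum_distrib_right vec_lambda_beta by (intro ext sum.cong refl) (simp add: mult_ac)
      ultimately have "((\<lambda>s. \<psi> (F (line s))) has_field_derivative (\<Sum>m\<in>UNIV. D m * k m)) (at s)"
        by (simp add: has_field_derivative_def)
      then show "\<exists>q'. ((\<lambda>s. \<psi> (F (line s))) has_field_derivative q') (at s)" by blast
    qed
    have "p 1 - \<psi> (F (line 1)) = 0"
    proof (rule analytic_continuation[OF holomorphic_on_diff[OF p_hol q_hol] \<open>open S\<close> \<open>connected S\<close> _ _ limT])
      show "T \<subseteq> S" using real_S by (auto simp: T_def)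
      show "0 \<in> S" using real_S[of 0] by simp
      show "1 \<in> S" using real_S[of 1] by simp
      fix s assume "s \<in> T"
      then obtain t where t: "s = of_real t" "\<bar>t\<bar> < r / (norm v + 1)" by (auto simp: T_def)
      show "p s - \<psi> (F (line s)) = 0"
        using p_real[of t] ball T_ball[OF t(2)] by (simp add: t(1) F_T[OF t(2)] \<psi>_real subset_iff)
    qed
    moreover have "p 1 = char_fun M 0" using p_real[of 1] x1 by (simp add: v_def)
    moreover obtain y where y: "F (line 1) = cvec y" using F_real[of 1] by auto
    ultimately have "char_fun M (y - f x1) = char_fun M 0" by (simp add: \<psi>_real)
    then have "y = f x1" using char_fun_eq_imp_zero by fastforce
    then show ?thesis using y by (simp add: line1)
  qed
  then show ?thesis using hol by blast
qed

end

section \<open>The Riemann-Lebesgue lemma\<close>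

lemma lborel_integral_shift:
  fixes h :: "'a::euclidean_space \<Rightarrow> 'b::{banach, second_countable_topology}"
  assumes "h \<in> borel_measurable borel"
  shows "(LINT x|lborel. h (s + x)) = (LINT x|lborel. h x)"
    and "integrable lborel (\<lambda>x. h (s + x)) \<longleftrightarrow> integrable lborel h"
proof -
  have "integral\<^sup>L (distr lborel borel ((+) s)) h = (LINT x|lborel. h (s + x))"
    by (rule integral_distr) (use assms in auto)
  then show "(LINT x|lborel. h (s + x)) = (LINT x|lborel. h x)" by (simp add: lborel_distr_plus)
  have "integrable (distr lborel borel ((+) s)) h \<longleftrightarrow> integrable lborel (\<lambda>x. h (s + x))"
    by (rule integrable_distr_eq) (use assms in auto)
  then show "integrable lborel (\<lambda>x. h (s + x)) \<longleftrightarrow> integrable lborel h" by (simp add: lborel_distr_plus)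
qed

definition fourier_decays :: "(real^'d \<Rightarrow> complex) \<Rightarrow> bool" where
  "fourier_decays w \<longleftrightarrow> ((\<lambda>t. LINT \<xi>|lborel. w \<xi> * exp_wave (cvec t) \<xi>) \<longlongrightarrow> 0) at_infinity"

lemma integrable_times_wave:
  assumes "integrable lborel w"
  shows "integrable lborel (\<lambda>\<xi>. w \<xi> * exp_wave (cvec t) \<xi>)"
proof (rule Bochner_Integration.integrable_bound[OF integrable_norm[OF assms]])
  show "(\<lambda>\<xi>. w \<xi> * exp_wave (cvec t) \<xi>) \<in> borel_measurable lborel"
    using borel_measurable_integrable[OF assms] by measurable
qed (simp add: norm_mult)

lemma fourier_decays_L1_limit:
  assumes w: "integrable lborel w"
    and approx: "\<And>e. e > 0 \<Longrightarrow> \<exists>v. integrable lborel v \<and> fourier_decays v \<and> (LINT \<xi>|lborel. cmod (w \<xi> - v \<xi>)) < e"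
  shows "fourier_decays w"
  unfolding fourier_decays_def tendsto_iff
proof (intro allI impI)
  fix e :: real assume "e > 0"
  then obtain v where v: "integrable lborel v" "fourier_decays v" "(LINT \<xi>|lborel. cmod (w \<xi> - v \<xi>)) < e / 2"
    using approx[of "e / 2"] by auto
  have "\<forall>\<^sub>F t in at_infinity. dist (LINT \<xi>|lborel. v \<xi> * exp_wave (cvec t) \<xi>) 0 < e / 2"
    using v(2) half_gt_zero[OF \<open>e > 0\<close>] unfolding fourier_decays_def tendsto_iff by blast
  then show "\<forall>\<^sub>F t in at_infinity. dist (LINT \<xi>|lborel. w \<xi> * exp_wave (cvec t) \<xi>) 0 < e"
  proof eventually_elim
    case (elim t)
    have "(LINT \<xi>|lborel. w \<xi> * exp_wave (cvec t) \<xi>) - (LINT \<xi>|lborel. v \<xi> * exp_wave (cvec t) \<xi>)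
        = (LINT \<xi>|lborel. (w \<xi> - v \<xi>) * exp_wave (cvec t) \<xi>)"
      using integrable_times_wave[OF w] integrable_times_wave[OF v(1)] by (simp add: left_diff_distrib)
    also have "cmod \<dots> \<le> (LINT \<xi>|lborel. cmod ((w \<xi> - v \<xi>) * exp_wave (cvec t) \<xi>))"
      by (rule integral_norm_bound)
    also have "\<dots> = (LINT \<xi>|lborel. cmod (w \<xi> - v \<xi>))" by (simp add: norm_mult)
    finally have "cmod ((LINT \<xi>|lborel. w \<xi> * exp_wave (cvec t) \<xi>) - (LINT \<xi>|lborel. v \<xi> * exp_wave (cvec t) \<xi>)) < e / 2"
      using v(3) by linarith
    then show ?case using elim
      norm_triangle_sub[of "LINT \<xi>|lborel. w \<xi> * exp_wave (cvec t) \<xi>" "LINT \<xi>|lborel. v \<xi> * exp_wave (cvec t) \<xi>"]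
      by simp
  qed
qed

text \<open>Shifting by half a period \<open>s\<close> of the wave changes its sign, so the integral over an open set is
  controlled by the difference between the set and its translate, which vanishes as \<open>s\<close> tends to
  zero because the set is open.\<close>

lemma fourier_decays_open:
  fixes G :: "(real^'d) set"
  assumes G: "open G" "emeasure lborel G < \<infinity>"
  shows "fourier_decays (\<lambda>\<xi>. complex_of_real (indicator G \<xi>))"
proof -
  have [measurable]: "G \<in> sets borel" using G by simp
  have iG: "integrable lborel (indicator G :: real^'d \<Rightarrow> real)" using G by (simp add: integrable_real_indicator)
  define k where "k = (\<lambda>s. LINT \<xi>|lborel. indicator G \<xi> * (1 - indicator G (s + \<xi>)) :: real)"
  have ik: "integrable lborel (\<lambda>\<xi>. indicator G \<xi> * (1 - indicator G (s + \<xi>)) :: real)" for s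
    by (rule Bochner_Integration.integrable_bound[OF iG]) (auto simp: indicator_def)
  have k0: "(k \<longlongrightarrow> 0) (at 0)"
    unfolding tendsto_at_iff_sequentially
  proof (intro allI impI)
    fix s :: "nat \<Rightarrow> real^'d" assume "s \<longlonglongrightarrow> 0"
    have "(\<lambda>n. LINT \<xi>|lborel. indicator G \<xi> * (1 - indicator G (s n + \<xi>)) :: real) \<longlonglongrightarrow> (LINT \<xi>|(lborel::(real^'d) measure). 0)"
    proof (rule integral_dominated_convergence[OF _ _ iG])
      show "AE \<xi> in lborel. (\<lambda>n. indicator G \<xi> * (1 - indicator G (s n + \<xi>)) :: real) \<longlonglongrightarrow> 0"
      proof (rule AE_I2)
        fix \<xi>
        show "(\<lambda>n. indicator G \<xi> * (1 - indicator G (s n + \<xi>)) :: real) \<longlonglongrightarrow> 0"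
        proof (cases "\<xi> \<in> G")
          case True
          have "(\<lambda>n. s n + \<xi>) \<longlonglongrightarrow> 0 + \<xi>" by (intro tendsto_intros \<open>s \<longlonglongrightarrow> 0\<close>)
          then have "\<forall>\<^sub>F n in sequentially. s n + \<xi> \<in> G"
            using G(1) True by (auto elim: topological_tendstoD)
          then have "\<forall>\<^sub>F n in sequentially. indicator G \<xi> * (1 - indicator G (s n + \<xi>)) = (0::real)"
            by eventually_elim simp
          then show ?thesis by (rule tendsto_eventually)
        qed simp
      qed
    qed (auto simp: indicator_def)
    then show "(k \<circ> s) \<longlonglongrightarrow> 0" by (simp add: k_def o_def)
  qed
  define s where "s = (\<lambda>t::real^'d. (pi / (norm t)\<^sup>2) *\<^sub>R t)"
  have norm_s: "norm (s t) = pi * inverse (norm t)" if "t \<noteq> 0" for t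
    using that by (simp add: s_def power2_eq_square divide_inverse)
  have ev: "\<forall>\<^sub>F t::real^'d in at_infinity. t \<noteq> 0"
    unfolding eventually_at_infinity by (intro exI[of _ 1]) auto
  have s0: "(s \<longlongrightarrow> 0) at_infinity"
  proof (rule tendsto_norm_zero_cancel)
    have "((\<lambda>t::real^'d. pi * inverse (norm t)) \<longlongrightarrow> pi * 0) at_infinity"
      by (rule tendsto_mult[OF tendsto_const tendsto_inverse_0_at_top[OF
            filterlim_at_infinity_imp_norm_at_top[OF filterlim_ident]]])
    moreover have "\<forall>\<^sub>F t in at_infinity. pi * inverse (norm t) = norm (s t)"
      using ev by eventually_elim (simp add: norm_s)
    ultimately show "((\<lambda>t. norm (s t)) \<longlongrightarrow> 0) at_infinity"
      by (auto intro: Lim_transform_eventually)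
  qed
  have s_ne: "\<forall>\<^sub>F t in at_infinity. s t \<noteq> 0" using ev by eventually_elim (simp add: s_def)
  have k1: "((\<lambda>t. k (s t)) \<longlongrightarrow> 0) at_infinity"
    by (rule filterlim_compose[OF k0]) (use s0 s_ne in \<open>simp add: filterlim_at\<close>)
  have k2: "((\<lambda>t. k (- s t)) \<longlongrightarrow> 0) at_infinity"
  proof (rule filterlim_compose[OF k0])
    have "((\<lambda>t. - s t) \<longlongrightarrow> - 0) at_infinity" by (intro tendsto_minus s0)
    then show "filterlim (\<lambda>t. - s t) (at 0) at_infinity" using s_ne by (simp add: filterlim_at)
  qed
  have bound: "cmod (LINT \<xi>|lborel. complex_of_real (indicator G \<xi>) * exp_wave (cvec t) \<xi>) \<le> (k (s t) + k (- s t)) / 2"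
    if t: "t \<noteq> 0" for t
  proof -
    let ?I = "LINT \<xi>|lborel. complex_of_real (indicator G \<xi>) * exp_wave (cvec t) \<xi>"
    have half: "exp_wave (cvec t) (s t + \<xi>) = - exp_wave (cvec t) \<xi>" for \<xi>
    proof -
      have "t \<bullet> s t = pi" using t by (simp add: s_def power2_norm_eq_inner)
      then show ?thesis by (simp add: exp_wave_def inner_add_right distrib_left exp_add)
    qed
    have iC: "integrable lborel (\<lambda>\<xi>. complex_of_real (indicator G \<xi>))" using iG by simp
    have iC': "integrable lborel (\<lambda>\<xi>. complex_of_real (indicator G (s t + \<xi>)))"
      using lborel_integral_shift(2)[of "\<lambda>\<xi>. complex_of_real (indicator G \<xi>)" "s t"] iC by simp
    have iR': "integrable lborel (\<lambda>\<xi>. indicator G (s t + \<xi>) * (1 - indicator G \<xi>) :: real)"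
      using lborel_integral_shift(2)[of "\<lambda>\<xi>. indicator G \<xi> * (1 - indicator G (- s t + \<xi>)) :: real" "s t"] ik[of "- s t"]
      by simp
    have kR': "(LINT \<xi>|lborel. indicator G (s t + \<xi>) * (1 - indicator G \<xi>)) = k (- s t)"
      using lborel_integral_shift(1)[of "\<lambda>\<xi>. indicator G \<xi> * (1 - indicator G (- s t + \<xi>)) :: real" "s t"]
      by (simp add: k_def)
    have "?I = (LINT \<xi>|lborel. complex_of_real (indicator G (s t + \<xi>)) * exp_wave (cvec t) (s t + \<xi>))"
      by (rule lborel_integral_shift(1)[symmetric]) measurable
    also have "\<dots> = - (LINT \<xi>|lborel. complex_of_real (indicator G (s t + \<xi>)) * exp_wave (cvec t) \<xi>)"
      by (simp add: half)
    finally have "2 * ?I = (LINT \<xi>|lborel. (complex_of_real (indicator G \<xi>) - complex_of_real (indicator G (s t + \<xi>))) * exp_wave (cvec t) \<xi>)"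
      using integrable_times_wave[OF iC] integrable_times_wave[OF iC'] by (simp add: left_diff_distrib)
    also have "cmod \<dots> \<le> (LINT \<xi>|lborel. cmod ((complex_of_real (indicator G \<xi>) - complex_of_real (indicator G (s t + \<xi>))) * exp_wave (cvec t) \<xi>))"
      by (rule integral_norm_bound)
    also have "\<dots> = (LINT \<xi>|lborel. indicator G \<xi> * (1 - indicator G (s t + \<xi>)) + indicator G (s t + \<xi>) * (1 - indicator G \<xi>))"
      by (intro Bochner_Integration.integral_cong) (auto simp: norm_mult indicator_def)
    also have "\<dots> = k (s t) + k (- s t)"
      using ik iR' by (simp add: kR' k_def)
    finally show ?thesis by (simp add: norm_mult)
  qed
  have le: "\<forall>\<^sub>F t in at_infinity. norm (LINT \<xi>|lborel. complex_of_real (indicator G \<xi>) * exp_wave (cvec t) \<xi>) \<le> (k (s t) + k (- s t)) / 2"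
    using ev by eventually_elim (rule bound)
  have "((\<lambda>t. (k (s t) + k (- s t)) / 2) \<longlongrightarrow> (0 + 0) / 2) at_infinity"
    by (intro tendsto_intros k1 k2) simp
  then have "((\<lambda>t. (k (s t) + k (- s t)) / 2) \<longlongrightarrow> 0) at_infinity" by simp
  with le show ?thesis unfolding fourier_decays_def by (rule Lim_null_comparison)
qed

text \<open>Outer regularity leads from open sets to measurable sets of finite measure, and approximation in the
  mean leads from there to integrable functions.\<close>

theorem Riemann_Lebesgue:
  fixes w :: "real^'d \<Rightarrow> complex"
  assumes "integrable lborel w"
  shows "fourier_decays w"
  using assms
proof (induction rule: integrable_induct)
  case (base A c)
  have A: "A \<in> sets borel" using base by simp
  have iA: "integrable lborel (indicator A :: real^'d \<Rightarrow> real)" using base by (simp add: integrable_real_indicator)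
  have "fourier_decays (\<lambda>\<xi>. complex_of_real (indicator A \<xi>))"
  proof (rule fourier_decays_L1_limit)
    show "integrable lborel (\<lambda>\<xi>. complex_of_real (indicator A \<xi>))" using iA by simp
    fix e :: real assume e: "e > 0"
    obtain G where G: "open G" "A \<subseteq> G" "emeasure lborel (G - A) < e"
      using outer_regular_lborel[OF A e] by blast
    have GA: "G - A \<in> sets borel" using G A by auto
    have "emeasure lborel G \<le> emeasure lborel A + emeasure lborel (G - A)"
      using emeasure_subadditive[of A lborel "G - A"] A GA G(2) by (simp add: Un_absorb1)
    also have "\<dots> < \<infinity>" using base(2) G(3) by (auto simp: less_top[symmetric] top_unique)
    finally have fG: "emeasure lborel G < \<infinity>" .
    have "(LINT \<xi>|lborel. cmod (complex_of_real (indicator A \<xi>) - complex_of_real (indicator G \<xi>))) = (LINT \<xi>|lborel. indicator (G - A) \<xi>)"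
      using G(2) by (intro Bochner_Integration.integral_cong) (auto simp: indicator_def)
    also have "\<dots> = measure lborel (G - A)" by simp
    also have "\<dots> < e"
    proof -
      have "emeasure lborel (G - A) \<noteq> \<infinity>" using G(3) by (auto simp: top_unique)
      then have "emeasure lborel (G - A) = ennreal (measure lborel (G - A))" by (rule emeasure_eq_ennreal_measure[unfolded infinity_ennreal_def[symmetric]])
      then show ?thesis using G(3) by (simp add: ennreal_less_iff)
    qed
    finally show "\<exists>v. integrable lborel v \<and> fourier_decays v \<and> (LINT \<xi>|lborel. cmod (complex_of_real (indicator A \<xi>) - v \<xi>)) < e"
      using fourier_decays_open[OF G(1) fG] G(1) fG
      by (intro exI[of _ "\<lambda>\<xi>. complex_of_real (indicator G \<xi>)"]) (simp add: integrable_real_indicator)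
  qed
  then have "((\<lambda>t. c * (LINT \<xi>|lborel. complex_of_real (indicator A \<xi>) * exp_wave (cvec t) \<xi>)) \<longlongrightarrow> c * 0) at_infinity"
    unfolding fourier_decays_def by (intro tendsto_intros)
  then show ?case
    unfolding fourier_decays_def
    by (simp add: scaleR_conv_of_real mult_ac flip: integral_mult_right_zero)
next
  case (add f g)
  have "((\<lambda>t. (LINT \<xi>|lborel. f \<xi> * exp_wave (cvec t) \<xi>) + (LINT \<xi>|lborel. g \<xi> * exp_wave (cvec t) \<xi>)) \<longlongrightarrow> 0 + 0) at_infinity"
    using add unfolding fourier_decays_def by (intro tendsto_add)
  then show ?case
    using integrable_times_wave[of f] integrable_times_wave[of g] add
    unfolding fourier_decays_def by (simp add: distrib_right)
next
  case (lim f s)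
  show ?case
  proof (rule fourier_decays_L1_limit[OF lim(4)])
    fix e :: real assume e: "e > 0"
    have "(\<lambda>n. LINT \<xi>|lborel. cmod (f \<xi> - s n \<xi>)) \<longlonglongrightarrow> (LINT \<xi>|(lborel::(real^'d) measure). 0)"
    proof (rule integral_dominated_convergence[where w="\<lambda>\<xi>. 3 * norm (f \<xi>)"])
      show "(\<lambda>\<xi>. cmod (f \<xi> - s n \<xi>)) \<in> borel_measurable lborel" for n
        using lim(1)[of n] lim(4) by (auto dest!: borel_measurable_integrable)
      show "integrable lborel (\<lambda>\<xi>. 3 * norm (f \<xi>))" using lim(4) by simp
      show "AE \<xi> in lborel. (\<lambda>n. cmod (f \<xi> - s n \<xi>)) \<longlonglongrightarrow> 0"
      proof (rule AE_I2)
        fix \<xi> :: "real^'d" assume "\<xi> \<in> space lborel"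
        then have "(\<lambda>n. cmod (f \<xi> - s n \<xi>)) \<longlonglongrightarrow> cmod (f \<xi> - f \<xi>)" by (intro tendsto_intros lim(2))
        then show "(\<lambda>n. cmod (f \<xi> - s n \<xi>)) \<longlonglongrightarrow> 0" by simp
      qed
      show "AE \<xi> in lborel. norm (cmod (f \<xi> - s n \<xi>)) \<le> 3 * norm (f \<xi>)" for n
      proof (rule AE_I2)
        fix \<xi> :: "real^'d" assume "\<xi> \<in> space lborel"
        then show "norm (cmod (f \<xi> - s n \<xi>)) \<le> 3 * norm (f \<xi>)"
          using lim(3)[of \<xi> n] norm_triangle_ineq4[of "f \<xi>" "s n \<xi>"] by simp
      qed
    qed simp
    then have "\<forall>\<^sub>F n in sequentially. (LINT \<xi>|lborel. cmod (f \<xi> - s n \<xi>)) < e"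
      using e by (auto elim: order_tendstoD(2))
    then obtain n where "(LINT \<xi>|lborel. cmod (f \<xi> - s n \<xi>)) < e"
      unfolding eventually_sequentially by blast
    then show "\<exists>v. integrable lborel v \<and> fourier_decays v \<and> (LINT \<xi>|lborel. cmod (f \<xi> - v \<xi>)) < e"
      using lim(1) lim(5) by blast
  qed
qed

lemma power_le_fact_exp:
  assumes "(y::real) \<ge> 0"
  shows "y ^ n \<le> fact n * exp y"
proof -
  have s: "(\<lambda>k. y ^ k / fact k) sums exp y"
    using exp_converges[of y] by (simp add: divide_inverse mult.commute)
  have "(\<Sum>k\<in>{n}. y ^ k / fact k) \<le> exp y"
    using sum_le_suminf[OF sums_summable[OF s], of "{n}"] assms sums_unique[OF s] by simp
  then show ?thesis by (simp add: divide_le_eq mult.commute)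
qed

text \<open>Comparison with a series of indicator functions of balls, whose volumes grow only polynomially.\<close>

lemma exp_norm_integrable:
  fixes c :: real assumes c: "c > 0"
  shows "integrable lborel (\<lambda>\<xi>::'a::euclidean_space. exp (- c * norm \<xi>))"
proof (rule integrableI_nonneg)
  define D where "D = DIM('a)"
  define g where "g = (\<lambda>(n::nat) \<xi>::'a. ennreal (exp (- c * real n)) * indicator (cball 0 (real n + 1)) \<xi>)"
  have le: "ennreal (exp (- c * norm \<xi>)) \<le> (\<Sum>n. g n \<xi>)" for \<xi> :: 'a
  proof -
    define n where "n = nat \<lfloor>norm \<xi>\<rfloor>"
    have n: "real n \<le> norm \<xi>" "norm \<xi> \<le> real n + 1" unfolding n_def by (simp_all add: floor_le_iff)
    have "ennreal (exp (- c * norm \<xi>)) \<le> g n \<xi>" using n c by (simp add: g_def ennreal_leI)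
    also have "\<dots> \<le> (\<Sum>n. g n \<xi>)" using sum_le_suminf[of "\<lambda>n. g n \<xi>" "{n}"] by simp
    finally show ?thesis .
  qed
  have sm: "summable (\<lambda>n. exp (- c * real n) * (unit_ball_vol D * (real n + 1) ^ D))"
  proof (rule summable_comparison_test')
    define K where "K = unit_ball_vol D * ((2 / c) ^ D * (fact D * exp (c / 2)))"
    show "summable (\<lambda>n. K * exp (- c / 2) ^ n)" using c by (intro summable_mult summable_geometric) simp
    fix n :: nat
    have "(c / 2 * (real n + 1)) ^ D \<le> fact D * exp (c / 2 * (real n + 1))"
      using c by (intro power_le_fact_exp) simp
    then have "(2 / c) ^ D * (c / 2 * (real n + 1)) ^ D \<le> (2 / c) ^ D * (fact D * exp (c / 2 * (real n + 1)))"
      using c by (intro mult_left_mono) auto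
    moreover have "(2 / c) ^ D * (c / 2 * (real n + 1)) ^ D = (real n + 1) ^ D"
    proof -
      have "2 / c * (c / 2 * (real n + 1)) = real n + 1" using c by simp
      then show ?thesis by (simp only: power_mult_distrib[symmetric])
    qed
    ultimately have p: "(real n + 1) ^ D \<le> (2 / c) ^ D * (fact D * exp (c / 2 * (real n + 1)))"
      by (simp only:)
    have "norm (exp (- c * real n) * (unit_ball_vol D * (real n + 1) ^ D))
        = exp (- c * real n) * (unit_ball_vol D * (real n + 1) ^ D)" by simp
    also have "\<dots> \<le> exp (- c * real n) * (unit_ball_vol D * ((2 / c) ^ D * (fact D * exp (c / 2 * (real n + 1)))))"
      by (intro mult_left_mono p) auto
    also have "\<dots> = unit_ball_vol D * ((2 / c) ^ D * (fact D * (exp (- c * real n) * exp (c / 2 * (real n + 1)))))"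
      by (simp only: mult_ac)
    also have "exp (- c * real n) * exp (c / 2 * (real n + 1)) = exp (c / 2) * exp (- c / 2) ^ n"
    proof -
      have "- c * real n + c / 2 * (real n + 1) = c / 2 + real n * (- c / 2)" by (simp add: field_simps)
      then show ?thesis by (metis exp_add exp_of_nat_mult)
    qed
    finally show "norm (exp (- c * real n) * (unit_ball_vol D * (real n + 1) ^ D)) \<le> K * exp (- c / 2) ^ n"
      by (simp add: K_def mult.assoc)
  qed
  have "(\<integral>\<^sup>+\<xi>. ennreal (exp (- c * norm (\<xi>::'a))) \<partial>lborel) \<le> (\<integral>\<^sup>+\<xi>. (\<Sum>n. g n \<xi>) \<partial>lborel)"
    by (intro nn_integral_mono le)
  also have "\<dots> = (\<Sum>n. \<integral>\<^sup>+\<xi>. g n \<xi> \<partial>lborel)"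
    unfolding g_def
    by (intro nn_integral_suminf borel_measurable_times_ennreal borel_measurable_const borel_measurable_indicator) simp
  also have "\<dots> = (\<Sum>n. ennreal (exp (- c * real n) * (unit_ball_vol D * (real n + 1) ^ D)))"
    by (intro suminf_cong) (simp add: g_def nn_integral_cmult_indicator emeasure_cball D_def ennreal_mult)
  also have "\<dots> = ennreal (\<Sum>n. exp (- c * real n) * (unit_ball_vol D * (real n + 1) ^ D))"
    by (intro suminf_ennreal2 sm) auto
  also have "\<dots> < \<infinity>" by simp
  finally show "(\<integral>\<^sup>+\<xi>. ennreal (exp (- c * norm (\<xi>::'a))) \<partial>lborel) < \<infinity>" .
qed auto

section \<open>The spectral measure of a translation kernel\<close>

context decaying_measure
begin

text \<open>Expanding the square gives the Gram matrix of the waves, whose entries are values of the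
  characteristic function.\<close>

lemma l2norm_wave_sum:
  assumes "finite S"
  shows "(l2norm M (\<lambda>\<xi>. \<Sum>x\<in>S. c x * exp_wave (cvec (p x)) \<xi>))\<^sup>2
    = Re (\<Sum>x\<in>S. \<Sum>y\<in>S. c x * cnj (c y) * char_fun M (p x - p y))"
proof -
  define g where "g = (\<lambda>\<xi>. \<Sum>x\<in>S. c x * exp_wave (cvec (p x)) \<xi>)"
  have e: "exp_wave (cvec x) \<xi> * cnj (exp_wave (cvec y) \<xi>) = exp_wave (cvec (x - y)) \<xi>" for x y \<xi> :: "real^'d"
    by (simp add: cnj_exp_wave_cvec flip: exp_wave_add cvec_add)
  have sq: "complex_of_real ((cmod (g \<xi>))\<^sup>2) = (\<Sum>x\<in>S. \<Sum>y\<in>S. c x * cnj (c y) * exp_wave (cvec (p x - p y)) \<xi>)" for \<xi>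
  proof -
    have "complex_of_real ((cmod (g \<xi>))\<^sup>2) = g \<xi> * cnj (g \<xi>)" by (rule complex_norm_square)
    also have "\<dots> = (\<Sum>x\<in>S. \<Sum>y\<in>S. (c x * exp_wave (cvec (p x)) \<xi>) * (cnj (c y) * cnj (exp_wave (cvec (p y)) \<xi>)))"
      by (simp add: g_def sum_product)
    finally show ?thesis by (simp add: mult_ac flip: e)
  qed
  have "complex_of_real ((l2norm M g)\<^sup>2) = (LINT \<xi>|M. complex_of_real ((cmod (g \<xi>))\<^sup>2))"
    unfolding l2norm_square by (rule integral_complex_of_real[symmetric])
  also have "\<dots> = (\<Sum>x\<in>S. \<Sum>y\<in>S. c x * cnj (c y) * char_fun M (p x - p y))"
    unfolding sq char_fun_def using wave_integrable by simp
  finally show ?thesis unfolding g_def by (metis Re_complex_of_real)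
qed

end

text \<open>The scaling makes the Fourier transform of the weight the characteristic function of this measure.\<close>

definition spectral_measure :: "(real^'d \<Rightarrow> real) \<Rightarrow> (real^'d) measure" where
  "spectral_measure w = distr (density lborel (\<lambda>\<xi>. ennreal (w \<xi>))) borel (\<lambda>\<xi>. (- 2 * pi) *\<^sub>R \<xi>)"

lemma spectral_measure_integral:
  fixes g :: "real^'d \<Rightarrow> 'b::{banach, second_countable_topology}"
  assumes w: "w \<in> borel_measurable borel" "\<And>\<xi>. 0 \<le> w \<xi>" and g: "g \<in> borel_measurable borel"
  shows "integrable (spectral_measure w) g \<longleftrightarrow> integrable lborel (\<lambda>\<xi>. w \<xi> *\<^sub>R g ((- 2 * pi) *\<^sub>R \<xi>))"
    and "(LINT \<xi>|spectral_measure w. g \<xi>) = (LINT \<xi>|lborel. w \<xi> *\<^sub>R g ((- 2 * pi) *\<^sub>R \<xi>))"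
proof -
  have m: "(\<lambda>\<xi>::real^'d. g ((- 2 * pi) *\<^sub>R \<xi>)) \<in> borel_measurable borel"
    by (rule measurable_compose[OF _ g]) measurable
  have s: "(\<lambda>\<xi>::real^'d. (- 2 * pi) *\<^sub>R \<xi>) \<in> measurable (density lborel (\<lambda>\<xi>. ennreal (w \<xi>))) borel"
    by measurable
  show "integrable (spectral_measure w) g \<longleftrightarrow> integrable lborel (\<lambda>\<xi>. w \<xi> *\<^sub>R g ((- 2 * pi) *\<^sub>R \<xi>))"
    unfolding spectral_measure_def integrable_distr_eq[OF s g]
    by (rule integrable_density) (use m w in auto)
  show "(LINT \<xi>|spectral_measure w. g \<xi>) = (LINT \<xi>|lborel. w \<xi> *\<^sub>R g ((- 2 * pi) *\<^sub>R \<xi>))"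
    unfolding spectral_measure_def integral_distr[OF s g]
    by (rule integral_density) (use m w in auto)
qed

lemma char_fun_spectral_measure:
  assumes "w \<in> borel_measurable borel" "\<And>\<xi>. 0 \<le> w \<xi>"
  shows "char_fun (spectral_measure w) t = (LINT \<xi>|lborel. complex_of_real (w \<xi>) * exp_wave (cvec ((- 2 * pi) *\<^sub>R t)) \<xi>)"
  unfolding char_fun_def spectral_measure_integral(2)[OF assms exp_wave_measurable]
  by (intro Bochner_Integration.integral_cong) (auto simp: exp_wave_def scaleR_conv_of_real[where 'a=complex])

lemma decaying_spectral_measure:
  fixes w :: "real^'d \<Rightarrow> real"
  assumes w: "w \<in> borel_measurable borel" "\<And>\<xi>. 0 \<le> w \<xi>" "integrable lborel w"
    and nz: "\<not> (AE \<xi> in lborel. w \<xi> = 0)"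
    and a: "a > 0" and decay: "AE \<xi> in lborel. w \<xi> \<le> L * exp (- (4 * pi * a * norm \<xi>))"
  shows "decaying_measure (spectral_measure w) a"
proof -
  let ?M = "spectral_measure w"
  have meas: "measure ?M (space ?M) = (LINT \<xi>|lborel. w \<xi>)"
    using spectral_measure_integral(2)[OF w(1,2), of "\<lambda>_. 1::real"] by simp
  interpret finite_measure ?M
  proof (rule finite_measureI)
    have "integrable ?M (\<lambda>_. 1::real)"
      using spectral_measure_integral(1)[OF w(1,2), of "\<lambda>_. 1::real"] w(3) by simp
    then show "emeasure ?M (space ?M) \<noteq> \<infinity>"
      by (simp add: integrable_iff_bounded less_top)
  qed
  show ?thesis
  proof unfold_locales
    show "sets ?M = sets borel" by (simp add: spectral_measure_def)
    show "a > 0" by (rule a)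
    show "integrable ?M (\<lambda>\<xi>. exp (2 * b * norm \<xi>))" if b: "b < a" for b
    proof -
      have "integrable lborel (\<lambda>\<xi>::real^'d. w \<xi> *\<^sub>R exp (2 * b * norm ((- 2 * pi) *\<^sub>R \<xi>)))"
      proof (rule Bochner_Integration.integrable_bound)
        show "integrable lborel (\<lambda>\<xi>::real^'d. L * exp (- (4 * pi * (a - b)) * norm \<xi>))"
          by (rule integrable_mult_right, rule exp_norm_integrable) (use b in simp)
        show "(\<lambda>\<xi>::real^'d. w \<xi> *\<^sub>R exp (2 * b * norm ((- 2 * pi) *\<^sub>R \<xi>))) \<in> borel_measurable lborel"
          using w(1) by measurable
        show "AE \<xi> in lborel. norm (w \<xi> *\<^sub>R exp (2 * b * norm ((- 2 * pi) *\<^sub>R \<xi>)))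
            \<le> norm (L * exp (- (4 * pi * (a - b)) * norm \<xi>))"
          using decay
        proof eventually_elim
          case (elim \<xi>)
          have "norm (w \<xi> *\<^sub>R exp (2 * b * norm ((- 2 * pi) *\<^sub>R \<xi>))) = w \<xi> * exp (4 * pi * b * norm \<xi>)"
            using w(2)[of \<xi>] by (simp add: mult_ac)
          also have "\<dots> \<le> L * exp (- (4 * pi * a * norm \<xi>)) * exp (4 * pi * b * norm \<xi>)"
            using elim by (intro mult_right_mono) auto
          also have "\<dots> = L * exp (- (4 * pi * (a - b)) * norm \<xi>)"
            by (simp add: mult.assoc algebra_simps flip: exp_add)
          also have "\<dots> \<le> norm (L * exp (- (4 * pi * (a - b)) * norm \<xi>))" by simp
          finally show ?case .
        qed
      qed
      then show ?thesis
        by (subst spectral_measure_integral(1)[OF w(1,2)]) auto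
    qed
    show "measure ?M (space ?M) > 0"
    proof -
      have "(LINT \<xi>|lborel. w \<xi>) \<noteq> 0"
        using integral_nonneg_eq_0_iff_AE[OF w(3)] w(2) nz by simp
      moreover have "(LINT \<xi>|lborel. w \<xi>) \<ge> 0" using w(2) by simp
      ultimately show ?thesis unfolding meas by simp
    qed
    have "((\<lambda>t. LINT \<xi>|lborel. complex_of_real (w \<xi>) * exp_wave (cvec t) \<xi>) \<longlongrightarrow> 0) at_infinity"
      using Riemann_Lebesgue[of "\<lambda>\<xi>. complex_of_real (w \<xi>)"] w(3) by (simp add: fourier_decays_def)
    moreover have "filterlim (\<lambda>t::real^'d. (- 2 * pi) *\<^sub>R t) at_infinity at_infinity"
    proof (rule filterlim_norm_at_top_imp_at_infinity)
      have "filterlim (\<lambda>t::real^'d. (2 * pi) * norm t) at_top at_infinity"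
        by (rule filterlim_tendsto_pos_mult_at_top[OF tendsto_const _
              filterlim_at_infinity_imp_norm_at_top[OF filterlim_ident]]) simp
      then show "filterlim (\<lambda>t::real^'d. norm ((- 2 * pi) *\<^sub>R t)) at_top at_infinity" by simp
    qed
    ultimately have "((\<lambda>t. LINT \<xi>|lborel. complex_of_real (w \<xi>) * exp_wave (cvec ((- 2 * pi) *\<^sub>R t)) \<xi>) \<longlongrightarrow> 0) at_infinity"
      by (rule filterlim_compose)
    then show "(char_fun ?M \<longlongrightarrow> 0) at_infinity"
      by (simp add: char_fun_spectral_measure[OF w(1,2), abs_def])
  qed
qed

lemma translation_kernel_spectral:
  fixes w w1 :: "real^'d \<Rightarrow> real"
  assumes w1: "w1 \<in> borel_measurable borel" "\<And>\<xi>. 0 \<le> w1 \<xi>"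
    and w: "w \<in> borel_measurable lebesgue" and ae: "AE \<xi> in lebesgue. w \<xi> = w1 \<xi>"
  shows "translation_kernel w x y = char_fun (spectral_measure w1) (x - y)"
proof -
  let ?E = "\<lambda>\<xi>. exp (- (2 * complex_of_real pi * \<i> * of_real (\<xi> \<bullet> (x - y))))"
  have E: "exp_wave (cvec ((- 2 * pi) *\<^sub>R (x - y))) \<xi> = ?E \<xi>" for \<xi>
    by (simp add: exp_wave_def inner_commute mult_ac)
  have Em: "?E \<in> borel_measurable borel" unfolding E[symmetric] by measurable
  then have Em': "?E \<in> borel_measurable lebesgue" by (simp add: measurable_completion)
  have w1': "w1 \<in> borel_measurable lebesgue" using w1 by (simp add: measurable_completion)
  have "translation_kernel w x y = (LINT \<xi>|lebesgue. of_real (w \<xi>) * ?E \<xi>)"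
    by (simp add: translation_kernel_def fourier_def)
  also have "\<dots> = (LINT \<xi>|lebesgue. of_real (w1 \<xi>) * ?E \<xi>)"
  proof (rule integral_cong_AE)
    show "(\<lambda>\<xi>. of_real (w \<xi>) * ?E \<xi>) \<in> borel_measurable lebesgue"
      using w Em' by (intro borel_measurable_times) auto
    show "(\<lambda>\<xi>. of_real (w1 \<xi>) * ?E \<xi>) \<in> borel_measurable lebesgue"
      using w1' Em' by (intro borel_measurable_times) auto
    show "AE \<xi> in lebesgue. of_real (w \<xi>) * ?E \<xi> = of_real (w1 \<xi>) * ?E \<xi>"
      using ae by eventually_elim simp
  qed
  also have "\<dots> = (LINT \<xi>|lborel. of_real (w1 \<xi>) * ?E \<xi>)"
    using w1 Em by (intro integral_completion borel_measurable_times) auto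
  finally show ?thesis unfolding char_fun_spectral_measure[OF w1] E .
qed

theorem theorem4:
  fixes w :: "real^'d \<Rightarrow> real"
    and n :: nat
    and a :: real
    and H H' :: "(real^'d \<Rightarrow> complex) set"
    and ip ip' :: "(real^'d \<Rightarrow> complex) \<Rightarrow> (real^'d \<Rightarrow> complex) \<Rightarrow> complex"
    and U :: "(real^'d) set"
    and f :: "real^'d \<Rightarrow> real^'d"
  assumes "integrable lebesgue w"
    and "ess_bounded w"
    and "AE \<xi> in lebesgue. 0 \<le> w \<xi>"
    and "\<not> (AE \<xi> in lebesgue. w \<xi> = 0)"
    and "n > 0" and "a > 0"
    and "decay_condition n a w"
    and "rkhs UNIV (translation_kernel w) H ip"
    and "open U"
    and "rkhs U (translation_kernel w) H' ip'"
    and "comp_dom U f H H' = H"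
    and "bounded_on (comp_dom U f H H') ip ip' (comp_op U f)"
  shows "\<exists>F :: complex^'d \<Rightarrow> complex^'d.
           holomorphic_map_on F (tube a) \<and> (\<forall>x\<in>U. F (cvec x) = cvec (f x))"
proof (cases "U = {}")
  case True
  have "holomorphic_map_on (\<lambda>z::complex^'d. 0 :: complex^'d) (tube a)"
    unfolding holomorphic_map_on_def by (auto intro!: exI[of _ "\<lambda>_. 0"])
  then show ?thesis using True by blast
next
  case False
  have wm: "w \<in> borel_measurable lebesgue" using assms(1) by simp
  obtain w0 where w0: "w0 \<in> borel_measurable lborel" "AE \<xi> in lborel. w \<xi> = w0 \<xi>"
    using completion_ex_borel_measurable_real[OF wm] by blast
  \<comment> \<open>A Borel representative that is non-negative everywhere can serve as a density.\<close>
  define w1 where "w1 = (\<lambda>\<xi>. max 0 (w0 \<xi>))"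
  have w1: "w1 \<in> borel_measurable borel" "\<And>\<xi>. 0 \<le> w1 \<xi>" using w0(1) by (auto simp: w1_def)
  have "AE \<xi> in lborel. 0 \<le> w \<xi>" using assms(3) by (simp add: AE_completion_iff)
  with w0(2) have ae: "AE \<xi> in lborel. w \<xi> = w1 \<xi>" by eventually_elim (simp add: w1_def)
  then have ae': "AE \<xi> in lebesgue. w \<xi> = w1 \<xi>" by (simp add: AE_completion_iff)
  have "integrable lebesgue w1"
    using integrable_cong_AE[OF wm _ ae'] assms(1) w1(1) by (simp add: measurable_completion)
  then have w1_int: "integrable lborel w1" using w1(1) by (simp add: integrable_completion)
  have w1_nz: "\<not> (AE \<xi> in lborel. w1 \<xi> = 0)"
  proof
    assume "AE \<xi> in lborel. w1 \<xi> = 0"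
    with ae have "AE \<xi> in lborel. w \<xi> = 0" by eventually_elim simp
    then show False using assms(4) by (simp add: AE_completion_iff)
  qed
  obtain L where L: "L > 0" "AE \<xi> in lebesgue. w \<xi> \<le> L * inverse (1 + norm \<xi> powr (2 * real n + real CARD('d) + 1))
      * exp (- (4 * pi * a * norm \<xi>))"
    using assms(7)[unfolded decay_condition_def, rule_format, OF zero_less_one] by blast
  have "AE \<xi> in lborel. w1 \<xi> \<le> L * exp (- (4 * pi * a * norm \<xi>))"
    using L(2)[unfolded AE_completion_iff] ae
  proof eventually_elim
    case (elim \<xi>)
    have "inverse (1 + norm \<xi> powr (2 * real n + real CARD('d) + 1)) \<le> 1"
      by (rule inverse_le_1_iff[THEN iffD2]) simp
    then have "L * inverse (1 + norm \<xi> powr (2 * real n + real CARD('d) + 1)) \<le> L * 1"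
      using L(1) by (intro mult_left_mono) auto
    then have "L * inverse (1 + norm \<xi> powr (2 * real n + real CARD('d) + 1)) * exp (- (4 * pi * a * norm \<xi>))
        \<le> L * exp (- (4 * pi * a * norm \<xi>))"
      by (simp add: mult_right_mono)
    then show ?case using elim by linarith
  qed
  then have dm: "decaying_measure (spectral_measure w1) a"
    by (rule decaying_spectral_measure[OF w1 w1_int w1_nz assms(6)])
  interpret D: decaying_measure "spectral_measure w1" a by (rule dm)
  let ?M = "spectral_measure w1"
  obtain C where C: "C \<ge> 0" "\<And>S c. finite S \<Longrightarrow> S \<subseteq> U \<Longrightarrow>
      Re (\<Sum>x\<in>S. \<Sum>y\<in>S. c x * cnj (c y) * translation_kernel w (f x) (f y))
        \<le> C\<^sup>2 * Re (\<Sum>x\<in>S. \<Sum>y\<in>S. c x * cnj (c y) * translation_kernel w x y)"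
    using bounded_comp_op_kernel_bound[OF assms(8,10,11,12)] by auto
  have bound: "l2norm ?M (\<lambda>\<xi>. \<Sum>x\<in>S. c x * exp_wave (cvec (f x)) \<xi>)
         \<le> C * l2norm ?M (\<lambda>\<xi>. \<Sum>x\<in>S. c x * exp_wave (cvec x) \<xi>)"
    if "finite S" "S \<subseteq> U" for S c
  proof (rule power2_le_imp_le)
    show "(l2norm ?M (\<lambda>\<xi>. \<Sum>x\<in>S. c x * exp_wave (cvec (f x)) \<xi>))\<^sup>2
         \<le> (C * l2norm ?M (\<lambda>\<xi>. \<Sum>x\<in>S. c x * exp_wave (cvec x) \<xi>))\<^sup>2"
      using C(2)[OF that, of c]
      unfolding power_mult_distrib D.l2norm_wave_sum[OF that(1)] translation_kernel_spectral[OF w1 wm ae'] .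
  qed (use C(1) in simp)
  obtain \<kappa> :: "'d \<Rightarrow> real^'d \<Rightarrow> real" and K where \<kappa>: "\<And>j. \<kappa> j \<in> borel_measurable borel"
    "\<And>j \<xi>. \<bar>\<kappa> j \<xi>\<bar> \<le> K" "\<And>j v. (LINT \<xi>|?M. \<kappa> j \<xi> * (v \<bullet> \<xi>)) = v $ j"
    using D.dual_weights by blast
  interpret dual_wave_transfer ?M a U f C \<kappa> K
    by unfold_locales (use assms(9) False C(1) bound \<kappa> in auto)
  show ?thesis by (rule holomorphic_extension)
qed

end
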